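(* A random sup-measure $X$ on $E$ that is a.s. not the zero sup-measure is a CRSM if and only if $X\overset{d}{=}\bigvee_{i\ge1}\Gamma_i^{-1}Y_i$ (as processes indexed by $\mathcal K$), where $\{\Gamma_i\}$ are the successive points of a unit intensity Poisson process on $(0,\infty)$ and $\{Y_i\}$ are i.i.d. copies, independent of $\{\Gamma_i\}$, of an integrable random sup-measure $Y$ whose distribution is supported by the family of non-zero scaled indicator sup-measures $K\mapsto c\,\mathbf 1_{F\cap K\neq\emptyset}$ with $c>0$ and $F$ a non-empty closed subset of $E$. In this case the extremal coefficient functional of $X$ is $\theta(K)=\mathbb E\,Y(K)$, $K\in\mathcal K$.
   Context: $E$ is a locally compact Hausdorff second countable space; $\mathcal K$ its compact subsets. A sup-measure on $E$ is a Choquet capacity $\varphi$ (non-decreasing, $\varphi(\emptyset)=0$, $\varphi(A_n)\uparrow\varphi(A)$ if $A_n\uparrow A$, $\varphi(K_n)\downarrow\varphi(K)$ for compact $K_n\downarrow K$), finite on compacts, with $\varphi(\bigcup_j G_j)=\sup_j\varphi(G_j)$ for all families of open sets; a random sup-measure is a random element of the space of sup-measures (Borel $\sigma$-algebra of the sup-vague topology); it is integrable if $\mathbb E\,Y(K)<\infty$ for all $K\in\mathcal K$. $\mathrm{USC}$: bounded non-negative upper semicontinuous functions with relatively compact support. Extremal integral $\int^e f\,d\varphi=\sup\{\varphi(K)\inf_{x\in K}f(x):K\in\mathcal K\}$. Unit Fréchet with scale $a\ge0$: distribution function $\exp(-a/t)$, $t>0$. $X$ is max-stable if $\bigvee_iu_iX(K_i)$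 is unit Fréchet for all $K_i\in\mathcal K$, $u_i\ge0$; tail dependence functional $\ell(f)$ = scale of $\int^e f\,dX$; extremal coefficient functional $\theta(K)=\ell(\mathbf 1_K)$. $X$ is a CRSM if it is max-stable and $\ell(f+g)=\ell(f)+\ell(g)$ for all $f,g\in\mathrm{USC}$ with $(f(x)-f(y))(g(x)-g(y))\ge0$ for all $x,y$. *)

theory Defs
  imports "HOL-Probability.Probability"
begin

definition sup_measure :: "('a::topological_space set \<Rightarrow> ennreal) \<Rightarrow> bool" where
  "sup_measure \<phi> \<longleftrightarrow>
     (\<forall>A B. A \<subseteq> B \<longrightarrow> \<phi> A \<le> \<phi> B) \<and>
     \<phi> {} = 0 \<and>
     (\<forall>A :: nat \<Rightarrow> 'a set. incseq A \<longrightarrow> (\<lambda>n. \<phi> (A n)) \<longlonglongrightarrow> \<phi> (\<Union>n. A n)) \<and>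
     (\<forall>K :: nat \<Rightarrow> 'a set. (\<forall>n. compact (K n)) \<and> decseq K \<longrightarrow>
        (\<lambda>n. \<phi> (K n)) \<longlonglongrightarrow> \<phi> (\<Inter>n. K n)) \<and>
     (\<forall>K. compact K \<longrightarrow> \<phi> K < \<infinity>) \<and>
     (\<forall>\<G>. (\<forall>G\<in>\<G>. open G) \<longrightarrow> \<phi> (\<Union>\<G>) = (SUP G\<in>\<G>. \<phi> G))"

text \<open>The measurable space of sup-measures: the sigma-algebra generated by the evaluation
  maps at compact sets (this is the Borel sigma-algebra of the sup-vague topology).\<close>

definition SM :: "('a::topological_space set \<Rightarrow> ennreal) measure" where
  "SM = sigma (Collect sup_measure)
     (\<Union>K\<in>{K. compact K}. {(\<lambda>\<phi>. \<phi> K) -` B \<inter> Collect sup_measure | B. B \<in> sets borel})"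

definition random_sup_measure :: "'m measure \<Rightarrow> ('m \<Rightarrow> 'a::topological_space set \<Rightarrow> ennreal) \<Rightarrow> bool" where
  "random_sup_measure M X \<longleftrightarrow> X \<in> measurable M SM"

definition integrable_rsm :: "'m measure \<Rightarrow> ('m \<Rightarrow> 'a::topological_space set \<Rightarrow> ennreal) \<Rightarrow> bool" where
  "integrable_rsm M Y \<longleftrightarrow> random_sup_measure M Y \<and>
     (\<forall>K. compact K \<longrightarrow> (\<integral>\<^sup>+ \<omega>. Y \<omega> K \<partial>M) < \<infinity>)"

definition scaled_indicator_sm :: "real \<Rightarrow> 'a set \<Rightarrow> 'a set \<Rightarrow> ennreal" where
  "scaled_indicator_sm c F = (\<lambda>K. if F \<inter> K \<noteq> {} then ennreal c else 0)"

definition usc_fun :: "('a::topological_space \<Rightarrow> real) \<Rightarrow> bool" where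
  "usc_fun f \<longleftrightarrow> (\<forall>a. open {x. f x < a})"

definition USC :: "('a::topological_space \<Rightarrow> real) set" where
  "USC = {f. bounded (range f) \<and> (\<forall>x. 0 \<le> f x) \<and> usc_fun f \<and>
              compact (closure {x. f x \<noteq> 0})}"

definition extremal_integral :: "('a::topological_space \<Rightarrow> real) \<Rightarrow> ('a set \<Rightarrow> ennreal) \<Rightarrow> ennreal" where
  "extremal_integral f \<phi> = (SUP K\<in>{K. compact K}. \<phi> K * (INF x\<in>K. ennreal (f x)))"

definition unit_frechet :: "'m measure \<Rightarrow> ('m \<Rightarrow> ennreal) \<Rightarrow> real \<Rightarrow> bool" where
  "unit_frechet M V a \<longleftrightarrow> 0 \<le> a \<and> V \<in> borel_measurable M \<and>
     (\<forall>t::real. 0 < t \<longrightarrow> measure M {\<omega>\<in>space M. V \<omega> \<le> ennreal t} = exp (- a / t))"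

definition frechet_scale :: "'m measure \<Rightarrow> ('m \<Rightarrow> ennreal) \<Rightarrow> real" where
  "frechet_scale M V = (THE a. unit_frechet M V a)"

definition max_stable :: "'m measure \<Rightarrow> ('m \<Rightarrow> 'a::topological_space set \<Rightarrow> ennreal) \<Rightarrow> bool" where
  "max_stable M X \<longleftrightarrow>
     (\<forall>(n::nat) (K :: nat \<Rightarrow> 'a set) (u :: nat \<Rightarrow> real).
        (\<forall>i<n. compact (K i) \<and> 0 \<le> u i) \<longrightarrow>
        (\<exists>a. unit_frechet M (\<lambda>\<omega>. SUP i\<in>{..<n}. ennreal (u i) * X \<omega> (K i)) a))"

definition tail_dep :: "'m measure \<Rightarrow> ('m \<Rightarrow> 'a::topological_space set \<Rightarrow> ennreal) \<Rightarrow> ('a \<Rightarrow> real) \<Rightarrow> real" where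
  "tail_dep M X f = frechet_scale M (\<lambda>\<omega>. extremal_integral f (X \<omega>))"

definition ext_coeff :: "'m measure \<Rightarrow> ('m \<Rightarrow> 'a::topological_space set \<Rightarrow> ennreal) \<Rightarrow> 'a set \<Rightarrow> real" where
  "ext_coeff M X K = tail_dep M X (indicator K)"

definition CRSM :: "'m measure \<Rightarrow> ('m \<Rightarrow> 'a::topological_space set \<Rightarrow> ennreal) \<Rightarrow> bool" where
  "CRSM M X \<longleftrightarrow> max_stable M X \<and>
     (\<forall>f\<in>USC. \<forall>g\<in>USC. (\<forall>x y. 0 \<le> (f x - f y) * (g x - g y)) \<longrightarrow>
        tail_dep M X (\<lambda>x. f x + g x) = tail_dep M X f + tail_dep M X g)"

definition unit_poisson_points :: "'m measure \<Rightarrow> ('m \<Rightarrow> nat \<Rightarrow> real) \<Rightarrow> bool" where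
  "unit_poisson_points N \<Gamma> \<longleftrightarrow>
     \<Gamma> \<in> measurable N (PiM UNIV (\<lambda>_. borel)) \<and>
     (AE \<omega> in N. strict_mono (\<Gamma> \<omega>) \<and> 0 < \<Gamma> \<omega> 0 \<and> filterlim (\<Gamma> \<omega>) at_top sequentially) \<and>
     (\<forall>(n::nat) (B :: nat \<Rightarrow> real set).
        (\<forall>j<n. B j \<in> sets borel \<and> bounded (B j) \<and> B j \<subseteq> {0<..}) \<and> disjoint_family_on B {..<n} \<longrightarrow>
        prob_space.indep_vars N (\<lambda>_. count_space UNIV) (\<lambda>j \<omega>. card {i. \<Gamma> \<omega> i \<in> B j}) {..<n} \<and>
        (\<forall>j<n. \<forall>k::nat. measure N {\<omega>\<in>space N. card {i. \<Gamma> \<omega> i \<in> B j} = k} =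
            exp (- measure lborel (B j)) * measure lborel (B j) ^ k / fact k))"

definition equal_in_distribution_K ::
  "'m measure \<Rightarrow> ('m \<Rightarrow> 'a::topological_space set \<Rightarrow> ennreal) \<Rightarrow>
   'n measure \<Rightarrow> ('n \<Rightarrow> 'a set \<Rightarrow> ennreal) \<Rightarrow> bool" where
  "equal_in_distribution_K M X N Z \<longleftrightarrow>
     distr M (PiM {K. compact K} (\<lambda>_. borel)) (\<lambda>\<omega>. restrict (X \<omega>) {K. compact K}) =
     distr N (PiM {K. compact K} (\<lambda>_. borel)) (\<lambda>\<omega>. restrict (Z \<omega>) {K. compact K})"

definition crsm_representation ::
  "'m measure \<Rightarrow> ('m \<Rightarrow> 'a::topological_space set \<Rightarrow> ennreal) \<Rightarrow>
   'n measure \<Rightarrow> ('n \<Rightarrow> nat \<Rightarrow> real) \<Rightarrow> ('n \<Rightarrow> nat \<Rightarrow> 'a set \<Rightarrow> ennreal) \<Rightarrow> bool" where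
  "crsm_representation M X N \<Gamma> Y \<longleftrightarrow>
     prob_space N \<and>
     unit_poisson_points N \<Gamma> \<and>
     (\<forall>i. integrable_rsm N (\<lambda>\<omega>. Y \<omega> i)) \<and>
     (\<forall>i. distr N SM (\<lambda>\<omega>. Y \<omega> i) = distr N SM (\<lambda>\<omega>. Y \<omega> 0)) \<and>
     prob_space.indep_vars N (\<lambda>_. SM) (\<lambda>i \<omega>. Y \<omega> i) UNIV \<and>
     Y \<in> measurable N (PiM UNIV (\<lambda>_. SM)) \<and>
     prob_space.indep_set N
        (sets (vimage_algebra (space N) \<Gamma> (PiM UNIV (\<lambda>_. borel))))
        (sets (vimage_algebra (space N) Y (PiM UNIV (\<lambda>_. SM)))) \<and>
     (\<forall>i. AE \<omega> in N. \<exists>c F. 0 < c \<and> closed F \<and> F \<noteq> {} \<and> Y \<omega> i = scaled_indicator_sm c F) \<and>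
     equal_in_distribution_K M X N (\<lambda>\<omega> K. SUP i. ennreal (1 / \<Gamma> \<omega> i) * Y \<omega> i K)"

end

theory Submission
  imports Defs "HOL-Real_Asymp.Real_Asymp"
begin

text \<open>
  A sup-measure is determined by its values on points, so \<open>\<integral>\<^sup>e f d\<phi> = sup f(x) \<phi>{x}\<close>, which is a
  countable supremum of terms \<open>q \<phi>{f \<ge> q}\<close>; for \<open>\<phi> = c 1_F\<close> it equals \<open>c sup_F f\<close>, and this is additive on
  comonotone \<open>f\<close>. The generating functional of the Poisson process of the \<open>(\<Gamma> i, Y i)\<close> shows that the
  maximum of finitely many \<open>u j X(K j)\<close> is Frechet with scale \<open>E max (u j Y(K j))\<close>, hence
  \<open>\<ell>(f) = E \<integral>\<^sup>e f dY\<close>, which gives the "if" part and the formula for \<open>\<theta>\<close>.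

  Conversely, comonotone additivity determines \<open>\<ell>\<close> on simple functions, and thereby the law of \<open>X\<close>, from
  \<open>\<theta>\<close> alone. It remains to find \<open>Y\<close> with \<open>E Y(K) = \<theta> K\<close>. Choquet's theorem is avoided: \<open>X(K) > t\<close> records
  whether \<open>K\<close> meets a random set, and \<open>t P(X(K) > t)\<close> tends to \<open>\<theta> K\<close>. The patterns of hits of a countable
  compact base are coded as points of the Cantor set, and Helly's theorem yields a limit law.
  Regularity of \<open>\<theta>\<close> makes almost every limiting pattern that of a closed set \<open>F\<close>.
\<close>

subsection \<open>Sup-measures\<close>

text \<open>The random set behind \<open>X(K) > t\<close> is \<open>{x. X {x} > t}\<close>: a
  sup-measure is the supremum of its point values, so \<open>K\<close> meets this set exactly when
  \<open>X K > t\<close>. Exceedances therefore turn unions of compacts into unions of events, and a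
  limit law of hitting patterns keeps this property. Two things can be lost in the limit. The total
  intensity may be infinite, since \<theta> is finite on compacts only, so without the tilt there
  need not be a limiting probability law. And a union-preserving 0-1 function on a countable base
  need not come from a closed set: a compact set may be missed although all its neighbourhoods are
  hit. Patterns with this defect would create a gap between the scale of a base member and the
  scales of its neighbourhoods, whereas \<theta> inherits continuity along decreasing compacts from
  \<open>X\<close>; hence they have probability zero. Undoing the tilt makes the height
  \<open>c\<close> depend on the pattern, which is harmless because \<open>Y\<close> may have any
  positive height. That \<open>X\<close> is almost surely not zero supplies a base member of
  positive scale, so that the tilt can be normalized.\<close>

lemma compact_base:
  assumes lc: "locally_compact_space (euclidean :: 'a::{t2_space, second_countable_topology} topology)"
  obtains kf :: "nat \<Rightarrow> 'a::{t2_space, second_countable_topology} set" where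
    "\<And>i. compact (kf i)" "\<And>i j. \<exists>k. kf k = kf i \<union> kf j"
    "\<And>C G. compact C \<Longrightarrow> open G \<Longrightarrow> C \<subseteq> G \<Longrightarrow> \<exists>i. C \<subseteq> interior (kf i) \<and> kf i \<subseteq> G"
proof -
  obtain B :: "'a set set" where B: "countable B" "topological_basis B"
    using ex_countable_basis by blast
  define \<C> where "\<C> = {closure b | b. b \<in> B \<and> compact (closure b)}"
  \<comment> \<open>Finite unions let one base member replace a finite subcover. The empty union is
    included, so \<open>{}\<close> belongs to the base and needs separate care in the hitting
    patterns.\<close>
  define \<F> where "\<F> = (\<lambda>S. \<Union>S) ` {S. finite S \<and> S \<subseteq> \<C>}"
  have "countable \<C>" unfolding \<C>_def
    by (rule countable_subset[OF _ countable_image[OF B(1), of closure]]) auto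
  then have "countable \<F>" unfolding \<F>_def
    by (intro countable_image countable_Collect_finite_subset)
  have "\<F> \<noteq> {}" unfolding \<F>_def by auto
  have nb: "neighbourhood_base_of (\<lambda>C. compactin euclidean C \<and> closedin euclidean C) (euclidean :: 'a topology)"
  proof -
    have H: "Hausdorff_space (euclidean :: 'a topology)"
      unfolding Hausdorff_space_def by (auto simp: disjnt_def) (metis hausdorff)
    then have "regular_space (euclidean :: 'a topology)"
      using lc locally_compact_Hausdorff_imp_regular_space by blast
    then show ?thesis
      using lc locally_compact_space_neighbourhood_base_closedin by blast
  qed
  have loc: "\<exists>b\<in>B. x \<in> b \<and> compact (closure b) \<and> closure b \<subseteq> G" if "open G" "x \<in> G" for x :: 'a and G
  proof -
    have "\<exists>U V. openin euclidean U \<and> (compactin euclidean V \<and> closedin euclidean V) \<and> x \<in> U \<and> U \<subseteq> V \<and> V \<subseteq> G"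
      by (rule nb[unfolded neighbourhood_base_of, rule_format]) (use that in simp)
    then obtain U V where UV: "open U" "compact V" "closed V" "x \<in> U" "U \<subseteq> V" "V \<subseteq> G"
      unfolding open_openin[symmetric] closed_closedin[symmetric] compactin_euclidean_iff
      by (elim exE conjE) (rule that)
    obtain b where b: "b \<in> B" "x \<in> b" "b \<subseteq> U"
      using topological_basisE[OF B(2) UV(1) UV(4)] by blast
    have "closure b \<subseteq> V" using closure_minimal[of b V] b(3) UV(3,5) by simp
    then have "compact (closure b)" using compact_Int_closed[OF UV(2) closed_closure[of b]]
      by (simp add: Int_absorb1)
    then show ?thesis using b UV \<open>closure b \<subseteq> V\<close> by blast
  qed
  define kf where "kf = from_nat_into \<F>"
  have rng: "range kf = \<F>" unfolding kf_def
    using \<open>\<F> \<noteq> {}\<close> \<open>countable \<F>\<close> by (rule range_from_nat_into)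
  show ?thesis
  proof
    fix i
    have "kf i \<in> \<F>" using rng by auto
    then show "compact (kf i)" unfolding \<F>_def \<C>_def by (auto intro!: compact_Union)
  next
    fix i j
    have "kf i \<in> \<F>" "kf j \<in> \<F>" using rng by auto
    then obtain S T where "kf i = \<Union>S" "kf j = \<Union>T" "finite S" "finite T" "S \<subseteq> \<C>" "T \<subseteq> \<C>"
      unfolding \<F>_def by auto
    then have "kf i \<union> kf j \<in> \<F>"
      unfolding \<F>_def by (intro image_eqI[of _ _ "S \<union> T"]) auto
    then show "\<exists>k. kf k = kf i \<union> kf j" using rng by (metis imageE)
  next
    fix C G :: "'a set" assume CG: "compact C" "open G" "C \<subseteq> G"
    have "\<exists>b\<in>B. x \<in> b \<and> compact (closure b) \<and> closure b \<subseteq> G" if "x \<in> C" for x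
      using loc CG that by blast
    then obtain b where b: "\<And>x. x \<in> C \<Longrightarrow> b x \<in> B \<and> x \<in> b x \<and> compact (closure (b x)) \<and> closure (b x) \<subseteq> G"
      by metis
    have ob: "open (b x)" if "x \<in> C" for x
      using b[OF that] B(2) topological_basis_open by blast
    obtain D where D: "D \<subseteq> C" "finite D" "C \<subseteq> (\<Union>x\<in>D. b x)"
      by (rule compactE_image[OF CG(1), of C b]) (use ob b in auto)
    define S where "S = (\<lambda>x. closure (b x)) ` D"
    have S: "finite S" "S \<subseteq> \<C>" unfolding S_def \<C>_def using b D by auto
    then have "\<Union>S \<in> \<F>" unfolding \<F>_def by auto
    then obtain i where i: "kf i = \<Union>S" using rng by (metis imageE)
    have "open (\<Union>x\<in>D. b x)" using ob D by blast
    moreover have "(\<Union>x\<in>D. b x) \<subseteq> \<Union>S" unfolding S_def using closure_subset by fastforce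
    ultimately have "C \<subseteq> interior (\<Union>S)"
      using D(3) interior_maximal by (metis subset_trans)
    moreover have "\<Union>S \<subseteq> G" unfolding S_def using b D by blast
    ultimately show "\<exists>i. C \<subseteq> interior (kf i) \<and> kf i \<subseteq> G" using i by metis
  qed
qed

text \<open>Finitely many base members whose interiors contain \<open>C\<close> intersect in a
  neighbourhood of \<open>C\<close>, and a point outside \<open>C\<close> is excluded by some base
  member inside its complement. Such sequences are the way to use the continuity of a sup-measure
  along decreasing compacts.\<close>

lemma compact_decseq_neighbourhoods:
  assumes lc: "locally_compact_space (euclidean :: 'a::{t2_space, second_countable_topology} topology)"
    and C: "compact (C :: 'a::{t2_space, second_countable_topology} set)"
  obtains D :: "nat \<Rightarrow> 'a::{t2_space, second_countable_topology} set" where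
    "\<And>n. compact (D n)" "decseq D" "(\<Inter>n. D n) = C" "\<And>n. C \<subseteq> interior (D n)"
proof -
  obtain kf :: "nat \<Rightarrow> 'a set" where kf: "\<And>i. compact (kf i)"
    "\<And>C G. compact C \<Longrightarrow> open G \<Longrightarrow> C \<subseteq> G \<Longrightarrow> \<exists>i. C \<subseteq> interior (kf i) \<and> kf i \<subseteq> G"
    using compact_base[OF lc] by metis
  define I where "I = {i. C \<subseteq> interior (kf i)}"
  obtain i0 where i0: "i0 \<in> I" using kf(2)[OF C open_UNIV] unfolding I_def by auto
  \<comment> \<open>The fixed index \<open>i0\<close> makes \<open>D n\<close> compact even if no
    index up to \<open>n\<close> qualifies.\<close>
  define D where "D n = (\<Inter>i\<in>insert i0 (I \<inter> {..n}). kf i)" for n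
  have fin: "finite (insert i0 (I \<inter> {..n}))" for n by simp
  have closedkf: "closed (kf i)" for i using kf(1) compact_imp_closed by blast
  show ?thesis
  proof
    fix n
    have "D n = kf i0 \<inter> (\<Inter>i\<in>(I \<inter> {..n}). kf i)" unfolding D_def by auto
    then show "compact (D n)" using kf(1) closedkf by (simp add: compact_Int_closed closed_INT)
    have "open (\<Inter>i\<in>insert i0 (I \<inter> {..n}). interior (kf i))" using fin by (intro open_INT) auto
    moreover have "(\<Inter>i\<in>insert i0 (I \<inter> {..n}). interior (kf i)) \<subseteq> D n"
      unfolding D_def using interior_subset by blast
    moreover have "C \<subseteq> (\<Inter>i\<in>insert i0 (I \<inter> {..n}). interior (kf i))" using i0 unfolding I_def by auto
    ultimately show "C \<subseteq> interior (D n)" by (metis interior_maximal subset_trans)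
  next
    show "decseq D" unfolding decseq_def D_def by (auto simp: INF_superset_mono)
  next
    have "x \<in> C" if "\<forall>n. x \<in> D n" for x
    proof (rule ccontr)
      assume "x \<notin> C"
      then have "C \<subseteq> - {x}" "open (- {x})" by auto
      then obtain i where i: "C \<subseteq> interior (kf i)" "kf i \<subseteq> - {x}" using kf(2)[OF C] by blast
      then have "i \<in> I" unfolding I_def by auto
      then have "D i \<subseteq> kf i" unfolding D_def by auto
      then show False using that i by auto
    qed
    moreover have "C \<subseteq> D n" for n unfolding D_def using i0 interior_subset unfolding I_def by fast
    ultimately show "(\<Inter>n. D n) = C" by auto
  qed
qed

lemma sup_measure_mono: "sup_measure \<phi> \<Longrightarrow> A \<subseteq> B \<Longrightarrow> \<phi> A \<le> \<phi> B"
  unfolding sup_measure_def by (elim conjE) simp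

lemma sup_measure_empty: "sup_measure \<phi> \<Longrightarrow> \<phi> {} = 0"
  unfolding sup_measure_def by blast

lemma sup_measure_decseq:
  "sup_measure \<phi> \<Longrightarrow> (\<And>n. compact (K n)) \<Longrightarrow> decseq K \<Longrightarrow> (\<lambda>n. \<phi> (K n)) \<longlonglongrightarrow> \<phi> (\<Inter>n. K n)" for K :: "nat \<Rightarrow> _"
  unfolding sup_measure_def by blast

lemma sup_measure_Union_open:
  "sup_measure \<phi> \<Longrightarrow> (\<And>G. G \<in> \<G> \<Longrightarrow> open G) \<Longrightarrow> \<phi> (\<Union>\<G>) = (SUP G\<in>\<G>. \<phi> G)"
  unfolding sup_measure_def by (elim conjE allE[of _ \<G>]) simp

text \<open>Continuity along compact neighbourhoods of \<open>x\<close> yields an open set around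
  \<open>x\<close> whose value is below any \<open>t\<close> exceeding the supremum of the point
  values. These open sets cover \<open>A\<close>, and the supremum property for families of open
  sets bounds the value of their union by \<open>t\<close>. All later computations with sup-measures
  go through this reduction to points.\<close>

lemma sup_measure_eq_SUP_points:
  assumes lc: "locally_compact_space (euclidean :: 'a::{t2_space, second_countable_topology} topology)"
    and \<phi>: "sup_measure \<phi>"
  shows "\<phi> A = (SUP x\<in>(A::'a::{t2_space, second_countable_topology} set). \<phi> {x})"
proof (rule antisym)
  show "(SUP x\<in>A. \<phi> {x}) \<le> \<phi> A"
    by (intro SUP_least sup_measure_mono[OF \<phi>]) auto
  show "\<phi> A \<le> (SUP x\<in>A. \<phi> {x})"
  proof (rule dense_ge)
    fix t assume t: "(SUP x\<in>A. \<phi> {x}) < t"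
    have "\<exists>G. open G \<and> x \<in> G \<and> \<phi> G \<le> t" if "x \<in> A" for x
    proof -
      have lt: "\<phi> {x} < t" using t that by (meson SUP_upper le_less_trans)
      obtain D :: "nat \<Rightarrow> 'a set" where D: "\<And>n. compact (D n)" "decseq D" "(\<Inter>n. D n) = {x}" "\<And>n. {x} \<subseteq> interior (D n)"
        by (rule compact_decseq_neighbourhoods[OF lc, of "{x}"]) (auto simp: decseq_def)
      have "(\<lambda>n. \<phi> (D n)) \<longlonglongrightarrow> \<phi> {x}" using sup_measure_decseq[OF \<phi> D(1) D(2)] D(3) by simp
      then have "eventually (\<lambda>n. \<phi> (D n) < t) sequentially" using lt by (rule order_tendstoD)
      then obtain n where "\<phi> (D n) < t" by (auto simp: eventually_sequentially)
      moreover have "\<phi> (interior (D n)) \<le> \<phi> (D n)" by (intro sup_measure_mono[OF \<phi>] interior_subset)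
      ultimately show ?thesis using D(4)[of n] by (intro exI[of _ "interior (D n)"]) auto
    qed
    then obtain G where G: "\<And>x. x \<in> A \<Longrightarrow> open (G x) \<and> x \<in> G x \<and> \<phi> (G x) \<le> t" by metis
    have "\<phi> A \<le> \<phi> (\<Union>(G ` A))" by (intro sup_measure_mono[OF \<phi>]) (use G in auto)
    also have "\<dots> = (SUP g\<in>G ` A. \<phi> g)" by (rule sup_measure_Union_open[OF \<phi>]) (use G in auto)
    also have "\<dots> \<le> t" using G by (auto intro!: SUP_least)
    finally show "\<phi> A \<le> t" .
  qed
qed

lemma sup_measure_Un:
  assumes lc: "locally_compact_space (euclidean :: 'a::{t2_space, second_countable_topology} topology)"
    and \<phi>: "sup_measure \<phi>"
  shows "\<phi> (A \<union> B) = max (\<phi> A) (\<phi> (B::'a::{t2_space, second_countable_topology} set))"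
  unfolding sup_measure_eq_SUP_points[OF lc \<phi>, of A] sup_measure_eq_SUP_points[OF lc \<phi>, of B]
    sup_measure_eq_SUP_points[OF lc \<phi>, of "A \<union> B"]
  by (simp add: SUP_union sup_max)

text \<open>Closedness of \<open>F\<close> matters for decreasing compacts: if \<open>F\<close>
  meets every \<open>K n\<close>, the finite intersection property in \<open>K 0\<close> gives a
  common point, so otherwise the values are eventually 0.\<close>

lemma sup_measure_scaled_indicator:
  assumes F: "closed (F :: 'a::t2_space set)"
  shows "sup_measure (scaled_indicator_sm c F)"
  unfolding sup_measure_def
proof (intro conjI allI impI)
  fix A B :: "'a set" assume "A \<subseteq> B"
  then show "scaled_indicator_sm c F A \<le> scaled_indicator_sm c F B"
    unfolding scaled_indicator_sm_def by auto
next
  show "scaled_indicator_sm c F {} = 0" unfolding scaled_indicator_sm_def by auto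
next
  fix A :: "nat \<Rightarrow> 'a set" assume A: "incseq A"
  show "(\<lambda>n. scaled_indicator_sm c F (A n)) \<longlonglongrightarrow> scaled_indicator_sm c F (\<Union>n. A n)"
  proof (cases "F \<inter> (\<Union>n. A n) = {}")
    case True
    then have "F \<inter> A n = {}" for n by auto
    then show ?thesis using True unfolding scaled_indicator_sm_def by simp
  next
    case False
    then obtain m where m: "F \<inter> A m \<noteq> {}" by auto
    have "F \<inter> A n \<noteq> {}" if "n \<ge> m" for n
    proof -
      have "A m \<subseteq> A n" using A that by (simp add: incseq_def)
      then show ?thesis using m by auto
    qed
    then have "eventually (\<lambda>n. scaled_indicator_sm c F (A n) = scaled_indicator_sm c F (\<Union>n. A n)) sequentially"
      using False unfolding scaled_indicator_sm_def eventually_sequentially by auto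
    then show ?thesis by (rule tendsto_eventually)
  qed
next
  fix K :: "nat \<Rightarrow> 'a set" assume K: "(\<forall>n. compact (K n)) \<and> decseq K"
  show "(\<lambda>n. scaled_indicator_sm c F (K n)) \<longlonglongrightarrow> scaled_indicator_sm c F (\<Inter>n. K n)"
  proof (cases "F \<inter> (\<Inter>n. K n) = {}")
    case False
    then have "F \<inter> K n \<noteq> {}" for n by auto
    then show ?thesis using False unfolding scaled_indicator_sm_def by simp
  next
    case True
    have "\<exists>n. F \<inter> K n = {}"
    proof (rule ccontr)
      assume ne: "\<nexists>n. F \<inter> K n = {}"
      have "K 0 \<inter> (\<Inter>n\<in>UNIV. F \<inter> K n) \<noteq> {}"
      proof (rule compact_imp_fip_image)
        show "compact (K 0)" "\<And>n. closed (F \<inter> K n)" using K F by (auto simp: closed_Int compact_imp_closed)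
        fix I :: "nat set" assume I: "finite I"
        \<comment> \<open>Inserting 0 makes the maximum meaningful for empty \<open>I\<close> and
          also covers the ambient compact set \<open>K 0\<close>.\<close>
        have "K (Max (insert 0 I)) \<subseteq> K n" if "n \<in> insert 0 I" for n
          using K I that by (simp add: decseq_def)
        then show "K 0 \<inter> (\<Inter>n\<in>I. F \<inter> K n) \<noteq> {}" using ne by blast
      qed
      with True show False by auto
    qed
    then obtain m where m: "F \<inter> K m = {}" by auto
    have "F \<inter> K n = {}" if "n \<ge> m" for n
    proof -
      have "K n \<subseteq> K m" using K that by (simp add: decseq_def)
      then show ?thesis using m by auto
    qed
    then have "eventually (\<lambda>n. scaled_indicator_sm c F (K n) = scaled_indicator_sm c F (\<Inter>n. K n)) sequentially"
      using True unfolding scaled_indicator_sm_def eventually_sequentially by auto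
    then show ?thesis by (rule tendsto_eventually)
  qed
next
  fix K :: "'a set"
  show "scaled_indicator_sm c F K < \<infinity>" unfolding scaled_indicator_sm_def by auto
next
  fix \<G> :: "'a set set"
  show "scaled_indicator_sm c F (\<Union>\<G>) = (SUP G\<in>\<G>. scaled_indicator_sm c F G)"
  proof (cases "F \<inter> \<Union>\<G> = {}")
    case True
    then have "F \<inter> G = {}" if "G \<in> \<G>" for G using that by auto
    then show ?thesis using True unfolding scaled_indicator_sm_def
      by (cases "\<G> = {}") (auto simp: bot_ennreal)
  next
    case False
    then obtain G where G: "G \<in> \<G>" "F \<inter> G \<noteq> {}" by auto
    show ?thesis
    proof (rule antisym)
      show "scaled_indicator_sm c F (\<Union>\<G>) \<le> (SUP G\<in>\<G>. scaled_indicator_sm c F G)"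
        by (rule SUP_upper2[OF G(1)]) (use G False in \<open>simp add: scaled_indicator_sm_def\<close>)
      show "(SUP G\<in>\<G>. scaled_indicator_sm c F G) \<le> scaled_indicator_sm c F (\<Union>\<G>)"
        by (rule SUP_least) (use False in \<open>simp add: scaled_indicator_sm_def\<close>)
    qed
  qed
qed

section \<open>The measurable space of sup-measures\<close>

lemma SM_generator_subset:
  "(\<Union>K\<in>{K. compact K}. {(\<lambda>\<phi>. \<phi> K) -` B \<inter> Collect sup_measure | B. B \<in> sets borel}) \<subseteq> Pow (Collect sup_measure)"
  by auto

lemma space_SM: "space SM = Collect sup_measure"
  unfolding SM_def by (rule space_measure_of[OF SM_generator_subset])

lemma measurable_SM_eval [measurable]:
  assumes "compact K"
  shows "(\<lambda>\<phi>. \<phi> K) \<in> measurable SM borel"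
proof (rule measurableI)
  fix B :: "ennreal set" assume "B \<in> sets borel"
  then show "(\<lambda>\<phi>. \<phi> K) -` B \<inter> space SM \<in> sets SM"
    unfolding space_SM unfolding SM_def sets_measure_of[OF SM_generator_subset]
    using assms by (intro sigma_sets.Basic) auto
qed simp

lemma measurable_SM:
  fixes X :: "'m \<Rightarrow> 'a::topological_space set \<Rightarrow> ennreal"
  assumes "\<And>\<omega>. \<omega> \<in> space M \<Longrightarrow> sup_measure (X \<omega>)"
    and "\<And>K. compact K \<Longrightarrow> (\<lambda>\<omega>. X \<omega> K) \<in> borel_measurable M"
  shows "X \<in> measurable M SM"
  unfolding SM_def
proof (rule measurable_measure_of[OF SM_generator_subset])
  show "X \<in> space M \<rightarrow> Collect sup_measure" using assms(1) by auto
  fix A :: "('a set \<Rightarrow> ennreal) set" assume "A \<in> (\<Union>K\<in>{K. compact K}. {(\<lambda>\<phi>. \<phi> K) -` B \<inter> Collect sup_measure | B. B \<in> sets borel})"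
  then obtain K B where K: "compact K" "B \<in> sets borel" "A = (\<lambda>\<phi>. \<phi> K) -` B \<inter> Collect sup_measure" by auto
  have "X -` A \<inter> space M = (\<lambda>\<omega>. X \<omega> K) -` B \<inter> space M" using assms(1) K by auto
  then show "X -` A \<inter> space M \<in> sets M" using assms(2)[OF K(1)] K(2) by (simp add: measurable_sets)
qed

lemma random_sup_measureD:
  assumes "random_sup_measure M X"
  shows "\<omega> \<in> space M \<Longrightarrow> sup_measure (X \<omega>)"
    and "compact K \<Longrightarrow> (\<lambda>\<omega>. X \<omega> K) \<in> borel_measurable M"
  using assms measurable_space[of X M SM] measurable_compose[of X M SM "\<lambda>\<phi>. \<phi> K" borel]
  unfolding random_sup_measure_def by (auto simp: space_SM)

subsection \<open>The extremal integral\<close>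

text \<open>The value on \<open>K\<close> splits into point values, and the infimum of
  \<open>f\<close> over \<open>K\<close> is at most \<open>f y\<close> at each point
  \<open>y\<close> of \<open>K\<close>. Conversely, singletons are compact and realize every term on
  the right.\<close>

lemma extremal_integral_eq_SUP_points:
  assumes lc: "locally_compact_space (euclidean :: 'a::{t2_space, second_countable_topology} topology)"
    and \<phi>: "sup_measure \<phi>"
  shows "extremal_integral f \<phi> = (SUP x::'a::{t2_space, second_countable_topology}. ennreal (f x) * \<phi> {x})"
  unfolding extremal_integral_def
proof (rule antisym)
  show "(SUP K\<in>{K. compact K}. \<phi> K * (INF x\<in>K. ennreal (f x))) \<le> (SUP x. ennreal (f x) * \<phi> {x})"
  proof (rule SUP_least)
    fix K :: "'a set" assume "K \<in> {K. compact K}"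
    have "\<phi> K * (INF x\<in>K. ennreal (f x)) = (SUP y\<in>K. \<phi> {y} * (INF x\<in>K. ennreal (f x)))"
      by (subst sup_measure_eq_SUP_points[OF lc \<phi>]) (rule SUP_mult_right_ennreal)
    also have "\<dots> \<le> (SUP x. ennreal (f x) * \<phi> {x})"
      by (rule SUP_least, rule SUP_upper2[OF UNIV_I]) (auto simp: mult.commute[of "\<phi> _"] intro!: mult_right_mono INF_lower)
    finally show "\<phi> K * (INF x\<in>K. ennreal (f x)) \<le> (SUP x. ennreal (f x) * \<phi> {x})" .
  qed
  show "(SUP x. ennreal (f x) * \<phi> {x}) \<le> (SUP K\<in>{K. compact K}. \<phi> K * (INF x\<in>K. ennreal (f x)))"
  proof (rule SUP_least)
    fix x :: 'a
    show "ennreal (f x) * \<phi> {x} \<le> (SUP K\<in>{K. compact K}. \<phi> K * (INF x\<in>K. ennreal (f x)))"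
      by (rule SUP_upper2[of "{x}"]) (auto simp: mult.commute)
  qed
qed

lemma USC_D:
  assumes "f \<in> USC"
  shows "bounded (range f)" "0 \<le> f x" "usc_fun f" "compact (closure {x. f x \<noteq> 0})"
  using assms unfolding USC_def by auto

lemma compact_superlevel:
  fixes f :: "'a::t2_space \<Rightarrow> real"
  assumes "f \<in> USC" "0 < q" shows "compact {x. q \<le> f x}"
proof -
  have "open {x. f x < q}" using USC_D(3)[OF assms(1)] unfolding usc_fun_def by blast
  then have "closed {x. q \<le> f x}"
    unfolding closed_def by (simp add: Collect_neg_eq[symmetric] not_le)
  moreover have "{x. q \<le> f x} \<subseteq> closure {x. f x \<noteq> 0}"
    using assms(2) closure_subset by fastforce
  ultimately show ?thesis
    using compact_Int_closed[OF USC_D(4)[OF assms(1)], of "{x. q \<le> f x}"] by (simp add: Int_absorb1)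
qed

text \<open>An enumeration of the positive rationals, used as levels: it makes suprema over levels
  countable, hence measurable, and its initial segments give the finite maxima to which
  max-stability applies.\<close>

definition pos_rat :: "nat \<Rightarrow> real" where
  "pos_rat = from_nat_into {q\<in>\<rat>. 0 < q}"

lemma range_pos_rat: "range pos_rat = {q\<in>\<rat>. 0 < q}"
  unfolding pos_rat_def
proof (rule range_from_nat_into)
  show "{q \<in> \<rat>. 0 < (q::real)} \<noteq> {}" using Rats_1 zero_less_one by blast
  show "countable {q \<in> \<rat>. 0 < (q::real)}" using countable_rat by (rule countable_subset[rotated]) auto
qed

lemma pos_rat_pos: "0 < pos_rat n"
  using range_pos_rat by auto

lemma pos_rat_between:
  assumes "0 \<le> a" "a < b" shows "\<exists>n. a < pos_rat n \<and> pos_rat n < b"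
proof -
  obtain q where "q \<in> \<rat>" "a < q" "q < b" using Rats_dense_in_real[OF assms(2)] by blast
  then have "q \<in> range pos_rat" unfolding range_pos_rat using assms by auto
  then show ?thesis using \<open>a < q\<close> \<open>q < b\<close> by auto
qed

lemma ennreal_le_SUP_pos_rat:
  assumes "0 \<le> a" shows "ennreal a \<le> (SUP n\<in>{n. pos_rat n \<le> a}. ennreal (pos_rat n))"
proof (rule dense_le)
  fix y assume y: "y < ennreal a"
  then obtain b where b: "y = ennreal b" "0 \<le> b" by (cases y) auto
  then have "b < a" using y by (simp add: ennreal_less_iff)
  then obtain n where n: "b < pos_rat n" "pos_rat n < a" using pos_rat_between b by blast
  show "y \<le> (SUP n\<in>{n. pos_rat n \<le> a}. ennreal (pos_rat n))"
    by (rule SUP_upper2[of n]) (use n b in \<open>auto simp: ennreal_leI\<close>)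
qed

text \<open>Each \<open>f x\<close> is the supremum of the rational levels below it, and
  \<open>x\<close> lies in the corresponding superlevel sets. For \<open>f \<in> USC\<close> these
  sets are compact, so only evaluations that are measurable on \<open>SM\<close> occur.\<close>

lemma extremal_integral_eq_SUP_superlevel:
  assumes lc: "locally_compact_space (euclidean :: 'a::{t2_space, second_countable_topology} topology)"
    and \<phi>: "sup_measure \<phi>" and f: "\<And>x. 0 \<le> f x"
  shows "extremal_integral f \<phi> = (SUP n. ennreal (pos_rat n) * \<phi> {x::'a::{t2_space, second_countable_topology}. pos_rat n \<le> f x})"
  unfolding extremal_integral_eq_SUP_points[OF lc \<phi>]
proof (rule antisym)
  show "(SUP x. ennreal (f x) * \<phi> {x}) \<le> (SUP n. ennreal (pos_rat n) * \<phi> {x. pos_rat n \<le> f x})"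
  proof (rule SUP_least)
    fix x
    have "ennreal (f x) * \<phi> {x} \<le> (SUP n\<in>{n. pos_rat n \<le> f x}. ennreal (pos_rat n)) * \<phi> {x}"
      by (intro mult_right_mono ennreal_le_SUP_pos_rat f) auto
    also have "\<dots> = (SUP n\<in>{n. pos_rat n \<le> f x}. ennreal (pos_rat n) * \<phi> {x})"
      by (rule SUP_mult_right_ennreal)
    also have "\<dots> \<le> (SUP n. ennreal (pos_rat n) * \<phi> {x. pos_rat n \<le> f x})"
      by (rule SUP_least, rule SUP_upper2[OF UNIV_I]) (auto intro!: mult_left_mono sup_measure_mono[OF \<phi>])
    finally show "ennreal (f x) * \<phi> {x} \<le> (SUP n. ennreal (pos_rat n) * \<phi> {x. pos_rat n \<le> f x})" .
  qed
  show "(SUP n. ennreal (pos_rat n) * \<phi> {x. pos_rat n \<le> f x}) \<le> (SUP x. ennreal (f x) * \<phi> {x})"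
  proof (rule SUP_least)
    fix n
    have "ennreal (pos_rat n) * \<phi> {x. pos_rat n \<le> f x} = (SUP x\<in>{x. pos_rat n \<le> f x}. ennreal (pos_rat n) * \<phi> {x})"
      by (subst sup_measure_eq_SUP_points[OF lc \<phi>]) (rule SUP_mult_left_ennreal)
    also have "\<dots> \<le> (SUP x. ennreal (f x) * \<phi> {x})"
      by (rule SUP_least, rule SUP_upper2[OF UNIV_I]) (auto intro!: mult_right_mono ennreal_leI)
    finally show "ennreal (pos_rat n) * \<phi> {x. pos_rat n \<le> f x} \<le> (SUP x. ennreal (f x) * \<phi> {x})" .
  qed
qed

lemma SUP_indicator_times:
  fixes c :: ennreal
  shows "(SUP x. (if x \<in> A then c else 0) * g x) = c * (SUP x\<in>A. g x)"
proof -
  have "(SUP x. (if x \<in> A then c else 0) * g x) = (SUP x\<in>A. c * g x)"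
    by (rule antisym; rule SUP_least) (auto intro: SUP_upper SUP_upper2)
  then show ?thesis by (simp add: SUP_mult_left_ennreal)
qed

lemma extremal_integral_scaled_indicator:
  fixes F :: "'a::{t2_space, second_countable_topology} set"
  assumes lc: "locally_compact_space (euclidean :: 'a topology)" and F: "closed F"
  shows "extremal_integral f (scaled_indicator_sm c F) = ennreal c * (SUP x\<in>F. ennreal (f x))"
proof -
  have "extremal_integral f (scaled_indicator_sm c F) = (SUP x. ennreal (f x) * scaled_indicator_sm c F {x})"
    by (rule extremal_integral_eq_SUP_points[OF lc sup_measure_scaled_indicator[OF F]])
  also have "\<dots> = (SUP x. (if x \<in> F then ennreal c else 0) * ennreal (f x))"
    by (rule SUP_cong) (auto simp: scaled_indicator_sm_def mult.commute)
  finally show ?thesis by (simp add: SUP_indicator_times)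
qed

text \<open>Over points the two suprema commute. This identifies the weighted maxima in the
  definition of max-stability with extremal integrals of step functions, and so connects
  finite-dimensional laws with the tail dependence functional.\<close>

lemma extremal_integral_Max_indicator:
  fixes K :: "nat \<Rightarrow> 'a::{t2_space, second_countable_topology} set"
  assumes lc: "locally_compact_space (euclidean :: 'a topology)" and \<phi>: "sup_measure \<phi>"
    and f: "\<And>x. ennreal (f x) = (SUP i\<in>{..<n}. ennreal (u i) * indicator (K i) x)"
  shows "extremal_integral f \<phi> = (SUP i\<in>{..<n}. ennreal (u i) * \<phi> (K i))"
proof -
  have "extremal_integral f \<phi> = (SUP x. SUP i\<in>{..<n}. (ennreal (u i) * indicator (K i) x) * \<phi> {x})"
    unfolding extremal_integral_eq_SUP_points[OF lc \<phi>] f by (simp add: SUP_mult_right_ennreal)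
  also have "\<dots> = (SUP i\<in>{..<n}. SUP x. (ennreal (u i) * indicator (K i) x) * \<phi> {x})"
    by (rule SUP_commute)
  also have "\<dots> = (SUP i\<in>{..<n}. SUP x. (if x \<in> K i then ennreal (u i) else 0) * \<phi> {x})"
    by (intro SUP_cong refl) (auto simp: indicator_def)
  also have "\<dots> = (SUP i\<in>{..<n}. ennreal (u i) * (SUP x\<in>K i. \<phi> {x}))"
    by (simp only: SUP_indicator_times)
  finally show ?thesis by (simp only: sup_measure_eq_SUP_points[OF lc \<phi>, symmetric])
qed

lemma extremal_integral_scaled_indicator_fun:
  fixes K :: "'a::{t2_space, second_countable_topology} set"
  assumes lc: "locally_compact_space (euclidean :: 'a topology)" and \<phi>: "sup_measure \<phi>" and "0 \<le> v"
  shows "extremal_integral (\<lambda>x. v * indicator K x) \<phi> = ennreal v * \<phi> K"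
  using extremal_integral_Max_indicator[OF lc \<phi>, where f="\<lambda>x. v * indicator K x" and n="Suc 0" and u="\<lambda>_. v" and K="\<lambda>_. K"] \<open>0 \<le> v\<close>
  by (simp add: lessThan_Suc ennreal_mult ennreal_indicator)

lemma extremal_integral_indicator:
  fixes K :: "'a::{t2_space, second_countable_topology} set"
  assumes lc: "locally_compact_space (euclidean :: 'a topology)" and \<phi>: "sup_measure \<phi>"
  shows "extremal_integral (indicator K) \<phi> = \<phi> K"
  using extremal_integral_scaled_indicator_fun[OF lc \<phi>, of 1 K] by simp

section \<open>Comonotone functions\<close>

text \<open>For two points of \<open>F\<close>, comonotonicity rules out that \<open>f\<close> is
  strictly larger at \<open>x\<close> while \<open>g\<close> is strictly larger at \<open>y\<close>.
  So \<open>f x + g y\<close> is bounded by the sum at \<open>x\<close> or at \<open>y\<close>, and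
  the two suprema can be approached at a common point. The empty set is separated because the
  supremum is moved through a sum.\<close>

lemma SUP_comonotone_add:
  fixes f g :: "'a \<Rightarrow> real"
  assumes f: "\<And>x. 0 \<le> f x" and g: "\<And>x. 0 \<le> g x"
    and co: "\<And>x y. 0 \<le> (f x - f y) * (g x - g y)"
  shows "(SUP x\<in>F. ennreal (f x + g x)) = (SUP x\<in>F. ennreal (f x)) + (SUP x\<in>F. ennreal (g x))"
proof (cases "F = {}")
  case True then show ?thesis by (simp add: bot_ennreal)
next
  case False
  have *: "(SUP x\<in>F. ennreal (f x)) + (SUP x\<in>F. ennreal (g x)) = (SUP x\<in>F. SUP y\<in>F. ennreal (f x) + ennreal (g y))"
    using False by (simp add: ennreal_SUP_add_left[symmetric] ennreal_SUP_add_right[symmetric])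
  show ?thesis unfolding *
  proof (rule antisym)
    show "(SUP x\<in>F. ennreal (f x + g x)) \<le> (SUP x\<in>F. SUP y\<in>F. ennreal (f x) + ennreal (g y))"
    proof (rule SUP_least)
      fix x assume "x \<in> F"
      then show "ennreal (f x + g x) \<le> (SUP x\<in>F. SUP y\<in>F. ennreal (f x) + ennreal (g y))"
        using f g by (intro SUP_upper2[of x] SUP_upper2[of x]) auto
    qed
    show "(SUP x\<in>F. SUP y\<in>F. ennreal (f x) + ennreal (g y)) \<le> (SUP x\<in>F. ennreal (f x + g x))"
    proof (intro SUP_least)
      fix x y assume xy: "x \<in> F" "y \<in> F"
      have "f x + g y \<le> f x + g x \<or> f x + g y \<le> f y + g y"
      proof (rule ccontr)
        assume "\<not> ?thesis"
        then have "g x - g y < 0" "f x - f y > 0" by auto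
        then have "(f x - f y) * (g x - g y) < 0" by (simp add: mult_pos_neg)
        then show False using co[of x y] by simp
      qed
      then obtain z where z: "z \<in> F" "f x + g y \<le> f z + g z" using xy by blast
      have "ennreal (f x) + ennreal (g y) = ennreal (f x + g y)" using f g by simp
      also have "\<dots> \<le> ennreal (f z + g z)" using z by (intro ennreal_leI)
      also have "\<dots> \<le> (SUP x\<in>F. ennreal (f x + g x))" using z by (intro SUP_upper)
      finally show "ennreal (f x) + ennreal (g y) \<le> (SUP x\<in>F. ennreal (f x + g x))" .
    qed
  qed
qed

lemma extremal_integral_scaled_indicator_comonotone:
  fixes F :: "'a::{t2_space, second_countable_topology} set"
  assumes lc: "locally_compact_space (euclidean :: 'a topology)" and F: "closed F"
    and fg: "\<And>x. 0 \<le> f x" "\<And>x. 0 \<le> g x" "\<And>x y. 0 \<le> (f x - f y) * (g x - g y)"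
  shows "extremal_integral (\<lambda>x. f x + g x) (scaled_indicator_sm c F) =
    extremal_integral f (scaled_indicator_sm c F) + extremal_integral g (scaled_indicator_sm c F)"
  unfolding extremal_integral_scaled_indicator[OF lc F] SUP_comonotone_add[OF fg]
  by (simp add: distrib_left)

text \<open>With finitely many values, the support is the superlevel set at the least nonzero value
  and hence already compact.\<close>

lemma finite_range_USC:
  fixes f :: "'a::t2_space \<Rightarrow> real"
  assumes "finite (range f)" "\<And>x. 0 \<le> f x" "\<And>q. 0 < q \<Longrightarrow> compact {x. q \<le> f x}"
  shows "f \<in> USC"
proof -
  have "open {x. f x < a}" for a
  proof (cases "0 < a")
    case True
    have "closed {x. a \<le> f x}" using assms(3)[OF True] by (rule compact_imp_closed)
    then show ?thesis unfolding closed_def by (simp add: Collect_neg_eq[symmetric] not_le)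
  next
    case False
    then have "{x. f x < a} = {}" using assms(2) by (auto simp: not_less intro: order_trans)
    then show ?thesis by simp
  qed
  then have "usc_fun f" unfolding usc_fun_def by simp
  moreover have "compact (closure {x. f x \<noteq> 0})"
  proof (cases "{x. f x \<noteq> 0} = {}")
    case False
    define m where "m = Min (range f - {0})"
    have fin: "finite (range f - {0})" "range f - {0} \<noteq> {}" using assms(1) False by auto
    have m: "m \<in> range f - {0}" "\<And>y. y \<in> range f - {0} \<Longrightarrow> m \<le> y"
      unfolding m_def using Min_in[OF fin] Min_le[OF fin(1)] by auto
    have "0 < m" using m(1) assms(2) by (auto simp: less_le)
    have "{x. f x \<noteq> 0} = {x. m \<le> f x}" using m(2) \<open>0 < m\<close> by auto
    then show ?thesis
      using assms(3)[OF \<open>0 < m\<close>] closure_closed[OF compact_imp_closed[OF assms(3)[OF \<open>0 < m\<close>]]] by simp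
  qed simp
  ultimately show ?thesis
    unfolding USC_def using assms(1,2) finite_imp_bounded by auto
qed

text \<open>Peeling off the lowest positive level of a simple function leaves a comonotone remainder.\<close>

lemma comonotone_additive_unique:
  fixes T T' :: "('a::t2_space \<Rightarrow> real) \<Rightarrow> 'b::monoid_add"
  assumes add: "\<And>f g. f \<in> USC \<Longrightarrow> g \<in> USC \<Longrightarrow> (\<And>x y. 0 \<le> (f x - f y) * (g x - g y)) \<Longrightarrow>
        T (\<lambda>x. f x + g x) = T f + T g"
    and add': "\<And>f g. f \<in> USC \<Longrightarrow> g \<in> USC \<Longrightarrow> (\<And>x y. 0 \<le> (f x - f y) * (g x - g y)) \<Longrightarrow>
        T' (\<lambda>x. f x + g x) = T' f + T' g"
    and ind: "\<And>v K. 0 \<le> v \<Longrightarrow> compact K \<Longrightarrow> T (\<lambda>x. v * indicator K x) = T' (\<lambda>x. v * indicator K x)"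
    and f: "f \<in> USC" "finite (range f)"
  shows "T f = T' f"
  using f
proof (induction "card (range f - {0})" arbitrary: f rule: less_induct)
  case less
  show ?case
  proof (cases "range f - {0} = {}")
    case True
    \<comment> \<open>In a monoid without cancellation, additivity does not force the value at the
      zero function to vanish; the base case is taken from agreement on scaled indicators
      instead.\<close>
    then have "f = (\<lambda>x. 0 * indicator {} x)" by (auto simp: fun_eq_iff)
    then show ?thesis using ind[of 0 "{}"] by simp
  next
    case False
    define m where "m = Min (range f - {0})"
    have fin: "finite (range f - {0})" "range f - {0} \<noteq> {}" using less.prems(2) False by auto
    have m: "m \<in> range f - {0}" "\<And>y. y \<in> range f - {0} \<Longrightarrow> m \<le> y"
      unfolding m_def using Min_in[OF fin] Min_le[OF fin(1)] by auto
    have f0: "0 \<le> f x" for x by (rule USC_D(2)[OF less.prems(1)])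
    have m0: "0 < m" using m(1) f0 by (auto simp: less_le)
    define K where "K = {x. m \<le> f x}"
    have K: "compact K" unfolding K_def by (rule compact_superlevel[OF less.prems(1) m0])
    have zero: "f x = 0" if "x \<notin> K" for x using m(2)[of "f x"] that unfolding K_def by auto
    define h where "h x = f x - m * indicator K x" for x
    have h0: "0 \<le> h x" for x unfolding h_def using f0 by (auto simp: K_def indicator_def)
    have split: "f = (\<lambda>x. m * indicator K x + h x)" unfolding h_def by auto
    \<comment> \<open>The nonzero values of \<open>h\<close> are those of \<open>f\<close> above
      \<open>m\<close>, shifted down by \<open>m\<close>. The value \<open>m\<close> itself becomes
      0, so the number of nonzero values drops.\<close>
    have rng: "range h - {0} \<subseteq> (\<lambda>y. y - m) ` (range f - {0} - {m})"
    proof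
      fix y assume "y \<in> range h - {0}"
      then obtain x where x: "y = h x" "h x \<noteq> 0" by auto
      have "x \<in> K" using x zero[of x] unfolding h_def by (cases "x \<in> K") simp_all
      then have hx: "h x = f x - m" unfolding h_def by simp
      have "f x \<noteq> 0" using \<open>x \<in> K\<close> m0 unfolding K_def by auto
      then show "y \<in> (\<lambda>y. y - m) ` (range f - {0} - {m})" using x hx by auto
    qed
    have "card (range h - {0}) \<le> card (range f - {0} - {m})"
      using surj_card_le[OF _ rng] fin by simp
    also have "\<dots> < card (range f - {0})" using m(1) fin by (intro psubset_card_mono) auto
    finally have card: "card (range h - {0}) < card (range f - {0})" .
    have finh: "finite (range h)"
      using finite_subset[OF rng] fin by simp
    have hU: "h \<in> USC"
    proof (rule finite_range_USC[OF finh h0])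
      fix q :: real assume q: "0 < q"
      have "q \<le> h x \<longleftrightarrow> q + m \<le> f x" for x
        using zero[of x] q m0 f0[of x] unfolding h_def by (cases "x \<in> K") auto
      then have "{x. q \<le> h x} = {x. q + m \<le> f x}" by simp
      then show "compact {x. q \<le> h x}" using compact_superlevel[OF less.prems(1), of "q + m"] q m0 by simp
    qed
    have gU: "(\<lambda>x. m * indicator K x) \<in> USC"
    proof (rule finite_range_USC)
      show "finite (range (\<lambda>x. m * indicator K x))"
        by (rule finite_subset[of _ "{0, m}"]) (auto simp: indicator_def)
      show "0 \<le> m * indicator K x" for x using m0 by simp
      fix q :: real assume q: "0 < q"
      have "{x. q \<le> m * indicator K x} = (if q \<le> m then K else {})"
        using q by (auto simp: indicator_def)
      then show "compact {x. q \<le> m * indicator K x}" using K by simp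
    qed
    \<comment> \<open>Both functions are nonnegative and vanish off \<open>K\<close>, while the
      indicator is constant on \<open>K\<close>; hence they never move in opposite
      directions.\<close>
    have co: "0 \<le> (m * indicator K x - m * indicator K y) * (h x - h y)" for x y
    proof -
      have hz: "h z = 0" if "z \<notin> K" for z using zero[OF that] that unfolding h_def by simp
      show ?thesis using m0 h0 hz by (cases "x \<in> K"; cases "y \<in> K") simp_all
    qed
    have "T f = T (\<lambda>x. m * indicator K x) + T h"
      by (subst split) (rule add[OF gU hU co])
    also have "\<dots> = T' (\<lambda>x. m * indicator K x) + T' h"
      using ind[of m K] K m0 less.hyps[OF card hU finh] by simp
    also have "\<dots> = T' (\<lambda>x. m * indicator K x + h x)" by (rule add'[OF gU hU co, symmetric])
    finally show ?thesis using split by simp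
  qed
qed

subsection \<open>Frechet laws\<close>

lemma unit_frechetD:
  assumes "unit_frechet M V a"
  shows "0 \<le> a" "V \<in> borel_measurable M"
    "0 < t \<Longrightarrow> measure M {\<omega>\<in>space M. V \<omega> \<le> ennreal t} = exp (- a / t)"
  using assms unfolding unit_frechet_def by auto

text \<open>The level \<open>t = 1\<close> already determines the scale, so the definite description
  in \<open>frechet_scale\<close> is meaningful as soon as the law is Frechet.\<close>

lemma unit_frechet_unique:
  assumes "unit_frechet M V a" "unit_frechet M V b" shows "a = b"
proof -
  have "exp (- a / 1) = exp (- b / 1)"
    using unit_frechetD(3)[OF assms(1), of 1] unit_frechetD(3)[OF assms(2), of 1] by simp
  then show ?thesis by simp
qed

lemma unit_frechet_cong:
  assumes "\<And>\<omega>. \<omega> \<in> space M \<Longrightarrow> V \<omega> = W \<omega>"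
  shows "unit_frechet M V a \<longleftrightarrow> unit_frechet M W a"
proof -
  have "V \<in> borel_measurable M \<longleftrightarrow> W \<in> borel_measurable M" by (rule measurable_cong) (rule assms)
  moreover have "{\<omega>\<in>space M. V \<omega> \<le> y} = {\<omega>\<in>space M. W \<omega> \<le> y}" for y using assms by auto
  ultimately show ?thesis unfolding unit_frechet_def by simp
qed

lemma frechet_scale_eq: "unit_frechet M V a \<Longrightarrow> frechet_scale M V = a"
  unfolding frechet_scale_def using unit_frechet_unique by (metis the_equality)

lemma unit_frechet_0: 
  assumes "prob_space M" shows "unit_frechet M (\<lambda>_. 0) 0"
  using prob_space.prob_space[OF assms] unfolding unit_frechet_def by simp

lemma (in prob_space) unit_frechet_mono:
  assumes V: "unit_frechet M V a" and W: "unit_frechet M W b"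
    and le: "\<And>\<omega>. \<omega> \<in> space M \<Longrightarrow> V \<omega> \<le> W \<omega>"
  shows "a \<le> b"
proof -
  have [measurable]: "V \<in> borel_measurable M" using V unfolding unit_frechet_def by auto
  have "prob {\<omega>\<in>space M. W \<omega> \<le> ennreal 1} \<le> prob {\<omega>\<in>space M. V \<omega> \<le> ennreal 1}"
    by (rule finite_measure_mono) (auto intro: order_trans[OF le])
  then have "exp (- b / 1) \<le> exp (- a / 1)"
    using unit_frechetD(3)[OF V, of 1] unit_frechetD(3)[OF W, of 1] by simp
  then show ?thesis by simp
qed

text \<open>The events \<open>V n \<omega> \<le> t\<close> decrease to the event that the supremum
  is at most \<open>t\<close>, so the distribution functions converge. The common bound
  \<open>b\<close> keeps the scales from diverging.\<close>

lemma (in prob_space) unit_frechet_SUP: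
  assumes V: "\<And>n. unit_frechet M (V n) (a n)" and mono: "\<And>\<omega>. \<omega> \<in> space M \<Longrightarrow> incseq (\<lambda>n. V n \<omega>)"
    and bd: "\<And>n. a n \<le> b"
  shows "\<exists>l. a \<longlonglongrightarrow> l \<and> unit_frechet M (\<lambda>\<omega>. SUP n. V n \<omega>) l"
proof -
  have [measurable]: "V n \<in> borel_measurable M" for n using V unfolding unit_frechet_def by auto
  have "incseq a" using mono
    by (intro incseq_SucI unit_frechet_mono[OF V V]) (auto simp: incseq_Suc_iff)
  then obtain l where l: "a \<longlonglongrightarrow> l" "\<And>n. a n \<le> l"
    using incseq_convergent[of a b] bd by auto
  have "0 \<le> a 0" using V unfolding unit_frechet_def by auto
  then have "0 \<le> l" using l(2)[of 0] by simp
  moreover have "prob {\<omega>\<in>space M. (SUP n. V n \<omega>) \<le> ennreal t} = exp (- l / t)" if "0 < t" for t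
  proof -
    have "(\<lambda>n. prob {\<omega>\<in>space M. V n \<omega> \<le> ennreal t}) \<longlonglongrightarrow> prob (\<Inter>n. {\<omega>\<in>space M. V n \<omega> \<le> ennreal t})"
    proof (rule finite_Lim_measure_decseq)
      show "range (\<lambda>n. {\<omega> \<in> space M. V n \<omega> \<le> ennreal t}) \<subseteq> events" by auto
      show "decseq (\<lambda>n. {\<omega> \<in> space M. V n \<omega> \<le> ennreal t})"
        using mono by (force simp: decseq_def incseq_def intro: order_trans)
    qed
    also have "(\<Inter>n. {\<omega>\<in>space M. V n \<omega> \<le> ennreal t}) = {\<omega>\<in>space M. (SUP n. V n \<omega>) \<le> ennreal t}"
      by (auto simp: SUP_le_iff)
    finally have "(\<lambda>n. exp (- a n / t)) \<longlonglongrightarrow> prob {\<omega>\<in>space M. (SUP n. V n \<omega>) \<le> ennreal t}"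
      using V that unfolding unit_frechet_def by simp
    moreover have "(\<lambda>n. exp (- a n / t)) \<longlonglongrightarrow> exp (- l / t)"
      using that by (intro tendsto_intros l) auto
    ultimately show ?thesis by (rule LIMSEQ_unique)
  qed
  ultimately show ?thesis using l unfolding unit_frechet_def by auto
qed

subsection \<open>Coding 0-1 sequences in the Cantor set\<close>

text \<open>The digit functions are continuous on the whole line, so weak limits of laws on the Cantor
  set may be tested against them.\<close>

primrec cantor_digit :: "nat \<Rightarrow> real \<Rightarrow> real" where
  "cantor_digit 0 x = max 0 (min 1 (3 * x - 1))"
| "cantor_digit (Suc i) x = cantor_digit i (3 * x - 2 * max 0 (min 1 (3 * x - 1)))"

text \<open>The ternary expansion with digits 0 and 2. A code starting with \<open>False\<close> is
  at most 1/3, one starting with \<open>True\<close> at least 2/3; in the gap the clipped function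
  \<open>3 * x - 1\<close> can interpolate continuously between the two digits.\<close>

definition cantor_code :: "(nat \<Rightarrow> bool) \<Rightarrow> real" where
  "cantor_code e = (\<Sum>i. 2 / 3 ^ Suc i * of_bool (e i))"

lemma continuous_cantor_digit: "continuous_on UNIV (cantor_digit i)"
proof (induction i)
  case 0
  have "continuous_on UNIV (\<lambda>x::real. max 0 (min 1 (3 * x - 1)))" by (intro continuous_intros)
  then show ?case by (simp add: fun_eq_iff[symmetric])
next
  case (Suc i)
  have "continuous_on UNIV (\<lambda>x::real. 3 * x - 2 * max 0 (min 1 (3 * x - 1)))" by (intro continuous_intros)
  from continuous_on_compose2[OF Suc this] show ?case by (simp add: fun_eq_iff[symmetric])
qed

lemma cantor_digit_bounds: "0 \<le> cantor_digit i x" "cantor_digit i x \<le> 1"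
  by (induction i arbitrary: x) auto

lemma cantor_code_sums: "(\<lambda>i. 2 / 3 ^ Suc i) sums (1::real)"
proof -
  have "(\<lambda>i. (2/3) * (1/3) ^ i) sums ((2/3) * (1 / (1 - 1/3 :: real)))"
    by (intro sums_mult geometric_sums) simp
  then show ?thesis by (simp add: power_one_over field_simps)
qed

lemma summable_cantor_code: "summable (\<lambda>i. 2 / 3 ^ Suc i * of_bool (e i) :: real)"
  by (rule summable_comparison_test'[OF sums_summable[OF cantor_code_sums], of 0]) auto

lemma cantor_code_bounds: "0 \<le> cantor_code e" "cantor_code e \<le> 1"
proof -
  show "0 \<le> cantor_code e" unfolding cantor_code_def by (intro suminf_nonneg summable_cantor_code) auto
  have "cantor_code e \<le> (\<Sum>i. 2 / 3 ^ Suc i)"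
    unfolding cantor_code_def by (intro suminf_le summable_cantor_code sums_summable[OF cantor_code_sums]) auto
  then show "cantor_code e \<le> 1" using sums_unique[OF cantor_code_sums] by simp
qed

lemma cantor_code_split: "cantor_code e = 2 / 3 * of_bool (e 0) + cantor_code (\<lambda>i. e (Suc i)) / 3"
proof -
  have "cantor_code e = (\<Sum>i. 2 / 3 ^ Suc (Suc i) * of_bool (e (Suc i))) + 2 / 3 ^ Suc 0 * of_bool (e 0)"
    unfolding cantor_code_def by (subst suminf_split_head[OF summable_cantor_code]) simp
  also have "(\<Sum>i. 2 / 3 ^ Suc (Suc i) * of_bool (e (Suc i))) = (\<Sum>i. (1 / 3) * (2 / 3 ^ Suc i * of_bool (e (Suc i)) :: real))"
    by (rule suminf_cong) simp
  also have "\<dots> = (1 / 3) * cantor_code (\<lambda>i. e (Suc i))"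
    unfolding cantor_code_def by (rule suminf_mult[OF summable_cantor_code])
  finally show ?thesis by simp
qed

text \<open>On a code, clipping \<open>3 * x - 1\<close> to the unit interval returns the first
  digit exactly; subtracting twice that digit from \<open>3 * x\<close> leaves the code of the
  shifted sequence, to which the induction applies.\<close>

lemma cantor_digit_code: "cantor_digit i (cantor_code e) = of_bool (e i)"
proof (induction i arbitrary: e)
  case 0
  show ?case using cantor_code_split[of e] cantor_code_bounds[of "\<lambda>i. e (Suc i)"] by (cases "e 0") auto
next
  case (Suc i)
  have "max 0 (min 1 (3 * cantor_code e - 1)) = of_bool (e 0)"
    using cantor_code_split[of e] cantor_code_bounds[of "\<lambda>i. e (Suc i)"] by (cases "e 0") auto
  then have "cantor_digit (Suc i) (cantor_code e) = cantor_digit i (3 * cantor_code e - 2 * of_bool (e 0))" by simp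
  also have "3 * cantor_code e - 2 * of_bool (e 0) = cantor_code (\<lambda>i. e (Suc i))"
    using cantor_code_split[of e] by (simp add: field_simps)
  finally show ?case using Suc by simp
qed

text \<open>A limit of the rescaled laws of \<open>(\<lambda>i. \<omega> \<in> E n i)\<close>. The limiting intensity may be infinite, so
  it is tilted by the summable weight \<open>w = (\<Sum>i. a i * digit i)\<close>; the factor \<open>c = s / w\<close> undoes the tilt.\<close>

lemma rescaled_indicator_limit:
  fixes E :: "nat \<Rightarrow> nat \<Rightarrow> 'm set" and \<theta> :: "nat \<Rightarrow> real"
  assumes M: "prob_space M" and E: "\<And>n i. E n i \<in> sets M"
    and law: "\<And>n i. measure M (E n i) = 1 - exp (- \<theta> i / (real n + 1))"
    and \<theta>: "\<And>i. 0 \<le> \<theta> i" "0 < \<theta> i0"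
  obtains \<nu> :: "real measure" and c :: "real \<Rightarrow> real" and e :: "nat \<Rightarrow> real \<Rightarrow> bool" where
    "prob_space \<nu>" "sets \<nu> = sets borel" "c \<in> borel_measurable borel" "\<And>i. {x. e i x} \<in> sets borel"
    "AE x in \<nu>. 0 < c x" "AE x in \<nu>. \<exists>i. e i x"
    "\<And>i. (\<integral>\<^sup>+x. ennreal (c x) * indicator {x. e i x} x \<partial>\<nu>) = ennreal (\<theta> i)"
    "\<forall>i j k. (\<forall>n. E n k = E n i \<union> E n j) \<longrightarrow> (AE x in \<nu>. e k x \<longleftrightarrow> e i x \<or> e j x)"
proof -
  interpret prob_space M by fact
  note [measurable] = E
  \<comment> \<open>The level of exceedance, shifted by one to be positive at \<open>n = 0\<close>;
    \<open>t n * prob (E n i)\<close> is the rescaled intensity of a hit.\<close>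
  define t where "t n = real n + 1" for n :: nat
  have t0: "0 < t n" for n unfolding t_def by simp
  \<comment> \<open>The bound is uniform in \<open>n\<close> and serves as domination when the
    normalizing constants converge.\<close>
  have p_le: "t n * prob (E n i) \<le> \<theta> i" for n i
  proof -
    have "1 + (- \<theta> i / t n) \<le> exp (- \<theta> i / t n)" by (rule exp_ge_add_one_self)
    then have "prob (E n i) \<le> \<theta> i / t n" unfolding law t_def by simp
    then show ?thesis using t0[of n] by (simp add: field_simps)
  qed
  have p_lim: "(\<lambda>n. t n * prob (E n i)) \<longlonglongrightarrow> \<theta> i" for i
    unfolding law t_def by real_asymp
  \<comment> \<open>Dividing by \<open>1 + \<theta> i\<close> makes both \<open>a\<close> and
    \<open>a * \<theta>\<close> summable: the former gives a bounded continuous weight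
    \<open>w\<close>, the latter a finite limiting mass \<open>s\<close>.\<close>
  define a where "a i = (1 / 2) ^ Suc i / (1 + \<theta> i)" for i
  have a0: "0 < a i" for i unfolding a_def using \<theta>(1)[of i] by (intro divide_pos_pos) auto
  have half: "(\<lambda>i. (1/2::real) ^ Suc i) sums 1" by (rule power_half_series)
  have a_le: "a i \<le> (1/2) ^ Suc i" "a i * \<theta> i \<le> (1/2) ^ Suc i" for i
    unfolding a_def using \<theta>(1)[of i] by (auto simp: divide_simps intro: mult_left_mono)
  have a_sum: "summable a"
    by (rule summable_comparison_test'[OF sums_summable[OF half], of 0]) (use a0 a_le in \<open>auto simp: less_imp_le abs_of_pos\<close>)
  have a\<theta>_sum: "summable (\<lambda>i. a i * \<theta> i)"
    by (rule summable_comparison_test'[OF sums_summable[OF half], of 0])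
      (use a0 a_le \<theta> in \<open>auto simp: less_imp_le abs_mult abs_of_pos\<close>)
  define s where "s = (\<Sum>i. a i * \<theta> i)"
  have s0: "0 < s"
    unfolding s_def by (rule suminf_pos2[OF a\<theta>_sum, of i0]) (use a0 \<theta> in \<open>auto simp: less_imp_le\<close>)
  define w where "w x = (\<Sum>i. a i * cantor_digit i x)" for x
  have w_sum: "summable (\<lambda>i. a i * cantor_digit i x)" for x
    by (rule summable_comparison_test'[OF a_sum, of 0])
      (use a0 cantor_digit_bounds in \<open>auto simp: abs_mult less_imp_le abs_of_pos intro!: mult_left_le\<close>)
  have w_cont: "continuous_on UNIV w"
    unfolding w_def[abs_def]
  proof (rule uniform_limit_theorem[OF _ Weierstrass_m_test[OF _ a_sum]])
    show "\<forall>\<^sub>F n in sequentially. continuous_on UNIV (\<lambda>x. \<Sum>i<n. a i * cantor_digit i x)"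
      by (intro always_eventually allI continuous_intros continuous_cantor_digit)
    show "norm (a n * cantor_digit n x) \<le> a n" for n x
      using a0[of n] cantor_digit_bounds[of n x] by (simp add: abs_mult mult_left_le)
  qed simp
  have w_ge: "a i * cantor_digit i x \<le> w x" for i x
    unfolding w_def using sum_le_suminf[OF w_sum, of "{i}" x] a0 cantor_digit_bounds by (simp add: less_imp_le)
  have w0: "0 \<le> w x" for x using w_ge[of 0 x] a0[of 0] cantor_digit_bounds[of 0 x]
    by (meson less_imp_le mult_nonneg_nonneg order_trans)
  have dig_m[measurable]: "cantor_digit i \<in> borel_measurable borel" for i
    by (rule borel_measurable_continuous_onI[OF continuous_cantor_digit])
  have w_m[measurable]: "w \<in> borel_measurable borel" by (rule borel_measurable_continuous_onI[OF w_cont])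
  define S where "S n \<omega> = cantor_code (\<lambda>i. \<omega> \<in> E n i)" for n \<omega>
  have S_m[measurable]: "S n \<in> borel_measurable M" for n
    unfolding S_def[abs_def] cantor_code_def of_bool_def by measurable
  have S_dig: "cantor_digit i (S n \<omega>) = of_bool (\<omega> \<in> E n i)" for i n \<omega>
    unfolding S_def by (rule cantor_digit_code)
  \<comment> \<open>The mean of \<open>t n * w (S n \<omega>)\<close>, hence the normalizing
    constant of the tilted law. It converges to \<open>s\<close> by exchanging limit and sum under
    the domination by \<open>a i * \<theta> i\<close>.\<close>
  define Z where "Z n = (\<Sum>i. a i * (t n * prob (E n i)))" for n
  have Z_sum: "summable (\<lambda>i. a i * (t n * prob (E n i)))" for n
    by (rule summable_comparison_test'[OF a\<theta>_sum, of 0])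
      (use a0 p_le t0 in \<open>auto simp: abs_mult abs_of_pos less_imp_le intro!: mult_left_mono\<close>)
  have Z0: "0 < Z n" for n
    unfolding Z_def
  proof (rule suminf_pos2[OF Z_sum, of _ i0])
    show "0 \<le> a i * (t n * prob (E n i))" for i using a0 t0 by (simp add: less_imp_le)
    have "- \<theta> i0 / (real n + 1) < 0" using \<theta>(2) by (simp add: divide_less_0_iff)
    then have "0 < prob (E n i0)" unfolding law by simp
    then show "0 < a i0 * (t n * prob (E n i0))" using a0 t0 by simp
  qed
  have Z_lim: "Z \<longlonglongrightarrow> s"
    unfolding s_def Z_def[abs_def]
  proof (rule tannerys_theorem[THEN conjunct2, THEN conjunct2])
    show "(\<lambda>n. a i * (t n * prob (E n i))) \<longlonglongrightarrow> a i * \<theta> i" for i by (intro tendsto_mult tendsto_const p_lim)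
    show "\<forall>\<^sub>F (i, n) in at_top \<times>\<^sub>F sequentially. norm (a i * (t n * prob (E n i))) \<le> a i * \<theta> i"
      using a0 p_le t0 by (intro always_eventually) (auto simp: abs_mult abs_of_pos less_imp_le intro!: mult_left_mono)
  qed (use a\<theta>_sum in auto)
  have W_int: "(\<integral>\<^sup>+\<omega>. ennreal (t n * w (S n \<omega>)) \<partial>M) = ennreal (Z n)" for n
  proof -
    have "(\<integral>\<^sup>+\<omega>. ennreal (t n * w (S n \<omega>)) \<partial>M) = (\<integral>\<^sup>+\<omega>. (\<Sum>i. ennreal (a i * t n) * indicator (E n i) \<omega>) \<partial>M)"
    proof (rule nn_integral_cong)
      fix \<omega>
      have "(\<Sum>i. ennreal (a i * t n) * indicator (E n i) \<omega>) = (\<Sum>i. ennreal (t n * (a i * cantor_digit i (S n \<omega>))))"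
        using a0 t0 by (intro suminf_cong) (auto simp: S_dig indicator_def mult.commute)
      also have "\<dots> = ennreal (\<Sum>i. t n * (a i * cantor_digit i (S n \<omega>)))"
        using a0 t0 cantor_digit_bounds by (intro suminf_ennreal2 summable_mult w_sum) (auto simp: less_imp_le)
      also have "(\<Sum>i. t n * (a i * cantor_digit i (S n \<omega>))) = t n * w (S n \<omega>)"
        unfolding w_def by (rule suminf_mult[OF w_sum])
      finally show "ennreal (t n * w (S n \<omega>)) = (\<Sum>i. ennreal (a i * t n) * indicator (E n i) \<omega>)" ..
    qed
    also have "\<dots> = (\<Sum>i. ennreal (a i * t n) * emeasure M (E n i))"
      by (subst nn_integral_suminf) (auto simp: nn_integral_cmult_indicator)
    also have "\<dots> = (\<Sum>i. ennreal (a i * (t n * prob (E n i))))"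
      using a0 t0 by (intro suminf_cong) (simp add: emeasure_eq_measure ennreal_mult[symmetric] less_imp_le mult.assoc)
    also have "\<dots> = ennreal (Z n)"
      unfolding Z_def using a0 t0 by (intro suminf_ennreal2 Z_sum) (auto simp: less_imp_le)
    finally show ?thesis .
  qed
  define D where "D n \<omega> = t n * w (S n \<omega>) / Z n" for n \<omega>
  have D0: "0 \<le> D n \<omega>" for n \<omega> unfolding D_def using w0 t0[of n] Z0[of n] by (simp add: less_imp_le)
  have D_m[measurable]: "D n \<in> borel_measurable M" for n unfolding D_def[abs_def] by measurable
  \<comment> \<open>The tilted probability: each pattern is weighted by \<open>w\<close>, so
    patterns without any hit receive no mass.\<close>
  define R where "R n = density M (\<lambda>\<omega>. ennreal (D n \<omega>))" for n
  have R_prob: "prob_space (R n)" for n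
  proof (rule prob_spaceI)
    have "emeasure (R n) (space (R n)) = (\<integral>\<^sup>+\<omega>. ennreal (D n \<omega>) \<partial>M)"
      unfolding R_def by (simp add: emeasure_density cong: nn_integral_cong)
    also have "\<dots> = (\<integral>\<^sup>+\<omega>. ennreal (1 / Z n) * ennreal (t n * w (S n \<omega>)) \<partial>M)"
      unfolding D_def using Z0[of n] t0[of n] w0 by (intro nn_integral_cong) (simp add: ennreal_mult[symmetric])
    also have "\<dots> = ennreal (1 / Z n) * ennreal (Z n)"
      by (subst nn_integral_cmult) (simp_all add: W_int)
    also have "\<dots> = 1" using Z0[of n] by (simp add: ennreal_mult[symmetric])
    finally show "emeasure (R n) (space (R n)) = 1" .
  qed
  define \<mu> where "\<mu> n = distr (R n) borel (S n)" for n
  have SR_m[measurable]: "S n \<in> borel_measurable (R n)" for n unfolding R_def by simp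
  have \<mu>_dist: "real_distribution (\<mu> n)" for n
    unfolding \<mu>_def by (rule prob_space.real_distribution_distr[OF R_prob]) simp
  have \<mu>_int: "(\<integral>x. f x \<partial>\<mu> n) = (\<integral>\<omega>. D n \<omega> * f (S n \<omega>) \<partial>M)" if [measurable]: "f \<in> borel_measurable borel" for f :: "real \<Rightarrow> real" and n
  proof -
    have "(\<integral>x. f x \<partial>\<mu> n) = (\<integral>\<omega>. f (S n \<omega>) \<partial>R n)" unfolding \<mu>_def by (rule integral_distr) measurable
    also have "\<dots> = (\<integral>\<omega>. D n \<omega> * f (S n \<omega>) \<partial>M)" unfolding R_def using D0 by (subst integral_density) auto
    finally show ?thesis .
  qed
  have "tight \<mu>"
    unfolding tight_def
  proof (intro conjI allI impI)
    fix \<epsilon> :: real assume "0 < \<epsilon>"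
    \<comment> \<open>Tightness is stated with intervals open on the left, so starting at -1 keeps
      the code 0 inside.\<close>
    have "measure (\<mu> n) {-1<..1} = 1" for n
    proof -
      interpret Rn: prob_space "R n" by (rule R_prob)
      have "measure (\<mu> n) {-1<..1} = Rn.prob (S n -` {-1<..1} \<inter> space (R n))"
        unfolding \<mu>_def by (rule measure_distr) auto
      also have "S n -` {-1<..1} \<inter> space (R n) = space (R n)"
      proof -
        have "-1 < cantor_code e" for e using cantor_code_bounds(1)[of e] by linarith
        then show ?thesis using cantor_code_bounds(2) unfolding S_def by auto
      qed
      finally show ?thesis using Rn.prob_space by simp
    qed
    then show "\<exists>a b. a < b \<and> (\<forall>n. 1 - \<epsilon> < measure (\<mu> n) {a<..b})"
      using \<open>0 < \<epsilon>\<close> by (intro exI[of _ "-1"] exI[of _ 1]) simp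
  qed (rule \<mu>_dist)
  from tight_imp_convergent_subsubsequence[OF this strict_mono_id]
  obtain r \<nu> where r: "strict_mono (r :: nat \<Rightarrow> nat)" and \<nu>: "real_distribution \<nu>" and conv: "weak_conv_m (\<mu> \<circ> id \<circ> r) \<nu>"
    by auto
  interpret \<nu>: real_distribution \<nu> by (rule \<nu>)
  have lim: "(\<lambda>n. \<integral>x. f x \<partial>\<mu> (r n)) \<longlonglongrightarrow> (\<integral>x. f x \<partial>\<nu>)"
    if f: "continuous_on UNIV f" "\<And>x. \<bar>f x\<bar> \<le> B" for f :: "real \<Rightarrow> real" and B
  proof -
    have "(\<lambda>n. integral\<^sup>L ((\<mu> \<circ> id \<circ> r) n) f) \<longlonglongrightarrow> integral\<^sup>L \<nu> f"
      by (rule weak_conv_imp_integral_bdd_continuous_conv[OF _ \<nu> conv, of f B])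
        (use \<mu>_dist f in \<open>auto simp: continuous_on_eq_continuous_at\<close>)
    then show ?thesis by simp
  qed
  have \<nu>_int: "integrable \<nu> f" if "continuous_on UNIV f" "\<And>x. \<bar>f x\<bar> \<le> B" for f :: "real \<Rightarrow> real" and B
  proof (rule \<nu>.integrable_const_bound[of _ B])
    show "f \<in> borel_measurable \<nu>"
      using borel_measurable_continuous_onI[OF that(1)] by (subst measurable_cong_sets[OF \<nu>.events_eq_borel refl])
  qed (use that in simp)
  \<comment> \<open>An identity between digits valid for all codes is the vanishing of a nonnegative
    continuous function on the codes. Its integral against every \<open>\<mu> n\<close> is 0, hence
    so is the integral against the weak limit.\<close>
  have AE_zero: "AE x in \<nu>. f x = 0"
    if f: "continuous_on UNIV f" "\<And>x. 0 \<le> f x" "\<And>x. f x \<le> 1" and z: "\<And>n \<omega>. f (S n \<omega>) = 0" for f :: "real \<Rightarrow> real"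
  proof -
    have B: "\<bar>f x\<bar> \<le> 1" for x using f by simp
    have [measurable]: "f \<in> borel_measurable borel" by (rule borel_measurable_continuous_onI[OF f(1)])
    have "(\<integral>x. f x \<partial>\<mu> n) = 0" for n using z by (simp add: \<mu>_int)
    then have "(\<integral>x. f x \<partial>\<nu>) = 0" using lim[OF f(1) B] by (simp add: LIMSEQ_const_iff)
    then show ?thesis using integral_nonneg_eq_0_iff_AE[OF \<nu>_int[OF f(1) B]] f(2) by simp
  qed
  have dig01: "AE x in \<nu>. \<forall>i. cantor_digit i x = 0 \<or> cantor_digit i x = 1"
    unfolding AE_all_countable
  proof
    fix i
    have "AE x in \<nu>. cantor_digit i x * (1 - cantor_digit i x) = 0"
    proof (rule AE_zero)
      show "continuous_on UNIV (\<lambda>x. cantor_digit i x * (1 - cantor_digit i x))"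
        by (intro continuous_intros continuous_cantor_digit)
      show "0 \<le> cantor_digit i x * (1 - cantor_digit i x)" "cantor_digit i x * (1 - cantor_digit i x) \<le> 1" for x
        using cantor_digit_bounds[of i x] by (auto intro: mult_le_one)
      show "cantor_digit i (S n \<omega>) * (1 - cantor_digit i (S n \<omega>)) = 0" for n \<omega> unfolding S_dig by simp
    qed
    then show "AE x in \<nu>. cantor_digit i x = 0 \<or> cantor_digit i x = 1" by (rule AE_mp) (auto intro!: AE_I2)
  qed
  \<comment> \<open>Ideally the digit divided by \<open>w\<close>, which removes the tilt. Wherever
    the digit is 1, \<open>w x\<close> is at least \<open>a m\<close>, so the maximum with
    \<open>a m\<close> changes nothing there, while it makes the quotient bounded and continuous on
    the whole line.\<close>
  define h where "h m x = cantor_digit m x / max (w x) (a m)" for m x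
  have h_cont: "continuous_on UNIV (h m)" for m
    unfolding h_def[abs_def] using a0[of m]
    by (intro continuous_intros continuous_cantor_digit w_cont) (auto simp: max_def)
  have h0: "0 \<le> h m x" for m x unfolding h_def using cantor_digit_bounds[of m x] a0[of m] by (intro divide_nonneg_nonneg) auto
  have h_bd: "\<bar>h m x\<bar> \<le> 1 / a m" for m x
    using h0[of m x] unfolding h_def using cantor_digit_bounds[of m x] a0[of m] by (auto intro!: frac_le)
  have h_m[measurable]: "h m \<in> borel_measurable borel" for m by (rule borel_measurable_continuous_onI[OF h_cont])
  have h_eq: "h m x = of_bool (cantor_digit m x = 1) / w x" if "cantor_digit m x = 0 \<or> cantor_digit m x = 1" for m x
    using that w_ge[of m x] unfolding h_def by (auto simp: max_def)
  have h_int: "(\<integral>x. h m x \<partial>\<nu>) = \<theta> m / s" for m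
  proof -
    have "(\<integral>x. h m x \<partial>\<mu> n) = t n * prob (E n m) / Z n" for n
    proof -
      \<comment> \<open>The weight in the density cancels the denominator of \<open>h m\<close>,
        leaving a multiple of the original event. This is how the limit recovers \<theta>
        exactly.\<close>
      have "D n \<omega> * h m (S n \<omega>) = t n / Z n * indicator (E n m) \<omega>" for \<omega>
      proof (cases "\<omega> \<in> E n m")
        case True
        then have "a m \<le> w (S n \<omega>)" using w_ge[of m "S n \<omega>"] by (simp add: S_dig)
        then show ?thesis using True a0[of m] unfolding D_def h_def by (simp add: S_dig max_def)
      next
        case False then show ?thesis unfolding h_def by (simp add: S_dig)
      qed
      then have "(\<integral>x. h m x \<partial>\<mu> n) = (\<integral>\<omega>. t n / Z n * indicator (E n m) \<omega> \<partial>M)" by (simp add: \<mu>_int)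
      then show ?thesis using sets.sets_into_space[OF E] by (simp add: Int_absorb2)
    qed
    then have "(\<lambda>n. t (r n) * prob (E (r n) m) / Z (r n)) \<longlonglongrightarrow> (\<integral>x. h m x \<partial>\<nu>)"
      using lim[OF h_cont h_bd, of m] by simp
    moreover have "(\<lambda>n. t (r n) * prob (E (r n) m) / Z (r n)) \<longlonglongrightarrow> \<theta> m / s"
      using s0 LIMSEQ_subseq_LIMSEQ[OF p_lim r, of m] LIMSEQ_subseq_LIMSEQ[OF Z_lim r]
      by (intro tendsto_divide) (auto simp: comp_def)
    ultimately show ?thesis by (rule LIMSEQ_unique)
  qed
  have h_nn: "(\<integral>\<^sup>+x. ennreal (h m x) \<partial>\<nu>) = ennreal (\<theta> m / s)" for m
    using nn_integral_eq_integral[OF \<nu>_int[OF h_cont h_bd]] h0 h_int by simp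
  \<comment> \<open>Mass could drift to the pattern without hits, where the factor
    \<open>s / w x\<close> breaks down. It does not: the combination of the \<open>h m\<close> with
    weights \<open>a m\<close> has integral 1 and is bounded by the indicator of
    \<open>w > 0\<close>, so that set has full measure.\<close>
  have w_pos: "AE x in \<nu>. 0 < w x"
  proof -
    have ge: "(\<Sum>m. ennreal (a m * h m x)) \<le> indicator {x. 0 < w x} x"
      if x: "\<forall>i. cantor_digit i x = 0 \<or> cantor_digit i x = 1" for x
    proof (cases "0 < w x")
      case True
      have "(\<lambda>m. a m * h m x) sums (w x / w x)"
      proof -
        have "(\<lambda>m. a m * cantor_digit m x / w x) sums (w x / w x)"
          unfolding w_def by (intro sums_divide summable_sums w_sum)
        moreover have "a m * h m x = a m * cantor_digit m x / w x" for m
          using h_eq[of m x] x[rule_format, of m] by auto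
        ultimately show ?thesis by simp
      qed
      then have "(\<Sum>m. ennreal (a m * h m x)) = ennreal (w x / w x)"
        using a0 h0 by (intro suminf_ennreal_eq) (auto simp: less_imp_le)
      then show ?thesis using True by simp
    next
      case False
      then have "w x = 0" using w0[of x] by simp
      then have "cantor_digit m x = 0" for m
        using w_ge[of m x] a0[of m] cantor_digit_bounds[of m x] by (simp add: mult_le_0_iff)
      then have "h m x = 0" for m unfolding h_def by simp
      then show ?thesis by simp
    qed
    have "1 = ennreal (s / s)" using s0 by simp
    also have "s / s = (\<Sum>m. a m * (\<theta> m / s))"
      unfolding s_def[symmetric] using suminf_divide[OF a\<theta>_sum, of s] unfolding s_def[symmetric] by simp
    also have "ennreal \<dots> = (\<Sum>m. ennreal (a m * (\<theta> m / s)))"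
      using a0 \<theta> s0 summable_divide[OF a\<theta>_sum, of s] by (intro suminf_ennreal2[symmetric]) (auto simp: less_imp_le)
    also have "\<dots> = (\<Sum>m. \<integral>\<^sup>+x. ennreal (a m * h m x) \<partial>\<nu>)"
    proof (rule suminf_cong)
      fix m
      have "(\<integral>\<^sup>+x. ennreal (a m * h m x) \<partial>\<nu>) = (\<integral>\<^sup>+x. ennreal (a m) * ennreal (h m x) \<partial>\<nu>)"
        using a0[of m] by (simp add: ennreal_mult' less_imp_le)
      also have "\<dots> = ennreal (a m) * ennreal (\<theta> m / s)" by (simp add: nn_integral_cmult h_nn)
      also have "\<dots> = ennreal (a m * (\<theta> m / s))" using a0[of m] by (intro ennreal_mult'[symmetric]) simp
      finally show "ennreal (a m * (\<theta> m / s)) = (\<integral>\<^sup>+x. ennreal (a m * h m x) \<partial>\<nu>)" ..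
    qed
    also have "\<dots> = (\<integral>\<^sup>+x. (\<Sum>m. ennreal (a m * h m x)) \<partial>\<nu>)"
      by (rule nn_integral_suminf[symmetric]) measurable
    also have "\<dots> \<le> (\<integral>\<^sup>+x. indicator {x. 0 < w x} x \<partial>\<nu>)"
      by (rule nn_integral_mono_AE, rule AE_mp[OF dig01]) (use ge in auto)
    also have "\<dots> = emeasure \<nu> {x. 0 < w x}" by simp
    finally have "emeasure \<nu> {x. 0 < w x} = 1" using \<nu>.emeasure_le_1 by (simp add: antisym)
    moreover have "{x. 0 < w x} \<in> \<nu>.events" by simp
    ultimately show ?thesis using \<nu>.AE_in_set_eq_1[of "{x. 0 < w x}"] by (simp add: \<nu>.emeasure_eq_measure)
  qed
  show ?thesis
  proof (rule that[of \<nu> "\<lambda>x. s / w x" "\<lambda>i x. cantor_digit i x = 1"])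
    show "prob_space \<nu>" by (rule \<nu>.prob_space_axioms)
    show "sets \<nu> = sets borel" by simp
    show "(\<lambda>x. s / w x) \<in> borel_measurable borel" by measurable
    show "{x. cantor_digit i x = 1} \<in> sets borel" for i by measurable
    show "AE x in \<nu>. 0 < s / w x" using w_pos s0 by (auto elim: AE_mp)
    show "AE x in \<nu>. \<exists>i. cantor_digit i x = 1"
      using w_pos dig01
    proof eventually_elim
      case (elim x)
      show ?case
      proof (rule ccontr)
        assume "\<nexists>i. cantor_digit i x = 1"
        then have "cantor_digit i x = 0" for i using elim(2) by auto
        then have "w x = 0" unfolding w_def by simp
        then show False using elim(1) by simp
      qed
    qed
    show "(\<integral>\<^sup>+x. ennreal (s / w x) * indicator {x. cantor_digit i x = 1} x \<partial>\<nu>) = ennreal (\<theta> i)" for i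
    proof -
      have "(\<integral>\<^sup>+x. ennreal (s / w x) * indicator {x. cantor_digit i x = 1} x \<partial>\<nu>) = (\<integral>\<^sup>+x. ennreal s * ennreal (h i x) \<partial>\<nu>)"
      proof (rule nn_integral_cong_AE, rule AE_mp[OF dig01], intro AE_I2 impI)
        fix x assume "\<forall>i. cantor_digit i x = 0 \<or> cantor_digit i x = 1"
        then have "h i x = of_bool (cantor_digit i x = 1) / w x" by (intro h_eq) simp
        then show "ennreal (s / w x) * indicator {x. cantor_digit i x = 1} x = ennreal s * ennreal (h i x)"
          using s0 w0[of x] by (simp add: ennreal_mult[symmetric] indicator_def)
      qed
      also have "\<dots> = ennreal s * ennreal (\<theta> i / s)" by (simp add: nn_integral_cmult h_nn)
      also have "\<dots> = ennreal (\<theta> i)" using s0 \<theta> by (simp add: ennreal_mult[symmetric])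
      finally show ?thesis .
    qed
  next
    have "AE x in \<nu>. (cantor_digit k x = 1) \<longleftrightarrow> (cantor_digit i x = 1 \<or> cantor_digit j x = 1)"
      if u: "\<forall>n. E n k = E n i \<union> E n j" for i j k
    proof -
    \<comment> \<open>For codes of events, a union is the maximum of the digits, an identity that
      \<open>AE_zero\<close> transfers to the limit.\<close>
    have "AE x in \<nu>. \<bar>cantor_digit k x - max (cantor_digit i x) (cantor_digit j x)\<bar> = 0"
    proof (rule AE_zero)
      show "continuous_on UNIV (\<lambda>x. \<bar>cantor_digit k x - max (cantor_digit i x) (cantor_digit j x)\<bar>)"
        by (intro continuous_intros continuous_cantor_digit)
      show "\<bar>cantor_digit k x - max (cantor_digit i x) (cantor_digit j x)\<bar> \<le> 1" for x
        using cantor_digit_bounds[of i x] cantor_digit_bounds[of j x] cantor_digit_bounds[of k x] by (auto simp: abs_le_iff max_def)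
      show "\<bar>cantor_digit k (S n \<omega>) - max (cantor_digit i (S n \<omega>)) (cantor_digit j (S n \<omega>))\<bar> = 0" for n \<omega>
        unfolding S_dig u[rule_format] by auto
    qed simp
    with dig01 show ?thesis
    proof eventually_elim
      case (elim x)
      then have "cantor_digit k x = max (cantor_digit i x) (cantor_digit j x)" by simp
      with elim(1)[rule_format, of i] elim(1)[rule_format, of j] show ?case
        by (elim disjE) simp_all
    qed
    qed
    then show "\<forall>i j k. (\<forall>n. E n k = E n i \<union> E n j) \<longrightarrow>
        (AE x in \<nu>. (cantor_digit k x = 1) \<longleftrightarrow> (cantor_digit i x = 1 \<or> cantor_digit j x = 1))"
      by simp
  qed
qed

subsection \<open>The spectral law of a max-stable sup-measure\<close>

lemma (in prob_space) unit_frechet_tail: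
  assumes V: "unit_frechet M V a" and t: "0 < t"
  shows "prob {\<omega>\<in>space M. ennreal t < V \<omega>} = 1 - exp (- a / t)"
proof -
  have [measurable]: "V \<in> borel_measurable M" by (rule unit_frechetD(2)[OF V])
  have "prob {\<omega>\<in>space M. V \<omega> \<le> ennreal t} = 1 - prob {\<omega>\<in>space M. ennreal t < V \<omega>}"
    by (subst prob_neg[symmetric]) (auto simp: not_less)
  then show ?thesis using unit_frechetD(3)[OF V t] by simp
qed

lemma (in prob_space) unit_frechet_zero_scale:
  assumes V: "unit_frechet M V 0" shows "AE \<omega> in M. V \<omega> = 0"
proof -
  have [measurable]: "V \<in> borel_measurable M" by (rule unit_frechetD(2)[OF V])
  have "AE \<omega> in M. V \<omega> \<le> ennreal (1 / real (Suc n))" for n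
    using unit_frechetD(3)[OF V, of "1 / real (Suc n)"] prob_Collect_eq_1[of "\<lambda>\<omega>. V \<omega> \<le> ennreal (1 / real (Suc n))"]
    by simp
  then have "AE \<omega> in M. \<forall>n. V \<omega> \<le> ennreal (1 / real (Suc n))" unfolding AE_all_countable by simp
  then show ?thesis
  proof (rule AE_mp, intro AE_I2 impI)
    fix \<omega> assume *: "\<forall>n. V \<omega> \<le> ennreal (1 / real (Suc n))"
    have "(\<lambda>n. ennreal (1 / real (Suc n))) \<longlonglongrightarrow> ennreal 0"
      by (intro tendsto_ennrealI LIMSEQ_Suc lim_1_over_n)
    then have "V \<omega> \<le> ennreal 0" using * by (intro LIMSEQ_le_const) auto
    then show "V \<omega> = 0" by simp
  qed
qed

text \<open>Pathwise continuity of \<open>X\<close> passes to the scales through the exceedance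
  events at level 1. The strict inequality becomes weak in the limit, so the limiting event is
  compared with exceedance of a level \<open>z < 1\<close>, and then \<open>z\<close> tends to
  1.\<close>

lemma (in prob_space) unit_frechet_scale_decseq:
  fixes X :: "'a \<Rightarrow> 'b::t2_space set \<Rightarrow> ennreal"
  assumes X: "random_sup_measure M X" and \<theta>: "\<And>K. compact K \<Longrightarrow> unit_frechet M (\<lambda>\<omega>. X \<omega> K) (\<theta> K)"
    and D: "\<And>n::nat. compact (D n)" "decseq D"
  shows "(\<lambda>n. \<theta> (D n)) \<longlonglongrightarrow> \<theta> (\<Inter>n. D n)"
proof -
  have [measurable]: "(\<lambda>\<omega>. X \<omega> (D n)) \<in> borel_measurable M" for n using random_sup_measureD(2)[OF X D(1)] .
  have mono: "\<theta> K \<le> \<theta> L" if "compact K" "compact L" "K \<subseteq> L" for K L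
    by (rule unit_frechet_mono[OF \<theta> \<theta>]) (use that sup_measure_mono[OF random_sup_measureD(1)[OF X]] in auto)
  have C: "compact (\<Inter>n. D n)"
  proof -
    have "closed (\<Inter>n. D n)" using D(1) compact_imp_closed by (intro closed_INT) auto
    moreover have "(\<Inter>n. D n) = D 0 \<inter> (\<Inter>n. D n)" by auto
    ultimately show ?thesis using compact_Int_closed[OF D(1)[of 0], of "\<Inter>n. D n"] by simp
  qed
  have dec: "decseq (\<lambda>n. \<theta> (D n))" using D mono by (auto simp: decseq_def)
  have ge: "\<theta> (\<Inter>n. D n) \<le> \<theta> (D n)" for n by (rule mono[OF C D(1)]) auto
  obtain l where l: "(\<lambda>n. \<theta> (D n)) \<longlonglongrightarrow> l" "\<And>n. l \<le> \<theta> (D n)"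
    using decseq_convergent[OF dec, of "\<theta> (\<Inter>n. D n)"] ge by auto
  have "\<theta> (\<Inter>n. D n) \<le> l" using l(1) ge by (intro LIMSEQ_le_const) auto
  moreover have "l \<le> \<theta> (\<Inter>n. D n)"
  proof (rule field_le_mult_one_interval)
    fix z :: real assume z: "0 < z" "z < 1"
    let ?A = "\<lambda>n. {\<omega>\<in>space M. ennreal 1 < X \<omega> (D n)}"
    have lim: "(\<lambda>n. prob (?A n)) \<longlonglongrightarrow> prob (\<Inter>n. ?A n)"
    proof (rule finite_Lim_measure_decseq)
      show "decseq ?A"
        unfolding decseq_def
      proof (intro allI impI subsetI)
        fix m n \<omega> assume "m \<le> n" and \<omega>: "\<omega> \<in> ?A n"
        then have "X \<omega> (D n) \<le> X \<omega> (D m)"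
          using D(2) by (intro sup_measure_mono[OF random_sup_measureD(1)[OF X]]) (auto simp: decseq_def)
        then show "\<omega> \<in> ?A m" using \<omega> by (auto intro: less_le_trans)
      qed
    qed auto
    have "1 - exp (- l) \<le> prob (?A n)" for n
      using unit_frechet_tail[OF \<theta>[OF D(1)], of 1 n] l(2)[of n] by simp
    then have "1 - exp (- l) \<le> prob (\<Inter>n. ?A n)" using lim by (intro LIMSEQ_le_const) auto
    also have "\<dots> \<le> prob {\<omega>\<in>space M. ennreal z < X \<omega> (\<Inter>n. D n)}"
    proof (rule finite_measure_mono)
      show "(\<Inter>n. ?A n) \<subseteq> {\<omega>\<in>space M. ennreal z < X \<omega> (\<Inter>n. D n)}"
      proof
        fix \<omega> assume \<omega>: "\<omega> \<in> (\<Inter>n. ?A n)"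
        then have "\<omega> \<in> space M" by auto
        have "(\<lambda>n. X \<omega> (D n)) \<longlonglongrightarrow> X \<omega> (\<Inter>n. D n)"
          by (rule sup_measure_decseq[OF random_sup_measureD(1)[OF X \<open>\<omega> \<in> space M\<close>] D])
        then have "ennreal 1 \<le> X \<omega> (\<Inter>n. D n)" using \<omega> by (intro LIMSEQ_le_const) (auto intro: less_imp_le)
        moreover have "ennreal z < ennreal 1" using z by (simp add: ennreal_less_iff)
        ultimately have "ennreal z < X \<omega> (\<Inter>n. D n)" by (rule less_le_trans[rotated])
        then show "\<omega> \<in> {\<omega>\<in>space M. ennreal z < X \<omega> (\<Inter>n. D n)}" using \<open>\<omega> \<in> space M\<close> by simp
      qed
      have [measurable]: "(\<lambda>\<omega>. X \<omega> (\<Inter>n. D n)) \<in> borel_measurable M" using random_sup_measureD(2)[OF X C] .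
      show "{\<omega>\<in>space M. ennreal z < X \<omega> (\<Inter>n. D n)} \<in> events" by measurable
    qed
    also have "\<dots> = 1 - exp (- \<theta> (\<Inter>n. D n) / z)" by (rule unit_frechet_tail[OF \<theta>[OF C] z(1)])
    finally have "l \<le> \<theta> (\<Inter>n. D n) / z" by simp
    then show "z * l \<le> \<theta> (\<Inter>n. D n)" using z by (simp add: field_simps)
  qed
  ultimately have "l = \<theta> (\<Inter>n. D n)" by (rule antisym[rotated])
  then show ?thesis using l(1) by simp
qed

text \<open>The exceedance events of \<open>X\<close> over a high level are the hitting events of a random closed set;
  the limit of their rescaled laws lives on hitting patterns, which are decoded into closed sets.\<close>

lemma exists_spectral_scaled_indicator:
  fixes X :: "'m \<Rightarrow> 'a::{t2_space, second_countable_topology} set \<Rightarrow> ennreal"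
  assumes lc: "locally_compact_space (euclidean :: 'a topology)" and M: "prob_space M"
    and X: "random_sup_measure M X" and nz: "AE \<omega> in M. X \<omega> \<noteq> (\<lambda>_. 0)"
    and \<theta>: "\<And>K. compact K \<Longrightarrow> unit_frechet M (\<lambda>\<omega>. X \<omega> K) (\<theta> K)"
  obtains \<nu> :: "real measure" and c :: "real \<Rightarrow> real" and F :: "real \<Rightarrow> 'a::{t2_space, second_countable_topology} set" where
    "prob_space \<nu>" "\<And>x. 0 < c x" "\<And>x. closed (F x)" "\<And>x. F x \<noteq> {}"
    "(\<lambda>x. scaled_indicator_sm (c x) (F x)) \<in> measurable \<nu> SM"
    "\<And>K. compact K \<Longrightarrow> (\<integral>\<^sup>+x. scaled_indicator_sm (c x) (F x) K \<partial>\<nu>) = ennreal (\<theta> K)"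
proof -
  interpret prob_space M by (rule M)
  note Xs = random_sup_measureD(1)[OF X]
  obtain kf :: "nat \<Rightarrow> 'a set" where kf: "\<And>i. compact (kf i)" "\<And>i j. \<exists>k. kf k = kf i \<union> kf j"
    "\<And>C G. compact C \<Longrightarrow> open G \<Longrightarrow> C \<subseteq> G \<Longrightarrow> \<exists>i. C \<subseteq> interior (kf i) \<and> kf i \<subseteq> G"
    using compact_base[OF lc] by metis
  define th where "th i = \<theta> (kf i)" for i
  have th: "unit_frechet M (\<lambda>\<omega>. X \<omega> (kf i)) (th i)" for i unfolding th_def by (rule \<theta>[OF kf(1)])
  have th0: "0 \<le> th i" for i by (rule unit_frechetD(1)[OF th])
  define E where "E n i = {\<omega>\<in>space M. ennreal (real n + 1) < X \<omega> (kf i)}" for n i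
  have [measurable]: "(\<lambda>\<omega>. X \<omega> (kf i)) \<in> borel_measurable M" for i using random_sup_measureD(2)[OF X kf(1)] .
  have E_m: "E n i \<in> sets M" for n i unfolding E_def by measurable
  have E_law: "prob (E n i) = 1 - exp (- th i / (real n + 1))" for n i
    unfolding E_def by (rule unit_frechet_tail[OF th]) simp
  have cover: "\<exists>i. C \<subseteq> interior (kf i)" if "compact C" for C using kf(3)[OF that open_UNIV] by auto
  \<comment> \<open>If all scales were 0, \<open>X\<close> would almost surely vanish on the
    countable base, hence at every point and therefore on every set.\<close>
  have "\<exists>i. 0 < th i"
  proof (rule ccontr)
    assume "\<nexists>i. 0 < th i"
    then have "th i = 0" for i using th0[of i] by (simp add: not_less antisym)
    then have "AE \<omega> in M. X \<omega> (kf i) = 0" for i using unit_frechet_zero_scale th[of i] by simp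
    then have "AE \<omega> in M. \<forall>i. X \<omega> (kf i) = 0" unfolding AE_all_countable by simp
    then have "AE \<omega> in M. False"
      using nz AE_space
    proof eventually_elim
      case (elim \<omega>)
      have "X \<omega> {x} = 0" for x
      proof -
        obtain i where "{x} \<subseteq> interior (kf i)" using cover[of "{x}"] by auto
        then have "X \<omega> {x} \<le> X \<omega> (kf i)"
          using interior_subset by (intro sup_measure_mono[OF Xs[OF elim(3)]]) blast
        then show ?thesis using elim(1) by simp
      qed
      then have "X \<omega> A = 0" for A
        unfolding sup_measure_eq_SUP_points[OF lc Xs[OF elim(3)], of A] by (cases "A = {}") (auto simp: bot_ennreal)
      then show False using elim(2) by auto
    qed
    then show False using AE_False by simp
  qed
  then obtain i0 where i0: "0 < th i0" ..
  obtain \<nu> :: "real measure" and c0 :: "real \<Rightarrow> real" and e :: "nat \<Rightarrow> real \<Rightarrow> bool" where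
    \<nu>: "prob_space \<nu>" "sets \<nu> = sets borel" and c0: "c0 \<in> borel_measurable borel" and e_m: "\<And>i. {x. e i x} \<in> sets borel"
    and c0_pos: "AE x in \<nu>. 0 < c0 x" and e_ex: "AE x in \<nu>. \<exists>i. e i x"
    and c0_int: "\<And>i. (\<integral>\<^sup>+x. ennreal (c0 x) * indicator {x. e i x} x \<partial>\<nu>) = ennreal (th i)"
    and e_Un: "\<forall>i j k. (\<forall>n. E n k = E n i \<union> E n j) \<longrightarrow> (AE x in \<nu>. e k x \<longleftrightarrow> e i x \<or> e j x)"
    by (rule rescaled_indicator_limit[of M E th i0, OF M E_m E_law th0 i0]) (rule that)
  interpret \<nu>: prob_space \<nu> by (rule \<nu>(1))
  have space_\<nu>: "space \<nu> = UNIV" using sets_eq_imp_space_eq[OF \<nu>(2)] by simp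
  have c0_m[measurable]: "c0 \<in> borel_measurable \<nu>" using c0 by (subst measurable_cong_sets[OF \<nu>(2) refl])
  have e_m'[measurable]: "Measurable.pred \<nu> (e i)" for i
    using e_m[of i] unfolding pred_def space_\<nu> \<nu>(2) by simp
  \<comment> \<open>Since \<open>X (A \<union> B)\<close> is the maximum of \<open>X A\<close> and
    \<open>X B\<close>, exceedance of a union is the union of the exceedances; there are only
    countably many triples, so one null set suffices.\<close>
  have U: "AE x in \<nu>. \<forall>i j k. kf k = kf i \<union> kf j \<longrightarrow> (e k x \<longleftrightarrow> e i x \<or> e j x)"
    unfolding AE_all_countable
  proof (intro allI)
    fix i j k
    show "AE x in \<nu>. kf k = kf i \<union> kf j \<longrightarrow> (e k x \<longleftrightarrow> e i x \<or> e j x)"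
    proof (cases "kf k = kf i \<union> kf j")
      case True
      have "E n k = E n i \<union> E n j" for n
        unfolding E_def True using sup_measure_Un[OF lc Xs] by (auto simp: less_max_iff_disj)
      then have "AE x in \<nu>. e k x \<longleftrightarrow> e i x \<or> e j x" using e_Un by simp
      then show ?thesis using True by simp
    qed simp
  qed
  have pos_null: "AE x in \<nu>. \<not> P x" if P[measurable]: "Measurable.pred \<nu> P" and 0: "(\<integral>\<^sup>+x. ennreal (c0 x) * indicator {x. P x} x \<partial>\<nu>) = 0" for P
  proof -
    have "AE x in \<nu>. ennreal (c0 x) * indicator {x. P x} x = 0"
      using 0 by (subst (asm) nn_integral_0_iff_AE) (auto simp: indicator_def[abs_def])
    then show ?thesis using c0_pos by eventually_elim (auto simp: indicator_def split: if_splits)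
  qed
  have mono: "\<theta> K \<le> \<theta> L" if "compact K" "compact L" "K \<subseteq> L" for K L
    by (rule unit_frechet_mono[OF \<theta> \<theta>]) (use that sup_measure_mono[OF Xs] in auto)
  \<comment> \<open>Base members fit between \<open>K\<close> and the compacts \<open>D n\<close>
    decreasing to it, so by monotonicity their scales are squeezed towards
    \<open>\<theta> K\<close>.\<close>
  have approx: "\<exists>D k. (\<forall>n. compact (D n)) \<and> decseq D \<and> (\<Inter>n. D n) = K \<and>
      (\<forall>n. K \<subseteq> interior (kf (k n))) \<and> (\<forall>n. kf (k n) \<subseteq> D n) \<and> (\<lambda>n. th (k n)) \<longlonglongrightarrow> \<theta> K" if K: "compact K" for K
  proof -
    obtain D :: "nat \<Rightarrow> 'a set" where D: "\<And>n. compact (D n)" "decseq D" "(\<Inter>n. D n) = K" "\<And>n. K \<subseteq> interior (D n)"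
      by (rule compact_decseq_neighbourhoods[OF lc K]) (rule that)
    have "\<forall>n. \<exists>i. K \<subseteq> interior (kf i) \<and> kf i \<subseteq> interior (D n)"
      using kf(3)[OF K open_interior D(4)] by blast
    then obtain k where k: "\<And>n. K \<subseteq> interior (kf (k n)) \<and> kf (k n) \<subseteq> interior (D n)" by metis
    have kD: "kf (k n) \<subseteq> D n" for n using k[of n] interior_subset[of "D n"] by blast
    have Kk: "K \<subseteq> kf (k n)" for n using k[of n] interior_subset[of "kf (k n)"] by blast
    have "(\<lambda>n. th (k n)) \<longlonglongrightarrow> \<theta> K"
    proof (rule tendsto_sandwich)
      show "\<forall>\<^sub>F n in sequentially. \<theta> K \<le> th (k n)" unfolding th_def using mono[OF K kf(1) Kk] by simp
      show "\<forall>\<^sub>F n in sequentially. th (k n) \<le> \<theta> (D n)" unfolding th_def using mono[OF kf(1) D(1) kD] by simp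
      show "(\<lambda>n. \<theta> (D n)) \<longlonglongrightarrow> \<theta> K" using unit_frechet_scale_decseq[OF X \<theta> D(1,2)] D(3) by simp
    qed simp
    then show ?thesis using D k kD by (intro exI[of _ D] exI[of _ k] conjI allI) simp_all
  qed
  have Z: "AE x in \<nu>. \<forall>i. kf i = {} \<longrightarrow> \<not> e i x"
    unfolding AE_all_countable
  proof
    fix i
    show "AE x in \<nu>. kf i = {} \<longrightarrow> \<not> e i x"
    proof (cases "kf i = {}")
      case True
      have "unit_frechet M (\<lambda>\<omega>. X \<omega> (kf i)) 0"
        using unit_frechet_0[OF M] unit_frechet_cong[of M "\<lambda>\<omega>. X \<omega> (kf i)" "\<lambda>_. 0" 0] sup_measure_empty[OF Xs] True by simp
      then have "th i = 0" using unit_frechet_unique th by blast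
      then have "AE x in \<nu>. \<not> e i x" by (intro pos_null) (simp_all add: c0_int)
      then show ?thesis by simp
    qed simp
  qed
  have R: "AE x in \<nu>. \<forall>i. \<not> e i x \<longrightarrow> (\<exists>j. kf i \<subseteq> interior (kf j) \<and> \<not> e j x)"
    unfolding AE_all_countable
  proof
    fix i
    \<comment> \<open>The defect: \<open>kf i\<close> is missed but all its base neighbourhoods are
      hit. This event is disjoint from \<open>e i\<close>, and both are contained in
      \<open>e j\<close> for every base neighbourhood \<open>kf j\<close>. Its weighted mass plus
      \<open>th i\<close> is thus at most \<open>th j\<close>, and such \<open>th j\<close> approach
      \<open>th i\<close>.\<close>
    define P where "P x \<longleftrightarrow> \<not> e i x \<and> (\<forall>j. kf i \<subseteq> interior (kf j) \<longrightarrow> e j x)" for x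
    have P_m[measurable]: "Measurable.pred \<nu> P" unfolding P_def by measurable
    let ?I = "\<integral>\<^sup>+x. ennreal (c0 x) * indicator {x. P x} x \<partial>\<nu>"
    have le: "?I + ennreal (th i) \<le> ennreal (th j)" if j: "kf i \<subseteq> interior (kf j)" for j
    proof -
      have "kf j = kf i \<union> kf j" using j interior_subset[of "kf j"] by blast
      then have ej: "AE x in \<nu>. e i x \<longrightarrow> e j x" using U by (auto elim!: AE_mp)
      have "?I + ennreal (th i) = (\<integral>\<^sup>+x. ennreal (c0 x) * indicator {x. P x} x + ennreal (c0 x) * indicator {x. e i x} x \<partial>\<nu>)"
        unfolding c0_int[symmetric] by (rule nn_integral_add[symmetric]) (auto simp: indicator_def[abs_def])
      also have "\<dots> \<le> (\<integral>\<^sup>+x. ennreal (c0 x) * indicator {x. e j x} x \<partial>\<nu>)"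
        by (rule nn_integral_mono_AE, rule AE_mp[OF ej]) (use j in \<open>auto simp: P_def indicator_def\<close>)
      finally show ?thesis unfolding c0_int .
    qed
    obtain D k where Dk: "\<And>n. kf i \<subseteq> interior (kf (k n))" "(\<lambda>n::nat. th (k n)) \<longlonglongrightarrow> \<theta> (kf i)"
      using approx[OF kf(1)[of i]] by (elim exE conjE) (rule that, erule spec, assumption)
    have "?I + ennreal (th i) \<le> ennreal (th i)"
      using tendsto_ennrealI[OF Dk(2)] le[OF Dk(1)] unfolding th_def[of i, symmetric] by (intro LIMSEQ_le_const) auto
    then have "?I = 0" by (simp add: add.commute[of _ "ennreal (th i)"])
    then have "AE x in \<nu>. \<not> P x" by (rule pos_null[OF P_m])
    then show "AE x in \<nu>. \<not> e i x \<longrightarrow> (\<exists>j. kf i \<subseteq> interior (kf j) \<and> \<not> e j x)"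
      unfolding P_def by (rule AE_mp) auto
  qed
  \<comment> \<open>The largest closed set avoiding the interiors of all missed base members. It is
    defined for every \<open>x\<close>, whether or not the pattern is consistent.\<close>
  define F0 where "F0 x = - (\<Union>j\<in>{j. \<not> e j x}. interior (kf j))" for x
  have F0_closed: "closed (F0 x)" for x unfolding F0_def closed_def by (auto intro!: open_UN)
  have hit: "AE x in \<nu>. \<forall>i. F0 x \<inter> kf i \<noteq> {} \<longleftrightarrow> e i x"
    using U Z R
  proof eventually_elim
    case (elim x)
    show ?case
    proof (intro allI iffI)
      fix i assume h: "F0 x \<inter> kf i \<noteq> {}"
      show "e i x"
      proof (rule ccontr)
        assume "\<not> e i x"
        then obtain j where "kf i \<subseteq> interior (kf j)" "\<not> e j x" using elim(3) by blast
        then show False using h unfolding F0_def by blast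
      qed
    next
      fix i assume ei: "e i x"
      show "F0 x \<inter> kf i \<noteq> {}"
      proof
        \<comment> \<open>By compactness finitely many missed members cover \<open>kf i\<close>.
          Their union is again a base member and is missed by union compatibility, so its subset
          \<open>kf i\<close> cannot be hit. The cover is nonempty because the empty base member is
          never hit.\<close>
        assume "F0 x \<inter> kf i = {}"
        then have "kf i \<subseteq> (\<Union>j\<in>{j. \<not> e j x}. interior (kf j))" unfolding F0_def by auto
        then obtain J where J: "J \<subseteq> {j. \<not> e j x}" "finite J" "kf i \<subseteq> (\<Union>j\<in>J. interior (kf j))"
          using compactE_image[OF kf(1)[of i], of "{j. \<not> e j x}" "\<lambda>j. interior (kf j)"] open_interior by metis
        have "J \<noteq> {}" using J(3) ei elim(2) by auto
        have "\<exists>k. kf k = (\<Union>j\<in>J. kf j) \<and> \<not> e k x"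
          using J(2) \<open>J \<noteq> {}\<close> J(1)
        proof (induction J rule: finite_ne_induct)
          case (singleton j) then show ?case by auto
        next
          case (insert j J)
          then obtain k where k: "kf k = (\<Union>j\<in>J. kf j)" "\<not> e k x" by auto
          obtain k' where k': "kf k' = kf j \<union> kf k" using kf(2) by blast
          have "\<not> e k' x" using elim(1) k' k(2) insert.prems by auto
          then show ?case using k' k(1) by auto
        qed
        then obtain k where k: "kf k = (\<Union>j\<in>J. kf j)" "\<not> e k x" by auto
        have "kf i \<subseteq> kf k"
        proof -
          have "(\<Union>j\<in>J. interior (kf j)) \<subseteq> (\<Union>j\<in>J. kf j)" by (intro UN_mono interior_subset) simp
          then show ?thesis using J(3) k(1) by simp
        qed
        then have "kf k = kf i \<union> kf k" by auto
        then show False using elim(1) ei k(2) by blast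
      qed
    qed
  qed
  \<comment> \<open>Finite subcovers turn the avoidance of \<open>K\<close> into a union over the
    countably many finite index sets of missed members.\<close>
  have hit_m: "Measurable.pred \<nu> (\<lambda>x. F0 x \<inter> K = {})" if K: "compact K" for K
  proof -
    have "F0 x \<inter> K = {} \<longleftrightarrow> (\<exists>J\<in>{J. finite J \<and> K \<subseteq> (\<Union>j\<in>J. interior (kf j))}. \<forall>j\<in>J. \<not> e j x)" for x
    proof
      assume "F0 x \<inter> K = {}"
      then have "K \<subseteq> (\<Union>j\<in>{j. \<not> e j x}. interior (kf j))" unfolding F0_def by auto
      then obtain J where "J \<subseteq> {j. \<not> e j x}" "finite J" "K \<subseteq> (\<Union>j\<in>J. interior (kf j))"
        using compactE_image[OF K, of "{j. \<not> e j x}" "\<lambda>j. interior (kf j)"] open_interior by metis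
      then show "\<exists>J\<in>{J. finite J \<and> K \<subseteq> (\<Union>j\<in>J. interior (kf j))}. \<forall>j\<in>J. \<not> e j x" by blast
    qed (auto simp: F0_def)
    moreover have "Measurable.pred \<nu> (\<lambda>x. \<exists>J\<in>{J. finite J \<and> K \<subseteq> (\<Union>j\<in>J. interior (kf j))}. \<forall>j\<in>J. \<not> e j x)"
      unfolding pred_def
    proof (rule sets.sets_Collect_countable_Ex')
      show "countable {J. finite J \<and> K \<subseteq> (\<Union>j\<in>J. interior (kf j))}"
        by (rule countable_subset[OF _ countable_Collect_finite_subset[of UNIV]]) auto
      fix J assume "J \<in> {J. finite J \<and> K \<subseteq> (\<Union>j\<in>J. interior (kf j))}"
      then have "finite J" by simp
      then have "Measurable.pred \<nu> (\<lambda>x. \<forall>j\<in>J. \<not> e j x)" by measurable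
      then show "{x \<in> space \<nu>. \<forall>j\<in>J. \<not> e j x} \<in> \<nu>.events" by (simp add: pred_def)
    qed
    ultimately show ?thesis by simp
  qed
  have F0_ne: "F0 x \<noteq> {} \<longleftrightarrow> (\<exists>i. \<not> F0 x \<inter> kf i = {})" for x
  proof
    assume "F0 x \<noteq> {}"
    then obtain y where y: "y \<in> F0 x" by auto
    obtain i where "{y} \<subseteq> interior (kf i)" using cover[of "{y}"] by auto
    then show "\<exists>i. \<not> F0 x \<inter> kf i = {}" using y interior_subset by blast
  qed auto
  define ok where "ok x \<longleftrightarrow> 0 < c0 x \<and> F0 x \<noteq> {}" for x
  have ok_m[measurable]: "Measurable.pred \<nu> ok"
  proof -
    have [measurable]: "Measurable.pred \<nu> (\<lambda>x. F0 x \<inter> kf i = {})" for i by (rule hit_m[OF kf(1)])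
    show ?thesis unfolding ok_def F0_ne by measurable
  qed
  have ok_AE: "AE x in \<nu>. ok x"
    using hit c0_pos e_ex by eventually_elim (auto simp: ok_def)
  \<comment> \<open>On the exceptional null set, height 1 and the whole space keep the value a
    genuine scaled indicator, as the conclusion is required at every \<open>x\<close>.\<close>
  define c where "c x = (if ok x then c0 x else 1)" for x
  define F where "F x = (if ok x then F0 x else UNIV)" for x
  have F_closed: "closed (F x)" for x unfolding F_def using F0_closed by simp
  let ?Y = "\<lambda>x. scaled_indicator_sm (c x) (F x)"
  have Y_eval: "(\<lambda>x. ?Y x K) \<in> borel_measurable \<nu>" if K: "compact K" for K
  proof -
    have [measurable]: "Measurable.pred \<nu> (\<lambda>x. F0 x \<inter> K = {})" by (rule hit_m[OF K])
    have "?Y x K = (if ok x then (if F0 x \<inter> K = {} then 0 else ennreal (c0 x)) else (if K = {} then 0 else 1))" for x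
      unfolding scaled_indicator_sm_def c_def F_def by auto
    then show ?thesis by simp
  qed
  have Ykf: "(\<integral>\<^sup>+x. ?Y x (kf i) \<partial>\<nu>) = ennreal (th i)" for i
  proof -
    have "AE x in \<nu>. ?Y x (kf i) = ennreal (c0 x) * indicator {x. e i x} x"
      using ok_AE hit by eventually_elim (auto simp: scaled_indicator_sm_def c_def F_def indicator_def)
    then show ?thesis unfolding c0_int[symmetric] by (rule nn_integral_cong_AE)
  qed
  have Y_sup: "sup_measure (?Y x)" for x by (rule sup_measure_scaled_indicator[OF F_closed])
  show ?thesis
  proof (rule that[of \<nu> c F])
    show "prob_space \<nu>" by (rule \<nu>(1))
    show "0 < c x" "F x \<noteq> {}" for x unfolding c_def F_def ok_def by auto
    show "closed (F x)" for x by (rule F_closed)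
    show "?Y \<in> measurable \<nu> SM" by (rule measurable_SM[OF Y_sup Y_eval])
    fix K :: "'a set" assume K: "compact K"
    obtain D k where D: "\<And>n. compact (D n)" "decseq D" "(\<Inter>n. D n) = K"
      and k: "\<And>n. K \<subseteq> interior (kf (k n))" "\<And>n. kf (k n) \<subseteq> D n" "(\<lambda>n::nat. th (k n)) \<longlonglongrightarrow> \<theta> K"
      using approx[OF K]
      by (elim exE conjE) (rule that, erule spec, assumption, assumption, erule spec, erule spec, assumption)
    \<comment> \<open>A single base member contains all \<open>kf (k n)\<close> and has finite mean;
      it is the dominating function that carries the mean formula from the base to
      \<open>K\<close>.\<close>
    obtain m where m: "D 0 \<subseteq> interior (kf m)" using cover[OF D(1)] by blast
    have kD0: "kf (k n) \<subseteq> kf m" for n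
    proof -
      have "D n \<subseteq> D 0" using D(2) by (simp add: decseq_def)
      then show ?thesis using k(2)[of n] m interior_subset[of "kf m"] by blast
    qed
    have Kk: "K \<subseteq> kf (k n)" for n using k(1)[of n] interior_subset[of "kf (k n)"] by blast
    have "(\<lambda>n. \<integral>\<^sup>+x. ?Y x (kf (k n)) \<partial>\<nu>) \<longlonglongrightarrow> (\<integral>\<^sup>+x. ?Y x K \<partial>\<nu>)"
    proof (rule nn_integral_dominated_convergence[where w="\<lambda>x. ?Y x (kf m)"])
      show "(\<lambda>x. ?Y x (kf (k n))) \<in> borel_measurable \<nu>" for n by (rule Y_eval[OF kf(1)])
      show "(\<lambda>x. ?Y x K) \<in> borel_measurable \<nu>" by (rule Y_eval[OF K])
      show "(\<lambda>x. ?Y x (kf m)) \<in> borel_measurable \<nu>" by (rule Y_eval[OF kf(1)])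
      show "AE x in \<nu>. ?Y x (kf (k n)) \<le> ?Y x (kf m)" for n
        by (intro AE_I2 sup_measure_mono[OF Y_sup] kD0)
      show "(\<integral>\<^sup>+x. ?Y x (kf m) \<partial>\<nu>) < \<infinity>" unfolding Ykf by simp
      show "AE x in \<nu>. (\<lambda>n. ?Y x (kf (k n))) \<longlonglongrightarrow> ?Y x K"
      proof (rule AE_I2)
        fix x
        have D_lim: "(\<lambda>n. ?Y x (D n)) \<longlonglongrightarrow> ?Y x K" using sup_measure_decseq[OF Y_sup D(1,2)] unfolding D(3) .
        show "(\<lambda>n. ?Y x (kf (k n))) \<longlonglongrightarrow> ?Y x K"
        proof (rule tendsto_sandwich[OF _ _ tendsto_const D_lim])
          show "\<forall>\<^sub>F n in sequentially. ?Y x K \<le> ?Y x (kf (k n))"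
            by (intro always_eventually allI sup_measure_mono[OF Y_sup] Kk)
          show "\<forall>\<^sub>F n in sequentially. ?Y x (kf (k n)) \<le> ?Y x (D n)"
            by (intro always_eventually allI sup_measure_mono[OF Y_sup] k(2))
        qed
      qed
    qed
    moreover have "(\<lambda>n. \<integral>\<^sup>+x. ?Y x (kf (k n)) \<partial>\<nu>) \<longlonglongrightarrow> ennreal (\<theta> K)"
      unfolding Ykf by (rule tendsto_ennrealI[OF k(3)])
    ultimately show "(\<integral>\<^sup>+x. ?Y x K \<partial>\<nu>) = ennreal (\<theta> K)" by (rule LIMSEQ_unique)
  qed
qed

subsection \<open>Poisson processes\<close>

text \<open>Once the lower coefficients are known to vanish, division by \<open>x ^ n\<close> leaves
  a power series whose limit at 0 is \<open>a n\<close>. The hypothesis covers only the interval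
  (0,1) of generating variables, so the limit is taken from the right.\<close>

lemma powser_eq_0_coeffs:
  fixes a :: "nat \<Rightarrow> real"
  assumes "\<And>x. 0 < x \<Longrightarrow> x < 1 \<Longrightarrow> (\<lambda>n. a n * x ^ n) sums 0"
  shows "a n = 0"
proof (induction n rule: less_induct)
  case (less n)
  define b where "b k = a (k + n)" for k
  have b: "(\<lambda>k. b k * x ^ k) sums 0" if x: "0 < x" "x < 1" for x
  proof -
    have "(\<lambda>k. a (k + n) * x ^ (k + n)) sums (0 - (\<Sum>i<n. a i * x ^ i))"
      by (rule sums_split_initial_segment[OF assms[OF x]])
    then have "(\<lambda>k. a (k + n) * x ^ (k + n)) sums 0" using less by simp
    then have "(\<lambda>k. (a (k + n) * x ^ (k + n)) / x ^ n) sums (0 / x ^ n)" by (rule sums_divide)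
    then show ?thesis using x by (simp add: power_add b_def field_simps)
  qed
  define f where "f x = (\<Sum>k. b k * x ^ k)" for x
  have "(f \<longlongrightarrow> b 0) (at 0)"
  proof (rule powser_limit_0[of "1/2"])
    fix x :: real assume x: "norm x < 1/2"
    have "summable (\<lambda>k. b k * (1/2) ^ k)" using b[of "1/2"] by (auto simp: sums_iff)
    then have "summable (\<lambda>k. b k * x ^ k)" by (rule powser_inside) (use x in auto)
    then show "(\<lambda>k. b k * x ^ k) sums f x" unfolding f_def by (rule summable_sums)
  qed simp
  then have "(f \<longlongrightarrow> b 0) (at_right 0)" by (rule filterlim_mono) (auto simp: at_within_le_at)
  moreover have "eventually (\<lambda>x. f x = 0) (at_right 0)"
    unfolding eventually_at_right_field f_def
    by (rule exI[of _ 1]) (use b in \<open>auto simp: sums_iff\<close>)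
  ultimately have "((\<lambda>x. 0) \<longlongrightarrow> b 0) (at_right (0::real))"
    using tendsto_cong by fast
  then have "b 0 = 0" using tendsto_unique[OF _ _ tendsto_const, of "at_right (0::real)"] by auto
  then show ?case unfolding b_def by simp
qed

text \<open>The coordinates are resolved one at a time: with the other variables fixed, both sides are
  power series in the generating variable of the current coordinate.\<close>

lemma (in prob_space) poisson_joint_law_of_pgf:
  fixes c :: "nat \<Rightarrow> 'a \<Rightarrow> nat" and l :: "nat \<Rightarrow> real"
  assumes c: "\<And>j. j < n \<Longrightarrow> c j \<in> measurable M (count_space UNIV)"
    and pgf: "\<And>s :: nat \<Rightarrow> real. (\<And>j. 0 \<le> s j \<and> s j \<le> 1) \<Longrightarrow>
      expectation (\<lambda>\<omega>. \<Prod>j<n. s j ^ c j \<omega>) = (\<Prod>j<n. exp (- l j * (1 - s j)))"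
  shows "prob {\<omega>\<in>space M. \<forall>j<n. c j \<omega> = m j} = (\<Prod>j<n. exp (- l j) * l j ^ m j / fact (m j))"
proof -
  \<comment> \<open>The state after \<open>k\<close> coordinates: events for \<open>j < k\<close>,
    powers of the generating variables for the rest. It is the hypothesis at \<open>k = 0\<close>
    and the claim at \<open>k = n\<close>.\<close>
  have claim: "expectation (\<lambda>\<omega>. (\<Prod>j<k. of_bool (c j \<omega> = m j)) * (\<Prod>j\<in>{k..<n}. s j ^ c j \<omega>)) =
      (\<Prod>j<k. exp (- l j) * l j ^ m j / fact (m j)) * (\<Prod>j\<in>{k..<n}. exp (- l j * (1 - s j)))"
    if "k \<le> n" "\<And>j. 0 \<le> s j \<and> s j \<le> 1" for k and s :: "nat \<Rightarrow> real"
    using that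
  proof (induction k arbitrary: s)
    case 0
    then show ?case using pgf[of s] by (simp add: atLeast0LessThan)
  next
    case (Suc k)
    have kn: "k < n" "k \<le> n" using Suc.prems(1) by auto
    define W where "W \<omega> = (\<Prod>j<k. of_bool (c j \<omega> = m j)) * (\<Prod>j\<in>{Suc k..<n}. s j ^ c j \<omega>)" for \<omega>
    define A where "A = (\<Prod>j<k. exp (- l j) * l j ^ m j / fact (m j)) * (\<Prod>j\<in>{Suc k..<n}. exp (- l j * (1 - s j)))"
    have [measurable]: "c j \<in> measurable M (count_space UNIV)" if "j \<in> {..<k} \<union> {k..<n}" for j
      using c that kn by auto
    have ckm [measurable]: "c k \<in> measurable M (count_space UNIV)" using c kn by auto
    have Wm [measurable]: "W \<in> borel_measurable M"
    proof -
      have "(\<lambda>\<omega>. of_bool (c j \<omega> = m j) :: real) \<in> borel_measurable M" "(\<lambda>\<omega>. s j ^ c j \<omega>) \<in> borel_measurable M"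
        if "j < n" for j
        using measurable_compose[OF c[OF that], of "\<lambda>x. of_bool (x = m j) :: real" borel]
          measurable_compose[OF c[OF that], of "\<lambda>x. s j ^ x" borel] by simp_all
      then show ?thesis
        unfolding W_def[abs_def] using kn by (intro borel_measurable_times borel_measurable_prod) auto
    qed
    have W01: "0 \<le> W \<omega>" "W \<omega> \<le> 1" for \<omega>
    proof -
      show "0 \<le> W \<omega>" unfolding W_def using Suc.prems(2) by (intro mult_nonneg_nonneg prod_nonneg) auto
      show "W \<omega> \<le> 1" unfolding W_def using Suc.prems(2)
        by (intro mult_le_one prod_le_1 prod_nonneg) (auto intro: power_le_one)
    qed
    define b where "b i = expectation (\<lambda>\<omega>. W \<omega> * of_bool (c k \<omega> = i))" for i
    define p where "p i = exp (- l k) * l k ^ i / fact i" for i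
    have split: "{k..<n} = insert k {Suc k..<n}" using kn by auto
    have E: "expectation (\<lambda>\<omega>. W \<omega> * x ^ c k \<omega>) = A * exp (- l k * (1 - x))" if "0 < x" "x < 1" for x
    proof -
      have "expectation (\<lambda>\<omega>. (\<Prod>j<k. of_bool (c j \<omega> = m j)) * (\<Prod>j\<in>{k..<n}. (s(k:=x)) j ^ c j \<omega>)) =
        (\<Prod>j<k. exp (- l j) * l j ^ m j / fact (m j)) * (\<Prod>j\<in>{k..<n}. exp (- l j * (1 - (s(k:=x)) j)))"
        by (rule Suc.IH) (use kn that Suc.prems in auto)
      then show ?thesis unfolding split W_def A_def by (simp add: mult_ac)
    qed
    have S1: "(\<lambda>i. b i * x ^ i) sums (A * exp (- l k * (1 - x)))" if x: "0 < x" "x < 1" for x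
    proof -
      have int: "integrable M (\<lambda>\<omega>. W \<omega> * of_bool (c k \<omega> = i))" for i
        by (rule integrable_const_bound[of _ 1]) (use W01 in \<open>auto simp: abs_mult\<close>)
      have "(\<lambda>N. expectation (\<lambda>\<omega>. \<Sum>i<N. W \<omega> * of_bool (c k \<omega> = i) * x ^ i)) \<longlonglongrightarrow> expectation (\<lambda>\<omega>. W \<omega> * x ^ c k \<omega>)"
      proof (rule integral_dominated_convergence[of _ _ _ "\<lambda>_. 1"])
        have *: "(\<Sum>i<N. W \<omega> * of_bool (c k \<omega> = i) * x ^ i) = (if c k \<omega> < N then W \<omega> * x ^ c k \<omega> else 0)" for N \<omega>
        proof -
          have "(\<Sum>i<N. W \<omega> * of_bool (c k \<omega> = i) * x ^ i) = (\<Sum>i<N. if i = c k \<omega> then W \<omega> * x ^ i else 0)"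
            by (intro sum.cong) auto
          then show ?thesis by (simp add: sum.delta)
        qed
        show "AE \<omega> in M. (\<lambda>N. \<Sum>i<N. W \<omega> * of_bool (c k \<omega> = i) * x ^ i) \<longlonglongrightarrow> W \<omega> * x ^ c k \<omega>"
          unfolding *
        proof (intro AE_I2 tendsto_eventually)
          fix \<omega>
          show "eventually (\<lambda>N. (if c k \<omega> < N then W \<omega> * x ^ c k \<omega> else 0) = W \<omega> * x ^ c k \<omega>) sequentially"
            by (rule eventually_sequentiallyI[of "Suc (c k \<omega>)"]) auto
        qed
        show "AE \<omega> in M. norm (\<Sum>i<N. W \<omega> * of_bool (c k \<omega> = i) * x ^ i) \<le> 1" for N
          unfolding * using W01 x by (intro AE_I2) (auto simp: abs_mult intro!: mult_le_one power_le_one)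
      qed auto
      moreover have "expectation (\<lambda>\<omega>. \<Sum>i<N. W \<omega> * of_bool (c k \<omega> = i) * x ^ i) = (\<Sum>i<N. b i * x ^ i)" for N
        unfolding b_def using int by (subst Bochner_Integration.integral_sum) auto
      ultimately show ?thesis unfolding sums_def using E[OF x] by simp
    qed
    have S2: "(\<lambda>i. A * p i * x ^ i) sums (A * exp (- l k * (1 - x)))" for x
    proof -
      have f: "(\<lambda>i. (A * exp (- l k)) * ((l k * x) ^ i /\<^sub>R fact i)) = (\<lambda>i. A * p i * x ^ i)"
        unfolding p_def by (rule ext) (simp add: power_mult_distrib field_simps)
      have e: "A * exp (- l k) * exp (l k * x) = A * exp (- l k * (1 - x))"
        by (simp add: exp_add[symmetric] algebra_simps)
      show ?thesis
        using sums_mult[OF exp_converges[of "l k * x"], of "A * exp (- l k)"] unfolding f e .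
    qed
    have "b i - A * p i = 0" for i
    proof (rule powser_eq_0_coeffs)
      fix x :: real assume "0 < x" "x < 1"
      from sums_diff[OF S1[OF this] S2[of x]]
      show "(\<lambda>n. (b n - A * p n) * x ^ n) sums 0" by (simp add: algebra_simps)
    qed
    then have "b (m k) = A * p (m k)" by simp
    then show ?case unfolding b_def A_def p_def W_def by (simp add: mult_ac)
  qed
  have "prob {\<omega>\<in>space M. \<forall>j<n. c j \<omega> = m j} = expectation (\<lambda>\<omega>. (\<Prod>j<n. of_bool (c j \<omega> = m j)))"
  proof -
    define S where "S = {\<omega>\<in>space M. \<forall>j<n. c j \<omega> = m j}"
    have S: "S \<in> sets M"
    proof -
      have "{\<omega>\<in>space M. c j \<omega> = m j} \<in> sets M" if "j \<in> {..<n}" for j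
      proof -
        have "c j -` {m j} \<inter> space M \<in> sets M" using that by (intro measurable_sets[OF c]) auto
        then show ?thesis by (simp add: vimage_def Int_def conj_commute)
      qed
      then have "{\<omega>\<in>space M. \<forall>j\<in>{..<n}. c j \<omega> = m j} \<in> sets M"
        by (rule sets.sets_Collect_finite_All[OF _ finite_lessThan])
      then show ?thesis unfolding S_def Ball_def lessThan_iff .
    qed
    have "prob S = expectation (indicator S)"
      using sets.sets_into_space[OF S] by (simp add: Int_absorb2)
    also have "\<dots> = expectation (\<lambda>\<omega>. (\<Prod>j<n. of_bool (c j \<omega> = m j)))"
    proof (rule Bochner_Integration.integral_cong)
      fix \<omega> assume "\<omega> \<in> space M"
      then show "indicator S \<omega> = (\<Prod>j<n. of_bool (c j \<omega> = m j) :: real)"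
        by (auto simp: indicator_def S_def)
    qed (rule refl)
    finally show ?thesis unfolding S_def .
  qed
  then show ?thesis using claim[of n "\<lambda>_. 1"] by simp
qed

lemma (in prob_space) poisson_pgf:
  fixes c :: "'a \<Rightarrow> nat" and l :: real
  assumes c [measurable]: "c \<in> measurable M (count_space UNIV)" and l: "0 \<le> l"
    and law: "\<And>k. prob {\<omega>\<in>space M. c \<omega> = k} = exp (- l) * l ^ k / fact k"
    and s: "0 \<le> s"
  shows "(\<integral>\<^sup>+\<omega>. ennreal (s ^ c \<omega>) \<partial>M) = ennreal (exp (- l * (1 - s)))"
proof -
  have "(\<integral>\<^sup>+\<omega>. ennreal (s ^ c \<omega>) \<partial>M) = (\<integral>\<^sup>+\<omega>. (\<Sum>k. ennreal (s ^ k) * indicator {\<omega>\<in>space M. c \<omega> = k} \<omega>) \<partial>M)"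
  proof (rule nn_integral_cong)
    fix \<omega> assume "\<omega> \<in> space M"
    then have "(\<Sum>k. ennreal (s ^ k) * indicator {\<omega>\<in>space M. c \<omega> = k} \<omega>) = 
       (\<Sum>k\<in>{c \<omega>}. ennreal (s ^ k) * indicator {\<omega>\<in>space M. c \<omega> = k} \<omega>)"
      by (intro suminf_finite) auto
    then show "ennreal (s ^ c \<omega>) = (\<Sum>k. ennreal (s ^ k) * indicator {\<omega>\<in>space M. c \<omega> = k} \<omega>)"
      using \<open>\<omega> \<in> space M\<close> by simp
  qed
  also have "\<dots> = (\<Sum>k. ennreal (s ^ k) * emeasure M {\<omega>\<in>space M. c \<omega> = k})"
    by (subst nn_integral_suminf) (auto simp: nn_integral_cmult_indicator)
  also have "\<dots> = (\<Sum>k. ennreal (exp (- l) * ((l * s) ^ k /\<^sub>R fact k)))"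
    using s l by (intro suminf_cong) (auto simp: emeasure_eq_measure law ennreal_mult[symmetric] power_mult_distrib field_simps)
  also have "\<dots> = ennreal (exp (- l) * exp (l * s))"
    using l s by (intro suminf_ennreal_eq sums_mult exp_converges) auto
  also have "exp (- l) * exp (l * s) = exp (- l * (1 - s))"
    by (simp add: exp_add[symmetric] algebra_simps)
  finally show ?thesis .
qed

section \<open>Generating functionals of the unit Poisson process\<close>

text \<open>Independence factors the expectation into one-dimensional Poisson generating functions.
  Measurability of the counts is itself read off from their independence.\<close>

lemma unit_poisson_points_pgf:
  fixes n :: nat and B :: "nat \<Rightarrow> real set" and s :: "nat \<Rightarrow> real"
  assumes N: "prob_space N" and \<Gamma>: "unit_poisson_points N \<Gamma>"
    and B: "\<And>j. j < n \<Longrightarrow> B j \<in> sets borel \<and> bounded (B j) \<and> B j \<subseteq> {0<..}" "disjoint_family_on B {..<n}"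
    and s: "\<And>j. 0 \<le> s j \<and> s j \<le> 1"
  shows "(\<integral>\<omega>. (\<Prod>j<n. s j ^ card {i. \<Gamma> \<omega> i \<in> B j}) \<partial>N) = exp (- (\<Sum>j<n. measure lborel (B j) * (1 - s j)))"
    and "\<And>j. j < n \<Longrightarrow> (\<lambda>\<omega>. card {i. \<Gamma> \<omega> i \<in> B j}) \<in> measurable N (count_space UNIV)"
proof -
  interpret prob_space N by fact
  define c where "c j \<omega> = card {i. \<Gamma> \<omega> i \<in> B j}" for j \<omega>
  have ind: "indep_vars (\<lambda>_. count_space UNIV) c {..<n}"
    and law: "\<And>j k. j < n \<Longrightarrow> prob {\<omega>\<in>space N. c j \<omega> = k} = exp (- measure lborel (B j)) * measure lborel (B j) ^ k / fact k"
    using \<Gamma>[unfolded unit_poisson_points_def, THEN conjunct2, THEN conjunct2, rule_format, of n B] B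
    unfolding c_def[abs_def] by auto
  show cm: "\<And>j. j < n \<Longrightarrow> (\<lambda>\<omega>. card {i. \<Gamma> \<omega> i \<in> B j}) \<in> measurable N (count_space UNIV)"
    using ind unfolding indep_vars_def c_def[abs_def] by auto
  have "(\<integral>\<^sup>+\<omega>. (\<Prod>j<n. ennreal (s j ^ c j \<omega>)) \<partial>N) = (\<Prod>j<n. \<integral>\<^sup>+\<omega>. ennreal (s j ^ c j \<omega>) \<partial>N)"
    by (rule indep_vars_nn_integral[OF _ indep_vars_compose2[OF ind]]) auto
  also have "\<dots> = (\<Prod>j<n. ennreal (exp (- measure lborel (B j) * (1 - s j))))"
    using cm law s by (intro prod.cong refl poisson_pgf) (auto simp: c_def[abs_def])
  also have "\<dots> = ennreal (exp (- (\<Sum>j<n. measure lborel (B j) * (1 - s j))))"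
    by (subst prod_ennreal) (auto simp: exp_sum[symmetric] sum_negf)
  finally have 1: "(\<integral>\<^sup>+\<omega>. ennreal (\<Prod>j<n. s j ^ c j \<omega>) \<partial>N) = ennreal (exp (- (\<Sum>j<n. measure lborel (B j) * (1 - s j))))"
    using s by (simp add: prod_ennreal)
  have "(\<lambda>\<omega>. \<Prod>j<n. s j ^ c j \<omega>) \<in> borel_measurable N"
  proof (rule borel_measurable_prod)
    fix j assume "j \<in> {..<n}"
    then show "(\<lambda>\<omega>. s j ^ c j \<omega>) \<in> borel_measurable N"
      using measurable_compose[OF cm, of j "\<lambda>x. s j ^ x" borel] by (simp add: c_def)
  qed
  then show "(\<integral>\<omega>. (\<Prod>j<n. s j ^ card {i. \<Gamma> \<omega> i \<in> B j}) \<partial>N) = exp (- (\<Sum>j<n. measure lborel (B j) * (1 - s j)))"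
    using s 1 unfolding c_def by (subst integral_eq_nn_integral) (auto intro!: prod_nonneg)
qed

lemma unit_poisson_pointsD:
  assumes "unit_poisson_points N \<Gamma>"
  shows "\<Gamma> \<in> measurable N (PiM UNIV (\<lambda>_. borel))"
    and "AE \<omega> in N. \<forall>i. 0 < \<Gamma> \<omega> i"
    and "AE \<omega> in N. \<forall>R. finite {i. \<Gamma> \<omega> i \<le> R}"
proof -
  show "\<Gamma> \<in> measurable N (PiM UNIV (\<lambda>_. borel))"
    using assms unfolding unit_poisson_points_def by (elim conjE)
  have AE: "AE \<omega> in N. strict_mono (\<Gamma> \<omega>) \<and> 0 < \<Gamma> \<omega> 0 \<and> filterlim (\<Gamma> \<omega>) at_top sequentially"
    using assms unfolding unit_poisson_points_def by (elim conjE)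
  show "AE \<omega> in N. \<forall>i. 0 < \<Gamma> \<omega> i"
    using AE
  proof (rule AE_mp, intro AE_I2 impI allI)
    fix \<omega> i assume "strict_mono (\<Gamma> \<omega>) \<and> 0 < \<Gamma> \<omega> 0 \<and> filterlim (\<Gamma> \<omega>) at_top sequentially"
    then show "0 < \<Gamma> \<omega> i"
      using strict_mono_less_eq[of "\<Gamma> \<omega>" 0 i] by auto
  qed
  show "AE \<omega> in N. \<forall>R. finite {i. \<Gamma> \<omega> i \<le> R}"
    using AE
  proof (rule AE_mp, intro AE_I2 impI allI)
    fix \<omega> R assume "strict_mono (\<Gamma> \<omega>) \<and> 0 < \<Gamma> \<omega> 0 \<and> filterlim (\<Gamma> \<omega>) at_top sequentially"
    then have "eventually (\<lambda>i. R + 1 \<le> \<Gamma> \<omega> i) sequentially" by (simp add: filterlim_at_top)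
    then obtain n where n: "\<And>i. n \<le> i \<Longrightarrow> R + 1 \<le> \<Gamma> \<omega> i" by (auto simp: eventually_sequentially)
    have "{i. \<Gamma> \<omega> i \<le> R} \<subseteq> {..<n}"
    proof (rule subsetI, rule ccontr)
      fix i assume "i \<in> {i. \<Gamma> \<omega> i \<le> R}" "i \<notin> {..<n}"
      then show False using n[of i] by auto
    qed
    then show "finite {i. \<Gamma> \<omega> i \<le> R}" by (rule finite_subset) simp
  qed
qed

lemma floor_multiple_approx:
  fixes x :: real
  shows "(\<lambda>n. of_int \<lfloor>x * real (Suc n)\<rfloor> / real (Suc n)) \<longlonglongrightarrow> x"
proof (rule LIMSEQ_I)
  fix e :: real assume "0 < e"
  then obtain m where m: "inverse (real (Suc m)) < e" using reals_Archimedean by blast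
  show "\<exists>no. \<forall>n\<ge>no. norm (of_int \<lfloor>x * real (Suc n)\<rfloor> / real (Suc n) - x) < e"
  proof (intro exI[of _ m] allI impI)
    fix n assume n: "m \<le> n"
    have "\<bar>of_int \<lfloor>x * real (Suc n)\<rfloor> - x * real (Suc n)\<bar> \<le> 1" by linarith
    moreover have "of_int \<lfloor>x * real (Suc n)\<rfloor> / real (Suc n) - x = (of_int \<lfloor>x * real (Suc n)\<rfloor> - x * real (Suc n)) / real (Suc n)"
      by (simp add: diff_divide_distrib)
    ultimately have "norm (of_int \<lfloor>x * real (Suc n)\<rfloor> / real (Suc n) - x) \<le> inverse (real (Suc n))"
      by (simp add: abs_divide divide_right_mono inverse_eq_divide)
    also have "\<dots> \<le> inverse (real (Suc m))" using n by (simp add: field_simps)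
    finally show "norm (of_int \<lfloor>x * real (Suc n)\<rfloor> / real (Suc n) - x) < e" using m by simp
  qed
qed

text \<open>The product runs over a random index set. It is rewritten as a limit of finite products,
  with a guard that turns all factors into 1 when the index set is infinite, in agreement with the
  convention for infinite products.\<close>

lemma unit_poisson_points_functional_measurable:
  fixes h :: "real \<Rightarrow> real" and R :: real
  assumes \<Gamma>: "unit_poisson_points N \<Gamma>" and h [measurable]: "h \<in> borel_measurable borel"
  shows "(\<lambda>\<omega>. \<Prod>i | \<Gamma> \<omega> i \<in> {0<..R}. 1 - h (\<Gamma> \<omega> i)) \<in> borel_measurable N"
proof -
  have \<Gamma>m[measurable]: "(\<lambda>\<omega>. \<Gamma> \<omega> i) \<in> borel_measurable N" for i
    using unit_poisson_pointsD(1)[OF \<Gamma>] by (rule measurable_compose) (rule measurable_component_singleton, simp)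
  have "(\<lambda>\<omega>. lim (\<lambda>n. \<Prod>i<n. if \<Gamma> \<omega> i \<in> {0<..R} \<and> finite {i. \<Gamma> \<omega> i \<in> {0<..R}} then 1 - h (\<Gamma> \<omega> i) else 1)) \<in> borel_measurable N"
  proof -
    have [measurable]: "Measurable.pred N (\<lambda>\<omega>. finite {i. \<Gamma> \<omega> i \<in> {0<..R}})"
      unfolding finite_nat_set_iff_bounded Ball_def mem_Collect_eq by measurable
    show ?thesis by measurable
  qed
  moreover have "lim (\<lambda>n. \<Prod>i<n. if \<Gamma> \<omega> i \<in> {0<..R} \<and> finite {i. \<Gamma> \<omega> i \<in> {0<..R}} then 1 - h (\<Gamma> \<omega> i) else 1) = (\<Prod>i | \<Gamma> \<omega> i \<in> {0<..R}. 1 - h (\<Gamma> \<omega> i))" for \<omega>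
  proof (cases "finite {i. \<Gamma> \<omega> i \<in> {0<..R}}")
    case True
    then obtain m where m: "{i. \<Gamma> \<omega> i \<in> {0<..R}} \<subseteq> {..<m}" using finite_nat_iff_bounded by auto
    have "(\<Prod>i<n. if \<Gamma> \<omega> i \<in> {0<..R} \<and> finite {i. \<Gamma> \<omega> i \<in> {0<..R}} then 1 - h (\<Gamma> \<omega> i) else 1) = (\<Prod>i | \<Gamma> \<omega> i \<in> {0<..R}. 1 - h (\<Gamma> \<omega> i))" if "n \<ge> m" for n
      using m that True by (intro prod.mono_neutral_cong_right) auto
    then have "eventually (\<lambda>n. (\<Prod>i<n. if \<Gamma> \<omega> i \<in> {0<..R} \<and> finite {i. \<Gamma> \<omega> i \<in> {0<..R}} then 1 - h (\<Gamma> \<omega> i) else 1) = (\<Prod>i | \<Gamma> \<omega> i \<in> {0<..R}. 1 - h (\<Gamma> \<omega> i))) sequentially"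
      by (rule eventually_sequentiallyI)
    then show ?thesis by (intro limI tendsto_eventually)
  qed (simp add: limI)
  ultimately show ?thesis by (simp only: )
qed

text \<open>Rounding \<open>h\<close> down to multiples of \<open>1 / Suc n\<close> groups the
  points by disjoint level sets, whose counts are independent Poisson variables. The product becomes
  a finite generating function, and bounded convergence removes the rounding on both sides.\<close>

lemma unit_poisson_points_functional:
  fixes h :: "real \<Rightarrow> real" and R :: real
  assumes N: "prob_space N" and \<Gamma>: "unit_poisson_points N \<Gamma>"
    and h [measurable]: "h \<in> borel_measurable borel" and h01: "\<And>x. 0 \<le> h x \<and> h x \<le> 1"
  shows "(\<integral>\<omega>. (\<Prod>i | \<Gamma> \<omega> i \<in> {0<..R}. 1 - h (\<Gamma> \<omega> i)) \<partial>N) = exp (- (\<integral>x. indicator {0<..R} x * h x \<partial>lborel))"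
proof -
  interpret prob_space N by fact
  define k where "k n x = nat \<lfloor>h x * real (Suc n)\<rfloor>" for n x
  define hn where "hn n x = real (k n x) / real (Suc n)" for n x
  have hn_floor: "hn n x = of_int \<lfloor>h x * real (Suc n)\<rfloor> / real (Suc n)" for n x
    unfolding hn_def k_def using h01[of x] by simp
  have k_le: "k n x \<le> Suc n" for n x
  proof -
    have "h x * real (Suc n) \<le> 1 * real (Suc n)" using h01 by (intro mult_right_mono) auto
    then have "\<lfloor>h x * real (Suc n)\<rfloor> \<le> int (Suc n)"
      using floor_mono[of "h x * real (Suc n)" "real (Suc n)"] floor_of_nat[of "Suc n", where 'a=real] by simp
    then show ?thesis unfolding k_def by linarith
  qed
  have hn01: "0 \<le> hn n x" "hn n x \<le> 1" for n x
    unfolding hn_def using k_le[of n x] by (auto simp: field_simps)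
  have hn_lim: "(\<lambda>n. hn n x) \<longlonglongrightarrow> h x" for x
    unfolding hn_floor by (rule floor_multiple_approx)
  have [measurable]: "k n \<in> measurable borel (count_space UNIV)" for n
    unfolding k_def by measurable
  have [measurable]: "hn n \<in> borel_measurable borel" for n unfolding hn_def[abs_def] by measurable
  define B where "B n j = {x\<in>{0<..R}. k n x = j}" for n j
  have B_sets[measurable]: "B n j \<in> sets borel" for n j unfolding B_def by measurable
  have Bb: "bounded (B n j)" for n j
    by (rule bounded_subset[of "{0..R}"]) (auto simp: B_def)
  have Bfin: "emeasure lborel (B n j) < \<infinity>" for n j by (rule emeasure_bounded_finite[OF Bb])
  have Bdisj: "disjoint_family_on (B n) A" for n A unfolding disjoint_family_on_def B_def by auto
  have Bc: "B n j \<in> sets borel \<and> bounded (B n j) \<and> B n j \<subseteq> {0<..}" for n j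
  proof -
    have "B n j \<subseteq> {0<..}" by (auto simp: B_def)
    then show ?thesis using B_sets Bb by simp
  qed
  have fin: "AE \<omega> in N. finite {i. \<Gamma> \<omega> i \<in> {0<..R}}"
    using unit_poisson_pointsD(3)[OF \<Gamma>] by (rule AE_mp) (auto intro!: AE_I2 elim: finite_subset[rotated])
  \<comment> \<open>The rounded levels \<open>k n x\<close> range from 0 to \<open>Suc n\<close>, so
    there are \<open>n + 2\<close> of them.\<close>
  have prod_eq: "(\<Prod>i | \<Gamma> \<omega> i \<in> {0<..R}. 1 - hn n (\<Gamma> \<omega> i)) = (\<Prod>j<n+2. (1 - real j / real (Suc n)) ^ card {i. \<Gamma> \<omega> i \<in> B n j})"
    if "finite {i. \<Gamma> \<omega> i \<in> {0<..R}}" for \<omega> n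
  proof -
    have "(\<Prod>i | \<Gamma> \<omega> i \<in> {0<..R}. 1 - hn n (\<Gamma> \<omega> i)) =
      (\<Prod>j<n+2. \<Prod>i\<in>{i \<in> {i. \<Gamma> \<omega> i \<in> {0<..R}}. k n (\<Gamma> \<omega> i) = j}. 1 - hn n (\<Gamma> \<omega> i))"
      by (rule prod.group[symmetric, OF that]) (use k_le in \<open>auto simp: less_Suc_eq_le\<close>)
    also have "\<dots> = (\<Prod>j<n+2. (1 - real j / real (Suc n)) ^ card {i. \<Gamma> \<omega> i \<in> B n j})"
    proof (rule prod.cong[OF refl])
      fix j
      have "{i \<in> {i. \<Gamma> \<omega> i \<in> {0<..R}}. k n (\<Gamma> \<omega> i) = j} = {i. \<Gamma> \<omega> i \<in> B n j}" unfolding B_def by auto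
      moreover have "(\<Prod>i | \<Gamma> \<omega> i \<in> B n j. 1 - hn n (\<Gamma> \<omega> i)) = (\<Prod>i | \<Gamma> \<omega> i \<in> B n j. 1 - real j / real (Suc n))"
        by (rule prod.cong) (auto simp: B_def hn_def)
      ultimately show "(\<Prod>i\<in>{i \<in> {i. \<Gamma> \<omega> i \<in> {0<..R}}. k n (\<Gamma> \<omega> i) = j}. 1 - hn n (\<Gamma> \<omega> i)) = (1 - real j / real (Suc n)) ^ card {i. \<Gamma> \<omega> i \<in> B n j}"
        by simp
    qed
    finally show ?thesis .
  qed
  have \<Gamma>m[measurable]: "(\<lambda>\<omega>. \<Gamma> \<omega> i) \<in> borel_measurable N" for i
    using unit_poisson_pointsD(1)[OF \<Gamma>] by (rule measurable_compose) (rule measurable_component_singleton, simp)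
  define P where "P n \<omega> = (\<Prod>j<n+2. (1 - real j / real (Suc n)) ^ card {i. \<Gamma> \<omega> i \<in> B n j})" for n \<omega>
  have s01: "0 \<le> 1 - real j / real (Suc n) \<and> 1 - real j / real (Suc n) \<le> 1" if "j < n + 2" for j n
    using that by (auto simp: field_simps)
  have P_m[measurable]: "P n \<in> borel_measurable N" for n
    unfolding P_def[abs_def]
  proof (rule borel_measurable_prod)
    fix j assume "j \<in> {..<n+2}"
    have "(\<lambda>\<omega>. card {i. \<Gamma> \<omega> i \<in> B n j}) \<in> measurable N (count_space UNIV)"
      by (rule unit_poisson_points_pgf(2)[OF N \<Gamma> Bc Bdisj, of "\<lambda>_. 1" j "Suc j"]) auto
    from measurable_compose[OF this, of "\<lambda>x. (1 - real j / real (Suc n)) ^ x" borel]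
    show "(\<lambda>\<omega>. (1 - real j / real (Suc n)) ^ card {i. \<Gamma> \<omega> i \<in> B n j}) \<in> borel_measurable N" by simp
  qed
  have P_int: "(\<integral>\<omega>. P n \<omega> \<partial>N) = exp (- (\<integral>x. indicator {0<..R} x * hn n x \<partial>lborel))" for n
  proof -
    \<comment> \<open>Beyond the range \<open>1 - real j / real (Suc n)\<close> would be negative,
      while the generating function lemma asks for all arguments in the unit interval.\<close>
    define s where "s j = (if j < n + 2 then 1 - real j / real (Suc n) else 1)" for j
    have "(\<integral>\<omega>. P n \<omega> \<partial>N) = (\<integral>\<omega>. (\<Prod>j<n+2. s j ^ card {i. \<Gamma> \<omega> i \<in> B n j}) \<partial>N)"
      unfolding P_def s_def by (intro Bochner_Integration.integral_cong prod.cong refl) auto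
    also have "\<dots> = exp (- (\<Sum>j<n+2. measure lborel (B n j) * (1 - s j)))"
      by (rule unit_poisson_points_pgf(1)[OF N \<Gamma> Bc Bdisj]) (use s01 in \<open>auto simp: s_def\<close>)
    also have "(\<Sum>j<n+2. measure lborel (B n j) * (1 - s j)) = (\<Sum>j<n+2. measure lborel (B n j) * (real j / real (Suc n)))"
      by (rule sum.cong) (auto simp: s_def)
    also have "\<dots> = (\<Sum>j<n+2. (\<integral>x. indicator (B n j) x * (real j / real (Suc n)) \<partial>lborel))"
      by simp
    also have "\<dots> = (\<integral>x. (\<Sum>j<n+2. indicator (B n j) x * (real j / real (Suc n))) \<partial>lborel)"
      using Bfin by (subst Bochner_Integration.integral_sum) (auto intro!: integrable_mult_left integrable_real_indicator)
    also have "\<dots> = (\<integral>x. indicator {0<..R} x * hn n x \<partial>lborel)"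
    proof (rule Bochner_Integration.integral_cong[OF refl])
      fix x
      have "(\<Sum>j<n+2. indicator (B n j) x * (real j / real (Suc n))) = (\<Sum>j<n+2. if j = k n x then indicator {0<..R} x * hn n x else 0)"
        by (rule sum.cong) (auto simp: B_def hn_def indicator_def)
      also have "\<dots> = indicator {0<..R} x * hn n x" using k_le[of n x] by (subst sum.delta) auto
      finally show "(\<Sum>j<n+2. indicator (B n j) x * (real j / real (Suc n))) = indicator {0<..R} x * hn n x" .
    qed
    finally show ?thesis .
  qed
  have "(\<lambda>n. \<integral>\<omega>. P n \<omega> \<partial>N) \<longlonglongrightarrow> (\<integral>\<omega>. (\<Prod>i | \<Gamma> \<omega> i \<in> {0<..R}. 1 - h (\<Gamma> \<omega> i)) \<partial>N)"
  proof (rule integral_dominated_convergence[of _ _ _ "\<lambda>_. 1"])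
    show lim: "AE \<omega> in N. (\<lambda>n. P n \<omega>) \<longlonglongrightarrow> (\<Prod>i | \<Gamma> \<omega> i \<in> {0<..R}. 1 - h (\<Gamma> \<omega> i))"
      using fin
    proof (rule AE_mp, intro AE_I2 impI)
      fix \<omega> assume f: "finite {i. \<Gamma> \<omega> i \<in> {0<..R}}"
      have "(\<lambda>n. \<Prod>i | \<Gamma> \<omega> i \<in> {0<..R}. 1 - hn n (\<Gamma> \<omega> i)) \<longlonglongrightarrow> (\<Prod>i | \<Gamma> \<omega> i \<in> {0<..R}. 1 - h (\<Gamma> \<omega> i))"
        by (intro tendsto_prod tendsto_diff tendsto_const hn_lim)
      then show "(\<lambda>n. P n \<omega>) \<longlonglongrightarrow> (\<Prod>i | \<Gamma> \<omega> i \<in> {0<..R}. 1 - h (\<Gamma> \<omega> i))"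
        unfolding P_def prod_eq[OF f] .
    qed
    show "(\<lambda>\<omega>. \<Prod>i | \<Gamma> \<omega> i \<in> {0<..R}. 1 - h (\<Gamma> \<omega> i)) \<in> borel_measurable N"
      by (rule unit_poisson_points_functional_measurable[OF \<Gamma> h])
    show "AE \<omega> in N. norm (P n \<omega>) \<le> 1" for n
    proof (rule AE_I2)
      fix \<omega>
      have "0 \<le> P n \<omega>" unfolding P_def using s01 by (intro prod_nonneg) auto
      moreover have "P n \<omega> \<le> 1" unfolding P_def using s01 by (intro prod_le_1) (auto intro!: power_le_one)
      ultimately show "norm (P n \<omega>) \<le> 1" by simp
    qed
  qed auto
  moreover have "(\<lambda>n. \<integral>\<omega>. P n \<omega> \<partial>N) \<longlonglongrightarrow> exp (- (\<integral>x. indicator {0<..R} x * h x \<partial>lborel))"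
    unfolding P_int
  proof (intro tendsto_exp tendsto_minus)
    show "(\<lambda>n. \<integral>x. indicator {0<..R} x * hn n x \<partial>lborel) \<longlonglongrightarrow> (\<integral>x. indicator {0<..R} x * h x \<partial>lborel)"
    proof (rule integral_dominated_convergence[of _ _ _ "indicator {0<..R}"])
      show "integrable lborel (indicator {0<..R} :: real \<Rightarrow> real)"
        by (rule integrable_real_indicator[OF _ emeasure_bounded_finite]) simp_all
      show "AE x in lborel. (\<lambda>n. indicator {0<..R} x * hn n x) \<longlonglongrightarrow> indicator {0<..R} x * h x"
        by (intro AE_I2 tendsto_mult tendsto_const hn_lim)
      show "AE x in lborel. norm (indicator {0<..R} x * hn n x) \<le> indicator {0<..R} x" for n
        using hn01 by (intro AE_I2) (auto simp: indicator_def)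
    qed auto
  qed
  ultimately show ?thesis by (rule LIMSEQ_unique)
qed


section \<open>Void probabilities of the marked process\<close>

text \<open>The length of the interval between 0 and \<open>w\<close>, infinite values included;
  with Fubini it converts the integral of the tail of a variable into its mean.\<close>

lemma emeasure_lborel_below_ennreal:
  fixes w :: ennreal
  shows "(\<integral>\<^sup>+x. indicator {0<..} x * indicator {..<w} (ennreal x) \<partial>lborel) = w"
proof (cases w)
  case (real r)
  have "(\<integral>\<^sup>+x. indicator {0<..} x * indicator {..<w} (ennreal x) \<partial>lborel) = (\<integral>\<^sup>+x. indicator {0<..<r} (x::real) \<partial>lborel)"
    by (rule nn_integral_cong) (auto simp: indicator_def real ennreal_less_iff)
  also have "\<dots> = w" using real by simp
  finally show ?thesis .
next
  case top
  have "(\<integral>\<^sup>+x. indicator {0<..} x * indicator {..<w} (ennreal x) \<partial>lborel) = (\<integral>\<^sup>+x. indicator {0<..} (x::real) * 1 \<partial>lborel)"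
    by (rule nn_integral_cong) (auto simp: indicator_def top)
  also have "\<dots> = emeasure lborel ({0<..} :: real set)" by simp
  also have "\<dots> = \<infinity>"
  proof -
    have "of_nat n \<le> emeasure lborel ({0<..} :: real set)" for n
    proof -
      have "emeasure lborel {0<..real n} \<le> emeasure lborel ({0<..} :: real set)"
        by (rule emeasure_mono) auto
      then show ?thesis by (simp add: ennreal_of_nat_eq_real_of_nat)
    qed
    then show ?thesis
      using ennreal_Ex_less_of_nat[of "emeasure lborel ({0<..} :: real set)"]
      by (auto simp: less_top[symmetric] not_less[symmetric])
  qed
  finally show ?thesis using top by simp
qed

text \<open>The library notion \<open>indep_var\<close> requires both variables to have values in the same type.\<close>

lemma (in prob_space) indep_set_imp_distr_pair:
  assumes X: "X \<in> measurable M S" and Y: "Y \<in> measurable M T"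
    and ind: "indep_set (sets (vimage_algebra (space M) X S)) (sets (vimage_algebra (space M) Y T))"
  shows "distr M (S \<Otimes>\<^sub>M T) (\<lambda>\<omega>. (X \<omega>, Y \<omega>)) = distr M S X \<Otimes>\<^sub>M distr M T Y"
proof (rule pair_measure_eqI[symmetric])
  interpret DX: prob_space "distr M S X" by (rule prob_space_distr[OF X])
  interpret DY: prob_space "distr M T Y" by (rule prob_space_distr[OF Y])
  show "sigma_finite_measure (distr M S X)" "sigma_finite_measure (distr M T Y)" ..
  show "sets (distr M S X \<Otimes>\<^sub>M distr M T Y) = sets (distr M (S \<Otimes>\<^sub>M T) (\<lambda>\<omega>. (X \<omega>, Y \<omega>)))"
    by (simp cong: sets_pair_measure_cong)
  fix A B assume "A \<in> sets (distr M S X)" "B \<in> sets (distr M T Y)"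
  then have A: "A \<in> sets S" and B: "B \<in> sets T" by auto
  have "prob ((X -` A \<inter> space M) \<inter> (Y -` B \<inter> space M)) = prob (X -` A \<inter> space M) * prob (Y -` B \<inter> space M)"
    using A B by (intro indep_setD[OF ind] in_vimage_algebra)
  moreover have "(X -` A \<inter> space M) \<inter> (Y -` B \<inter> space M) = (\<lambda>\<omega>. (X \<omega>, Y \<omega>)) -` (A \<times> B) \<inter> space M" by auto
  ultimately show "emeasure (distr M S X) A * emeasure (distr M T Y) B = emeasure (distr M (S \<Otimes>\<^sub>M T) (\<lambda>\<omega>. (X \<omega>, Y \<omega>))) (A \<times> B)"
    using A B X Y by (simp add: emeasure_distr emeasure_eq_measure ennreal_mult)
qed

text \<open>Given the points, the independent marks satisfy all constraints with probability equal
  to the product of \<open>1 - h (\<Gamma> \<omega> i)\<close>, where \<open>h\<close> is the tail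
  of \<open>W\<close>. The generating functional evaluates the mean of this product as an
  exponential of minus the integral of \<open>h\<close>, and that integral is the mean of
  \<open>W\<close>. Windows \<open>{0<..R}\<close> come first because they contain finitely many
  points almost surely.\<close>

lemma marked_poisson_void_probability:
  assumes N: "prob_space N" and \<Gamma>: "unit_poisson_points N \<Gamma>"
    and Ym [measurable]: "Y \<in> measurable N (PiM UNIV (\<lambda>_. S))"
    and ind: "prob_space.indep_set N
        (sets (vimage_algebra (space N) \<Gamma> (PiM UNIV (\<lambda>_. borel))))
        (sets (vimage_algebra (space N) Y (PiM UNIV (\<lambda>_. S))))"
    and iY: "prob_space.indep_vars N (\<lambda>_. S) (\<lambda>i \<omega>. Y \<omega> i) UNIV"
    and dY: "\<And>i. distr N S (\<lambda>\<omega>. Y \<omega> i) = distr N S (\<lambda>\<omega>. Y \<omega> (0::nat))"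
    and W [measurable]: "W \<in> borel_measurable S" and fin: "(\<integral>\<^sup>+\<omega>. W (Y \<omega> 0) \<partial>N) < \<infinity>"
  shows "measure N {\<omega>\<in>space N. \<forall>i. W (Y \<omega> i) \<le> ennreal (\<Gamma> \<omega> i)} = exp (- enn2real (\<integral>\<^sup>+\<omega>. W (Y \<omega> 0) \<partial>N))"
proof -
  interpret prob_space N by fact
  have \<Gamma>m[measurable]: "\<Gamma> \<in> measurable N (PiM UNIV (\<lambda>_. borel))"
    by (rule unit_poisson_pointsD(1)[OF \<Gamma>])
  have [measurable]: "(\<lambda>\<omega>. \<Gamma> \<omega> i) \<in> borel_measurable N" for i
    using \<Gamma>m by (rule measurable_compose) (rule measurable_component_singleton, simp)
  have Yim[measurable]: "(\<lambda>\<omega>. Y \<omega> i) \<in> measurable N S" for i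
    using Ym by (rule measurable_compose) (rule measurable_component_singleton, simp)
  define h where "h x = prob {\<omega>\<in>space N. ennreal x < W (Y \<omega> 0)}" for x
  have h01: "0 \<le> h x \<and> h x \<le> 1" for x unfolding h_def by auto
  \<comment> \<open>A tail function is decreasing, and monotone real functions are Borel.\<close>
  have h_m[measurable]: "h \<in> borel_measurable borel"
  proof -
    have "mono (\<lambda>x. - h x)"
      unfolding h_def by (rule monoI) (auto intro!: finite_measure_mono elim: order.strict_trans1[OF ennreal_leI])
    then have "(\<lambda>x. - h x) \<in> borel_measurable borel" by (rule borel_measurable_mono)
    then show ?thesis by simp
  qed
  have G: "prob {\<omega>\<in>space N. W (Y \<omega> i) \<le> ennreal x} = 1 - h x" for i x
  proof -
    have "measure (distr N S (\<lambda>\<omega>. Y \<omega> i)) {y\<in>space S. W y \<le> ennreal x} = measure (distr N S (\<lambda>\<omega>. Y \<omega> 0)) {y\<in>space S. W y \<le> ennreal x}"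
      unfolding dY[of i] ..
    moreover have "measure (distr N S (\<lambda>\<omega>. Y \<omega> i)) {y\<in>space S. W y \<le> ennreal x} = prob {\<omega>\<in>space N. W (Y \<omega> i) \<le> ennreal x}" for i
      using measurable_space[OF Yim[of i]] by (subst measure_distr) (auto intro!: arg_cong[where f=prob])
    ultimately have "prob {\<omega>\<in>space N. W (Y \<omega> i) \<le> ennreal x} = prob {\<omega>\<in>space N. W (Y \<omega> 0) \<le> ennreal x}" by simp
    also have "\<dots> = 1 - h x"
      unfolding h_def by (subst prob_neg[symmetric]) (auto simp: not_less)
    finally show ?thesis .
  qed
  define A where "A R = {\<omega>\<in>space N. \<forall>i. \<Gamma> \<omega> i \<in> {0<..real R} \<longrightarrow> W (Y \<omega> i) \<le> ennreal (\<Gamma> \<omega> i)}" for R :: nat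
  have A_m[measurable]: "A R \<in> sets N" for R unfolding A_def by measurable
  have A_prob: "prob (A R) = exp (- (\<integral>x. indicator {0<..real R} x * h x \<partial>lborel))" for R
  proof -
    let ?G = "PiM UNIV (\<lambda>_::nat. borel :: real measure)" and ?S = "PiM UNIV (\<lambda>_::nat. S)"
    interpret DG: prob_space "distr N ?G \<Gamma>" by (rule prob_space_distr) simp
    interpret DY: prob_space "distr N ?S Y" by (rule prob_space_distr) simp
    define A' where "A' = {p\<in>space (?G \<Otimes>\<^sub>M ?S). \<forall>i. fst p i \<in> {0<..real R} \<longrightarrow> W (snd p i) \<le> ennreal (fst p i)}"
    have [measurable]: "(\<lambda>p. fst p i) \<in> borel_measurable (?G \<Otimes>\<^sub>M ?S)" "(\<lambda>p. snd p i) \<in> measurable (?G \<Otimes>\<^sub>M ?S) S" for i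
      by (rule measurable_compose[OF measurable_fst measurable_component_singleton] measurable_compose[OF measurable_snd measurable_component_singleton], simp)+
    have A'_m[measurable]: "A' \<in> sets (?G \<Otimes>\<^sub>M ?S)" unfolding A'_def by measurable
    have "emeasure N (A R) = emeasure (distr N (?G \<Otimes>\<^sub>M ?S) (\<lambda>\<omega>. (\<Gamma> \<omega>, Y \<omega>))) A'"
      using measurable_space[OF Ym] measurable_space[OF \<Gamma>m]
      by (subst emeasure_distr) (auto simp: A_def A'_def space_pair_measure intro!: arg_cong[where f="emeasure N"])
    \<comment> \<open>Independence makes the joint law a product, so the points can be frozen and
      the marks integrated first.\<close>
    also have "\<dots> = emeasure (distr N ?G \<Gamma> \<Otimes>\<^sub>M distr N ?S Y) A'"
      by (simp only: indep_set_imp_distr_pair[OF \<Gamma>m Ym ind])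
    also have "\<dots> = (\<integral>\<^sup>+g. emeasure (distr N ?S Y) (Pair g -` A') \<partial>distr N ?G \<Gamma>)"
      by (rule DY.emeasure_pair_measure_alt) (simp add: A'_m)
    also have "\<dots> = (\<integral>\<^sup>+\<omega>. emeasure (distr N ?S Y) (Pair (\<Gamma> \<omega>) -` A') \<partial>N)"
      by (rule nn_integral_distr[OF \<Gamma>m]) (rule DY.measurable_emeasure_Pair, simp add: A'_m)
    also have "\<dots> = (\<integral>\<^sup>+\<omega>. ennreal (\<Prod>i | \<Gamma> \<omega> i \<in> {0<..real R}. 1 - h (\<Gamma> \<omega> i)) \<partial>N)"
    proof (rule nn_integral_cong_AE)
      show "AE \<omega> in N. emeasure (distr N ?S Y) (Pair (\<Gamma> \<omega>) -` A') = ennreal (\<Prod>i | \<Gamma> \<omega> i \<in> {0<..real R}. 1 - h (\<Gamma> \<omega> i))"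
        using unit_poisson_pointsD(3)[OF \<Gamma>]
      proof (rule AE_mp, intro AE_I2 impI)
        fix \<omega> assume \<omega>: "\<omega> \<in> space N" and f: "\<forall>R. finite {i. \<Gamma> \<omega> i \<le> R}"
        define J where "J = {i. \<Gamma> \<omega> i \<in> {0<..real R}}"
        have J: "finite J" using f unfolding J_def by (auto elim: finite_subset[rotated])
        have "Pair (\<Gamma> \<omega>) -` A' = {y\<in>space ?S. \<forall>i. i \<in> J \<longrightarrow> W (y i) \<le> ennreal (\<Gamma> \<omega> i)}"
          using measurable_space[OF \<Gamma>m \<omega>] unfolding A'_def J_def by (auto simp: space_pair_measure)
        moreover have "{y\<in>space ?S. \<forall>i. i \<in> J \<longrightarrow> W (y i) \<le> ennreal (\<Gamma> \<omega> i)} \<in> sets ?S" by measurable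
        ultimately have "emeasure (distr N ?S Y) (Pair (\<Gamma> \<omega>) -` A') = emeasure N {\<omega>'\<in>space N. \<forall>i\<in>J. W (Y \<omega>' i) \<le> ennreal (\<Gamma> \<omega> i)}"
          using measurable_space[OF Ym] by (simp add: emeasure_distr) (auto intro!: arg_cong[where f="emeasure N"])
        also have "\<dots> = ennreal (prob {\<omega>'\<in>space N. \<forall>i\<in>J. W (Y \<omega>' i) \<le> ennreal (\<Gamma> \<omega> i)})"
          by (rule emeasure_eq_measure)
        also have "prob {\<omega>'\<in>space N. \<forall>i\<in>J. W (Y \<omega>' i) \<le> ennreal (\<Gamma> \<omega> i)} = (\<Prod>i\<in>J. 1 - h (\<Gamma> \<omega> i))"
        proof (cases "J = {}")
          case True then show ?thesis using prob_space by simp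
        next
          case False
          let ?A = "\<lambda>i. {y\<in>space S. W y \<le> ennreal (\<Gamma> \<omega> i)}"
          have "prob (\<Inter>i\<in>J. (\<lambda>\<omega>'. Y \<omega>' i) -` ?A i \<inter> space N) = (\<Prod>i\<in>J. prob ((\<lambda>\<omega>'. Y \<omega>' i) -` ?A i \<inter> space N))"
            by (rule indep_varsD[OF iY False J]) auto
          moreover have "(\<lambda>\<omega>'. Y \<omega>' i) -` ?A i \<inter> space N = {\<omega>'\<in>space N. W (Y \<omega>' i) \<le> ennreal (\<Gamma> \<omega> i)}" for i
            using measurable_space[OF Yim[of i]] by auto
          moreover have "(\<Inter>i\<in>J. {\<omega>'\<in>space N. W (Y \<omega>' i) \<le> ennreal (\<Gamma> \<omega> i)}) = {\<omega>'\<in>space N. \<forall>i\<in>J. W (Y \<omega>' i) \<le> ennreal (\<Gamma> \<omega> i)}"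
            using False by auto
          ultimately show ?thesis by (simp only: G)
        qed
        finally show "emeasure (distr N ?S Y) (Pair (\<Gamma> \<omega>) -` A') = ennreal (\<Prod>i | \<Gamma> \<omega> i \<in> {0<..real R}. 1 - h (\<Gamma> \<omega> i))"
          unfolding J_def .
      qed
    qed
    finally have "(\<integral>\<^sup>+\<omega>. ennreal (\<Prod>i | \<Gamma> \<omega> i \<in> {0<..real R}. 1 - h (\<Gamma> \<omega> i)) \<partial>N) = ennreal (prob (A R))"
      by (simp add: emeasure_eq_measure)
    then have "(\<integral>\<omega>. (\<Prod>i | \<Gamma> \<omega> i \<in> {0<..real R}. 1 - h (\<Gamma> \<omega> i)) \<partial>N) = prob (A R)"
      by (subst integral_eq_nn_integral)
        (use h01 unit_poisson_points_functional_measurable[OF \<Gamma> h_m] in \<open>auto intro!: AE_I2 prod_nonneg\<close>)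
    then show ?thesis
      using unit_poisson_points_functional[OF N \<Gamma> h_m h01, of "real R"] by simp
  qed
  have lim1: "(\<lambda>R. prob (A R)) \<longlonglongrightarrow> prob (\<Inter>R. A R)"
  proof (rule finite_Lim_measure_decseq)
    show "decseq A" unfolding decseq_def A_def by (auto intro: order_trans)
  qed auto
  \<comment> \<open>Almost surely every point is positive and so lies in some window; the
    constraints over all windows are then all the constraints.\<close>
  have "prob (\<Inter>R. A R) = prob {\<omega>\<in>space N. \<forall>i. W (Y \<omega> i) \<le> ennreal (\<Gamma> \<omega> i)}"
  proof (rule finite_measure_eq_AE)
    show "AE \<omega> in N. (\<omega> \<in> (\<Inter>R. A R)) = (\<omega> \<in> {\<omega>\<in>space N. \<forall>i. W (Y \<omega> i) \<le> ennreal (\<Gamma> \<omega> i)})"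
      using unit_poisson_pointsD(2)[OF \<Gamma>]
    proof (rule AE_mp, intro AE_I2 impI)
      fix \<omega> assume \<omega>: "\<omega> \<in> space N" and p: "\<forall>i. 0 < \<Gamma> \<omega> i"
      have "W (Y \<omega> i) \<le> ennreal (\<Gamma> \<omega> i)" if "\<forall>R. \<omega> \<in> A R" for i
        using that p real_arch_simple[of "\<Gamma> \<omega> i"] unfolding A_def by auto
      then show "(\<omega> \<in> (\<Inter>R. A R)) = (\<omega> \<in> {\<omega>\<in>space N. \<forall>i. W (Y \<omega> i) \<le> ennreal (\<Gamma> \<omega> i)})"
        using \<omega> unfolding A_def by auto
    qed
  qed auto
  note lim1 = lim1[unfolded this A_prob]
  have int_h: "(\<integral>\<^sup>+x. indicator {0<..} x * ennreal (h x) \<partial>lborel) = (\<integral>\<^sup>+\<omega>. W (Y \<omega> 0) \<partial>N)"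
  proof -
    have "(\<integral>\<^sup>+x. indicator {0<..} x * ennreal (h x) \<partial>lborel) = (\<integral>\<^sup>+x. (\<integral>\<^sup>+\<omega>. indicator {0<..} x * indicator {..<W (Y \<omega> 0)} (ennreal x) \<partial>N) \<partial>lborel)"
    proof (rule nn_integral_cong)
      fix x :: real
      have "(\<integral>\<^sup>+\<omega>. indicator {0<..} x * indicator {..<W (Y \<omega> 0)} (ennreal x) \<partial>N) = indicator {0<..} x * (\<integral>\<^sup>+\<omega>. indicator {\<omega>\<in>space N. ennreal x < W (Y \<omega> 0)} \<omega> \<partial>N)"
        by (subst nn_integral_cmult[symmetric]) (auto intro!: nn_integral_cong simp: indicator_def)
      also have "\<dots> = indicator {0<..} x * ennreal (h x)"
        unfolding h_def by (simp add: emeasure_eq_measure)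
      finally show "indicator {0<..} x * ennreal (h x) = (\<integral>\<^sup>+\<omega>. indicator {0<..} x * indicator {..<W (Y \<omega> 0)} (ennreal x) \<partial>N)" ..
    qed
    also have "\<dots> = (\<integral>\<^sup>+\<omega>. (\<integral>\<^sup>+x. indicator {0<..} x * indicator {..<W (Y \<omega> 0)} (ennreal x) \<partial>lborel) \<partial>N)"
    proof -
      interpret P: pair_sigma_finite lborel N ..
      have "(\<lambda>(x, \<omega>). indicator {0<..} x * indicator {..<W (Y \<omega> 0)} (ennreal x) :: ennreal) \<in> borel_measurable (lborel \<Otimes>\<^sub>M N)"
        unfolding indicator_def lessThan_iff by measurable
      from P.Fubini'[OF this] show ?thesis ..
    qed
    finally show ?thesis by (simp only: emeasure_lborel_below_ennreal)
  qed
  have "(\<lambda>R. \<integral>\<^sup>+x. indicator {0<..real R} x * ennreal (h x) \<partial>lborel) \<longlonglongrightarrow> (\<integral>\<^sup>+x. indicator {0<..} x * ennreal (h x) \<partial>lborel)"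
  proof (rule nn_integral_LIMSEQ)
    show "incseq (\<lambda>R x. indicator {0<..real R} x * ennreal (h x))"
      by (auto simp: incseq_def le_fun_def indicator_def)
    fix x :: real
    obtain m where m: "x \<le> real m" using real_arch_simple by blast
    show "(\<lambda>R. indicator {0<..real R} x * ennreal (h x)) \<longlonglongrightarrow> indicator {0<..} x * ennreal (h x)"
      by (rule tendsto_eventually, rule eventually_sequentiallyI[of m]) (use m in \<open>auto simp: indicator_def\<close>)
  qed auto
  moreover have "(\<integral>\<^sup>+x. indicator {0<..real R} x * ennreal (h x) \<partial>lborel) = ennreal (\<integral>x. indicator {0<..real R} x * h x \<partial>lborel)" for R :: nat
  proof -
    have "integrable lborel (\<lambda>x. indicator {0<..real R} x * h x)"
    proof (rule Bochner_Integration.integrable_bound[of _ "indicator {0<..real R} :: real \<Rightarrow> real"])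
      show "integrable lborel (indicator {0<..real R} :: real \<Rightarrow> real)"
        by (rule integrable_real_indicator[OF _ emeasure_bounded_finite]) simp_all
    qed (use h01 in \<open>auto simp: indicator_def intro!: AE_I2\<close>)
    then have "(\<integral>\<^sup>+x. ennreal (indicator {0<..real R} x * h x) \<partial>lborel) = ennreal (\<integral>x. indicator {0<..real R} x * h x \<partial>lborel)"
      using h01 by (intro nn_integral_eq_integral) auto
    then show ?thesis using h01 by (simp add: ennreal_mult ennreal_indicator)
  qed
  ultimately have "(\<lambda>R. ennreal (\<integral>x. indicator {0<..real R} x * h x \<partial>lborel)) \<longlonglongrightarrow> (\<integral>\<^sup>+\<omega>. W (Y \<omega> 0) \<partial>N)"
    using int_h by simp
  then have "(\<lambda>R. enn2real (ennreal (\<integral>x. indicator {0<..real R} x * h x \<partial>lborel))) \<longlonglongrightarrow> enn2real (\<integral>\<^sup>+\<omega>. W (Y \<omega> 0) \<partial>N)"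
    using fin by (intro tendsto_enn2real) auto
  then have "(\<lambda>R. \<integral>x. indicator {0<..real R} x * h x \<partial>lborel) \<longlonglongrightarrow> enn2real (\<integral>\<^sup>+\<omega>. W (Y \<omega> 0) \<partial>N)"
    using h01 by (simp add: enn2real_ennreal Bochner_Integration.integral_nonneg)
  then have "(\<lambda>R. exp (- (\<integral>x. indicator {0<..real R} x * h x \<partial>lborel))) \<longlonglongrightarrow> exp (- enn2real (\<integral>\<^sup>+\<omega>. W (Y \<omega> 0) \<partial>N))"
    by (intro tendsto_intros)
  with lim1 show ?thesis by (rule LIMSEQ_unique)
qed

subsection \<open>Representable sup-measures\<close>

text \<open>Both directions go through the law of \<open>SUP j<n. u j * X (K j)\<close>, since these laws determine the
  distribution on \<open>PiM {K. compact K} borel\<close>: the half-open boxes generate.\<close>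

lemma equal_in_distribution_KI:
  fixes X :: "'m \<Rightarrow> 'a::topological_space set \<Rightarrow> ennreal" and Z :: "'n \<Rightarrow> 'a set \<Rightarrow> ennreal"
  assumes M: "prob_space M" and N: "prob_space N"
    and X: "\<And>K. compact K \<Longrightarrow> (\<lambda>\<omega>. X \<omega> K) \<in> borel_measurable M"
    and Z: "\<And>K. compact K \<Longrightarrow> (\<lambda>\<omega>. Z \<omega> K) \<in> borel_measurable N"
    and eq: "\<And>J t. finite J \<Longrightarrow> (\<And>K. K \<in> J \<Longrightarrow> compact K \<and> (0::real) < t K) \<Longrightarrow>
      measure M {\<omega>\<in>space M. \<forall>K\<in>J. X \<omega> K \<le> ennreal (t K)} = measure N {\<omega>\<in>space N. \<forall>K\<in>J. Z \<omega> K \<le> ennreal (t K)}"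
  shows "equal_in_distribution_K M X N Z"
proof -
  interpret M: prob_space M by fact
  interpret N: prob_space N by fact
  let ?I = "{K :: 'a set. compact K}"
  let ?P = "PiM ?I (\<lambda>_. borel :: ennreal measure)"
  let ?fX = "\<lambda>\<omega>. restrict (X \<omega>) ?I" and ?fZ = "\<lambda>\<omega>. restrict (Z \<omega>) ?I"
  have Xm: "?fX \<in> measurable M ?P" by (rule measurable_restrict) (simp add: X)
  have Zm: "?fZ \<in> measurable N ?P" by (rule measurable_restrict) (simp add: Z)
  define G where "G = {{f\<in>space ?P. \<forall>K\<in>J. f K \<le> ennreal (t K)} | J t. finite J \<and> (\<forall>K\<in>J. compact K \<and> (0::real) < t K)}"
  have G_sub: "G \<subseteq> Pow (space ?P)" unfolding G_def by auto
  have UG: "space ?P \<in> G" unfolding G_def by (auto intro!: exI[of _ "{}"])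
  have G_sets: "A \<in> sets ?P" if "A \<in> G" for A
  proof -
    obtain J t where A: "A = {f\<in>space ?P. \<forall>K\<in>J. f K \<le> ennreal (t K)}" and J: "finite J" "\<forall>K\<in>J. compact K \<and> (0::real) < t K"
      using \<open>A \<in> G\<close> unfolding G_def by auto
    have "{f\<in>space ?P. f K \<le> ennreal (t K)} \<in> sets ?P" if "K \<in> J" for K
    proof -
      have [measurable]: "(\<lambda>f. f K) \<in> borel_measurable ?P" using J that by (intro measurable_component_singleton) auto
      show ?thesis by measurable
    qed
    then show ?thesis unfolding A by (rule sets.sets_Collect_finite_All[OF _ J(1)])
  qed
  have stable: "Int_stable G"
  proof (rule Int_stableI)
    fix A B assume "A \<in> G" "B \<in> G"
    then obtain J t J' t' where A: "A = {f\<in>space ?P. \<forall>K\<in>J. f K \<le> ennreal (t K)}" "finite J" "\<forall>K\<in>J. compact K \<and> (0::real) < t K"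
      and B: "B = {f\<in>space ?P. \<forall>K\<in>J'. f K \<le> ennreal (t' K)}" "finite J'" "\<forall>K\<in>J'. compact K \<and> (0::real) < t' K"
      unfolding G_def by blast
    \<comment> \<open>On common indices the smaller threshold wins; elsewhere each box keeps its
      own.\<close>
    define s where "s K = (if K \<in> J \<and> K \<in> J' then min (t K) (t' K) else if K \<in> J then t K else t' K)" for K
    have "A \<inter> B = {f\<in>space ?P. \<forall>K\<in>J \<union> J'. f K \<le> ennreal (s K)}"
    proof -
      have "z \<le> ennreal (min a b) \<longleftrightarrow> z \<le> ennreal a \<and> z \<le> ennreal b" for z a b
        by (auto simp: min_def intro: order_trans[OF _ ennreal_leI])
      then have "(\<forall>K\<in>J \<union> J'. f K \<le> ennreal (s K)) \<longleftrightarrow> (\<forall>K\<in>J. f K \<le> ennreal (t K)) \<and> (\<forall>K\<in>J'. f K \<le> ennreal (t' K))" for f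
        unfolding s_def by (smt (verit, best) UnCI UnE)
      then show ?thesis unfolding A B by auto
    qed
    moreover have "finite (J \<union> J')" "\<forall>K\<in>J \<union> J'. compact K \<and> 0 < s K" using A B unfolding s_def by auto
    ultimately show "A \<inter> B \<in> G" unfolding G_def by blast
  qed
  have gen: "sets ?P = sigma_sets (space ?P) G"
  proof
    show "sigma_sets (space ?P) G \<subseteq> sets ?P" using G_sets by (intro sets.sigma_sets_subset) auto
    have sets_G: "sets (sigma (space ?P) G) = sigma_sets (space ?P) G" using G_sub by (rule sets_measure_of)
    have space_G: "space (sigma (space ?P) G) = space ?P" using G_sub by (rule space_measure_of)
    have "(\<lambda>f. f K) \<in> borel_measurable (sigma (space ?P) G)" if K: "compact K" for K
    proof (rule borel_measurableI_le)
      fix y :: ennreal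
      have pos: "{f\<in>space ?P. f K \<le> ennreal r} \<in> sigma_sets (space ?P) G" if "0 < r" for r
        using K that by (intro sigma_sets.Basic) (auto simp: G_def intro!: exI[of _ "{K}"] exI[of _ "\<lambda>_. r"])
      show "{f\<in>space (sigma (space ?P) G). f K \<le> y} \<in> sets (sigma (space ?P) G)"
        unfolding sets_G space_G
      proof (cases y)
        case (real r)
        show "{f\<in>space ?P. f K \<le> y} \<in> sigma_sets (space ?P) G"
        proof (cases "0 < r")
          case True then show ?thesis using pos real by simp
        next
          case False
          \<comment> \<open>The generating boxes have positive thresholds, as Frechet laws are
            described at \<open>t > 0\<close> only; threshold 0 is reached as a countable
            intersection.\<close>
          have "{f\<in>space ?P. f K \<le> y} = (\<Inter>n. {f\<in>space ?P. f K \<le> ennreal (1 / real (Suc n))})"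
          proof -
            have "x = 0" if "\<forall>n. x \<le> ennreal (1 / real (Suc n))" for x :: ennreal
            proof -
              have "(\<lambda>n. ennreal (1 / real (Suc n))) \<longlonglongrightarrow> ennreal 0"
                by (intro tendsto_ennrealI LIMSEQ_Suc lim_1_over_n)
              then have "x \<le> ennreal 0" using that by (intro LIMSEQ_le_const) auto
              then show ?thesis by simp
            qed
            then show ?thesis using real False by auto
          qed
          also have "\<dots> \<in> sigma_sets (space ?P) G"
            using pos G_sub by (intro sigma_sets_INTER) (auto simp del: of_nat_Suc)
          finally show ?thesis .
        qed
      next
        case top
        then show "{f\<in>space ?P. f K \<le> y} \<in> sigma_sets (space ?P) G" using sigma_sets_top by auto
      qed
    qed
    note meas = this
    have "sets ?P \<subseteq> sets (sigma (space ?P) G)"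
    proof (rule sets_PiM_in_sets)
      show "space (sigma (space ?P) G) = (\<Pi>\<^sub>E i\<in>?I. space borel)"
        unfolding space_G by (rule space_PiM)
      fix K and A :: "ennreal set" assume "K \<in> ?I" "A \<in> sets borel"
      then show "{f \<in> space (sigma (space ?P) G). f K \<in> A} \<in> sets (sigma (space ?P) G)"
        using measurable_sets[OF meas, of K A] by (simp only: vimage_def Int_def mem_Collect_eq conj_commute)
    qed
    then show "sets ?P \<subseteq> sigma_sets (space ?P) G" unfolding sets_G .
  qed
  have "distr M ?P ?fX = distr N ?P ?fZ"
  proof (rule measure_eqI_generator_eq[OF stable G_sub])
    show "sets (distr M ?P ?fX) = sigma_sets (space ?P) G" "sets (distr N ?P ?fZ) = sigma_sets (space ?P) G"
      using gen by simp_all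
    show "range (\<lambda>_::nat. space ?P) \<subseteq> G" "(\<Union>i::nat. space ?P) = space ?P" using UG by auto
    show "emeasure (distr M ?P ?fX) (space ?P) \<noteq> \<infinity>"
      using Xm by (simp add: emeasure_distr measurable_space cong: M.emeasure_eq_measure)
    fix A assume AG: "A \<in> G"
    then obtain J t where A: "A = {f\<in>space ?P. \<forall>K\<in>J. f K \<le> ennreal (t K)}" and J: "finite J" "\<forall>K\<in>J. compact K \<and> (0::real) < t K"
      unfolding G_def by auto
    have "?fX -` A \<inter> space M = {\<omega>\<in>space M. \<forall>K\<in>J. X \<omega> K \<le> ennreal (t K)}"
      using measurable_space[OF Xm] J unfolding A by (auto simp: restrict_def)
    moreover have "?fZ -` A \<inter> space N = {\<omega>\<in>space N. \<forall>K\<in>J. Z \<omega> K \<le> ennreal (t K)}"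
      using measurable_space[OF Zm] J unfolding A by (auto simp: restrict_def)
    ultimately show "emeasure (distr M ?P ?fX) A = emeasure (distr N ?P ?fZ) A"
      using eq[OF J(1), of t] J(2)
      by (simp add: emeasure_distr[OF Xm G_sets[OF AG]] emeasure_distr[OF Zm G_sets[OF AG]] M.emeasure_eq_measure N.emeasure_eq_measure)
  qed
  then show ?thesis unfolding equal_in_distribution_K_def .
qed

text \<open>The event involves finitely many coordinates and is therefore measurable in the product,
  even though the index set of all compacts may be uncountable.\<close>

lemma equal_in_distribution_KD:
  fixes X :: "'m \<Rightarrow> 'a::topological_space set \<Rightarrow> ennreal" and Z :: "'n \<Rightarrow> 'a set \<Rightarrow> ennreal"
  assumes eq: "equal_in_distribution_K M X N Z"
    and X: "\<And>K. compact K \<Longrightarrow> (\<lambda>\<omega>. X \<omega> K) \<in> borel_measurable M"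
    and Z: "\<And>K. compact K \<Longrightarrow> (\<lambda>\<omega>. Z \<omega> K) \<in> borel_measurable N"
    and K: "\<And>i. i < n \<Longrightarrow> compact (K i)"
  shows "measure M {\<omega>\<in>space M. (SUP i\<in>{..<n::nat}. ennreal (u i) * X \<omega> (K i)) \<le> y} =
    measure N {\<omega>\<in>space N. (SUP i\<in>{..<n}. ennreal (u i) * Z \<omega> (K i)) \<le> y}"
proof -
  let ?I = "{K :: 'a set. compact K}"
  let ?P = "PiM ?I (\<lambda>_. borel :: ennreal measure)"
  have Xm: "(\<lambda>\<omega>. restrict (X \<omega>) ?I) \<in> measurable M ?P" by (rule measurable_restrict) (simp add: X)
  have Zm: "(\<lambda>\<omega>. restrict (Z \<omega>) ?I) \<in> measurable N ?P" by (rule measurable_restrict) (simp add: Z)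
  define A where "A = {f\<in>space ?P. (SUP i\<in>{..<n}. ennreal (u i) * f (K i)) \<le> y}"
  have [measurable]: "(\<lambda>f. f (K i)) \<in> borel_measurable ?P" if "i \<in> {..<n}" for i
    using K that by (intro measurable_component_singleton) auto
  have "(\<lambda>f. SUP i\<in>{..<n}. ennreal (u i) * f (K i)) \<in> borel_measurable ?P"
    by (intro borel_measurable_SUP) auto
  then have A: "A \<in> sets ?P" unfolding A_def by measurable
  have "measure (distr M ?P (\<lambda>\<omega>. restrict (X \<omega>) ?I)) A = measure (distr N ?P (\<lambda>\<omega>. restrict (Z \<omega>) ?I)) A"
    using eq unfolding equal_in_distribution_K_def by simp
  moreover have "(\<lambda>\<omega>. restrict (X \<omega>) ?I) -` A \<inter> space M = {\<omega>\<in>space M. (SUP i\<in>{..<n}. ennreal (u i) * X \<omega> (K i)) \<le> y}"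
  proof -
    have "(SUP i\<in>{..<n}. ennreal (u i) * restrict (X \<omega>) ?I (K i)) = (SUP i\<in>{..<n}. ennreal (u i) * X \<omega> (K i))" for \<omega>
      by (rule SUP_cong) (use K in auto)
    then show ?thesis using measurable_space[OF Xm] unfolding A_def by (auto simp del: restrict_apply)
  qed
  moreover have "(\<lambda>\<omega>. restrict (Z \<omega>) ?I) -` A \<inter> space N = {\<omega>\<in>space N. (SUP i\<in>{..<n}. ennreal (u i) * Z \<omega> (K i)) \<le> y}"
  proof -
    have "(SUP i\<in>{..<n}. ennreal (u i) * restrict (Z \<omega>) ?I (K i)) = (SUP i\<in>{..<n}. ennreal (u i) * Z \<omega> (K i))" for \<omega>
      by (rule SUP_cong) (use K in auto)
    then show ?thesis using measurable_space[OF Zm] unfolding A_def by (auto simp del: restrict_apply)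
  qed
  ultimately show ?thesis using measure_distr[OF Xm A] measure_distr[OF Zm A] by simp
qed


section \<open>Laws of Poisson-scaled maxima\<close>

text \<open>All conditions of \<open>crsm_representation\<close> that do not mention
  \<open>X\<close>. The law of the maximum can thus be computed, and the marks constructed, before
  any comparison with \<open>X\<close>.\<close>

definition scaled_indicator_marks ::
  "'n measure \<Rightarrow> ('n \<Rightarrow> nat \<Rightarrow> real) \<Rightarrow> ('n \<Rightarrow> nat \<Rightarrow> 'a::topological_space set \<Rightarrow> ennreal) \<Rightarrow> bool" where
  "scaled_indicator_marks N \<Gamma> Y \<longleftrightarrow>
     prob_space N \<and>
     unit_poisson_points N \<Gamma> \<and>
     (\<forall>i. integrable_rsm N (\<lambda>\<omega>. Y \<omega> i)) \<and>
     (\<forall>i. distr N SM (\<lambda>\<omega>. Y \<omega> i) = distr N SM (\<lambda>\<omega>. Y \<omega> 0)) \<and>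
     prob_space.indep_vars N (\<lambda>_. SM) (\<lambda>i \<omega>. Y \<omega> i) UNIV \<and>
     Y \<in> measurable N (PiM UNIV (\<lambda>_. SM)) \<and>
     prob_space.indep_set N
        (sets (vimage_algebra (space N) \<Gamma> (PiM UNIV (\<lambda>_. borel))))
        (sets (vimage_algebra (space N) Y (PiM UNIV (\<lambda>_. SM)))) \<and>
     (\<forall>i. AE \<omega> in N. \<exists>c F. 0 < c \<and> closed F \<and> F \<noteq> {} \<and> Y \<omega> i = scaled_indicator_sm c F)"

lemma crsm_representation_iff:
  "crsm_representation M X N \<Gamma> Y \<longleftrightarrow> scaled_indicator_marks N \<Gamma> Y \<and>
     equal_in_distribution_K M X N (\<lambda>\<omega> K. SUP i. ennreal (1 / \<Gamma> \<omega> i) * Y \<omega> i K)"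
  unfolding crsm_representation_def scaled_indicator_marks_def by simp

lemma scaled_indicator_marksD:
  assumes "scaled_indicator_marks N \<Gamma> Y"
  shows "prob_space N" "unit_poisson_points N \<Gamma>" "integrable_rsm N (\<lambda>\<omega>. Y \<omega> i)"
    "distr N SM (\<lambda>\<omega>. Y \<omega> i) = distr N SM (\<lambda>\<omega>. Y \<omega> 0)"
    "prob_space.indep_vars N (\<lambda>_. SM) (\<lambda>i \<omega>. Y \<omega> i) UNIV"
    "Y \<in> measurable N (PiM UNIV (\<lambda>_. SM))"
    "prob_space.indep_set N
        (sets (vimage_algebra (space N) \<Gamma> (PiM UNIV (\<lambda>_. borel))))
        (sets (vimage_algebra (space N) Y (PiM UNIV (\<lambda>_. SM))))"
    "AE \<omega> in N. \<exists>c F. 0 < c \<and> closed F \<and> F \<noteq> {} \<and> Y \<omega> i = scaled_indicator_sm c F"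
  using assms unfolding scaled_indicator_marks_def by (elim conjE; simp)+

lemma integrable_rsmD:
  assumes "integrable_rsm M Y"
  shows "random_sup_measure M Y" "compact K \<Longrightarrow> (\<integral>\<^sup>+\<omega>. Y \<omega> K \<partial>M) < \<infinity>"
  using assms unfolding integrable_rsm_def by auto

lemma scaled_indicator_marks_measurable:
  fixes Y :: "'n \<Rightarrow> nat \<Rightarrow> 'a::topological_space set \<Rightarrow> ennreal"
  assumes YN: "scaled_indicator_marks N \<Gamma> Y" and K: "compact K"
  shows "(\<lambda>\<omega>. Y \<omega> i K) \<in> borel_measurable N"
    and "(\<lambda>\<omega>. SUP i. ennreal (1 / \<Gamma> \<omega> i) * Y \<omega> i K) \<in> borel_measurable N"
proof -
  show *: "(\<lambda>\<omega>. Y \<omega> i K) \<in> borel_measurable N" for i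
    using random_sup_measureD(2)[OF integrable_rsmD(1)[OF scaled_indicator_marksD(3)[OF YN]] K] .
  have [measurable]: "(\<lambda>\<omega>. \<Gamma> \<omega> i) \<in> borel_measurable N" for i
    using unit_poisson_pointsD(1)[OF scaled_indicator_marksD(2)[OF YN]]
    by (rule measurable_compose) (rule measurable_component_singleton, simp)
  show "(\<lambda>\<omega>. SUP i. ennreal (1 / \<Gamma> \<omega> i) * Y \<omega> i K) \<in> borel_measurable N"
    using * by (intro borel_measurable_SUP borel_measurable_times_ennreal) auto
qed

text \<open>Moves the point \<open>g\<close> to the right-hand side, which turns a bound on the
  scaled mark into the constraint of the void probability. An infinite \<open>y\<close> needs the
  distinction whether \<open>u\<close> is 0.\<close>

lemma ennreal_scaling_le_iff:
  assumes "0 \<le> u" "0 < t" "0 < g"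
  shows "ennreal u * (ennreal (1 / g) * y) \<le> ennreal t \<longleftrightarrow> ennreal (u / t) * y \<le> ennreal g"
proof (cases y)
  case (real r)
  have "u * (1 / g * r) \<le> t \<longleftrightarrow> u / t * r \<le> g" using assms by (simp add: field_simps)
  then show ?thesis using assms real by (simp add: ennreal_mult[symmetric])
next
  case top
  then show ?thesis using assms by (cases "u = 0") (simp_all add: ennreal_mult_top top_unique)
qed

text \<open>The maximum stays below \<open>t\<close> exactly when no mark satisfies
  \<open>W (Y \<omega> i) > \<Gamma> \<omega> i\<close>, where \<open>W\<close> is the weighted
  maximum over the \<open>K j\<close> divided by \<open>t\<close>. The void probability then yields
  the Frechet form with the mean of the maximum as scale; this mean is finite since a maximum is at
  most a sum.\<close>

lemma scaled_indicator_marks_law: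
  fixes Y :: "'n \<Rightarrow> nat \<Rightarrow> 'a::topological_space set \<Rightarrow> ennreal"
  assumes YN: "scaled_indicator_marks N \<Gamma> Y"
    and K: "\<And>j. j < n \<Longrightarrow> compact (K j)" and u: "\<And>j. j < n \<Longrightarrow> 0 \<le> u j"
  shows "(\<integral>\<^sup>+\<omega>. (SUP j\<in>{..<n::nat}. ennreal (u j) * Y \<omega> 0 (K j)) \<partial>N) < \<infinity>"
    and "0 < t \<Longrightarrow> measure N {\<omega>\<in>space N. (SUP j\<in>{..<n}. ennreal (u j) * (SUP i. ennreal (1 / \<Gamma> \<omega> i) * Y \<omega> i (K j))) \<le> ennreal t}
      = exp (- enn2real (\<integral>\<^sup>+\<omega>. (SUP j\<in>{..<n}. ennreal (u j) * Y \<omega> 0 (K j)) \<partial>N) / t)"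
proof -
  interpret prob_space N by (rule scaled_indicator_marksD(1)[OF YN])
  have [measurable]: "(\<lambda>\<omega>. Y \<omega> i (K j)) \<in> borel_measurable N"
    "(\<lambda>\<omega>. SUP i. ennreal (1 / \<Gamma> \<omega> i) * Y \<omega> i (K j)) \<in> borel_measurable N" if "j \<in> {..<n}" for i j
    using scaled_indicator_marks_measurable[OF YN K] that by auto
  have "(\<integral>\<^sup>+\<omega>. (SUP j\<in>{..<n}. ennreal (u j) * Y \<omega> 0 (K j)) \<partial>N) \<le> (\<integral>\<^sup>+\<omega>. (\<Sum>j<n. ennreal (u j) * Y \<omega> 0 (K j)) \<partial>N)"
  proof (intro nn_integral_mono SUP_least)
    fix \<omega> j assume "j \<in> {..<n}"
    then show "ennreal (u j) * Y \<omega> 0 (K j) \<le> (\<Sum>j<n. ennreal (u j) * Y \<omega> 0 (K j))"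
      by (intro member_le_sum[of j "{..<n}" "\<lambda>j. ennreal (u j) * Y \<omega> 0 (K j)"]) auto
  qed
  also have "\<dots> = (\<Sum>j<n. ennreal (u j) * (\<integral>\<^sup>+\<omega>. Y \<omega> 0 (K j) \<partial>N))"
    by (subst nn_integral_sum) (auto simp: nn_integral_cmult)
  also have "\<dots> < \<infinity>"
    using integrable_rsmD(2)[OF scaled_indicator_marksD(3)[OF YN], of _ 0] K
    by (auto simp: ennreal_mult_less_top)
  finally show fin: "(\<integral>\<^sup>+\<omega>. (SUP j\<in>{..<n}. ennreal (u j) * Y \<omega> 0 (K j)) \<partial>N) < \<infinity>" .
  assume t: "0 < t"
  define W where "W \<phi> = (SUP j\<in>{..<n}. ennreal (u j / t) * \<phi> (K j))" for \<phi> :: "'a set \<Rightarrow> ennreal"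
  have W_m: "W \<in> borel_measurable SM"
    unfolding W_def[abs_def] using K by (intro borel_measurable_SUP borel_measurable_times_ennreal measurable_SM_eval) auto
  have W_int: "(\<integral>\<^sup>+\<omega>. W (Y \<omega> 0) \<partial>N) = ennreal (1 / t) * (\<integral>\<^sup>+\<omega>. (SUP j\<in>{..<n}. ennreal (u j) * Y \<omega> 0 (K j)) \<partial>N)"
  proof -
    have "W (Y \<omega> 0) = ennreal (1 / t) * (SUP j\<in>{..<n}. ennreal (u j) * Y \<omega> 0 (K j))" for \<omega>
      unfolding W_def SUP_mult_left_ennreal
      using u t by (intro SUP_cong) (auto simp: mult.assoc[symmetric] ennreal_mult[symmetric])
    then show ?thesis by (simp add: nn_integral_cmult)
  qed
  have "AE \<omega> in N. (\<omega> \<in> {\<omega>\<in>space N. (SUP j\<in>{..<n}. ennreal (u j) * (SUP i. ennreal (1 / \<Gamma> \<omega> i) * Y \<omega> i (K j))) \<le> ennreal t})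
      = (\<omega> \<in> {\<omega>\<in>space N. \<forall>i. W (Y \<omega> i) \<le> ennreal (\<Gamma> \<omega> i)})"
    using unit_poisson_pointsD(2)[OF scaled_indicator_marksD(2)[OF YN]]
  proof (rule AE_mp, intro AE_I2 impI)
    fix \<omega> assume p: "\<forall>i. 0 < \<Gamma> \<omega> i"
    have "(SUP j\<in>{..<n}. ennreal (u j) * (SUP i. ennreal (1 / \<Gamma> \<omega> i) * Y \<omega> i (K j))) \<le> ennreal t
      \<longleftrightarrow> (\<forall>j<n. \<forall>i. ennreal (u j) * (ennreal (1 / \<Gamma> \<omega> i) * Y \<omega> i (K j)) \<le> ennreal t)"
      by (auto simp: SUP_le_iff SUP_mult_left_ennreal)
    also have "\<dots> \<longleftrightarrow> (\<forall>j<n. \<forall>i. ennreal (u j / t) * Y \<omega> i (K j) \<le> ennreal (\<Gamma> \<omega> i))"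
      using ennreal_scaling_le_iff[OF u t] p by auto
    also have "\<dots> \<longleftrightarrow> (\<forall>i. W (Y \<omega> i) \<le> ennreal (\<Gamma> \<omega> i))"
      unfolding W_def by (auto simp: SUP_le_iff)
    finally show "(\<omega> \<in> {\<omega>\<in>space N. (SUP j\<in>{..<n}. ennreal (u j) * (SUP i. ennreal (1 / \<Gamma> \<omega> i) * Y \<omega> i (K j))) \<le> ennreal t})
      = (\<omega> \<in> {\<omega>\<in>space N. \<forall>i. W (Y \<omega> i) \<le> ennreal (\<Gamma> \<omega> i)})" by simp
  qed
  then have "prob {\<omega>\<in>space N. (SUP j\<in>{..<n}. ennreal (u j) * (SUP i. ennreal (1 / \<Gamma> \<omega> i) * Y \<omega> i (K j))) \<le> ennreal t}
      = prob {\<omega>\<in>space N. \<forall>i. W (Y \<omega> i) \<le> ennreal (\<Gamma> \<omega> i)}"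
  proof (rule finite_measure_eq_AE)
    have "(\<lambda>\<omega>. SUP j\<in>{..<n}. ennreal (u j) * (SUP i. ennreal (1 / \<Gamma> \<omega> i) * Y \<omega> i (K j))) \<in> borel_measurable N"
      by (rule borel_measurable_SUP, simp, rule borel_measurable_times_ennreal, simp,
          rule scaled_indicator_marks_measurable(2)[OF YN K], simp)
    then show "{\<omega>\<in>space N. (SUP j\<in>{..<n}. ennreal (u j) * (SUP i. ennreal (1 / \<Gamma> \<omega> i) * Y \<omega> i (K j))) \<le> ennreal t} \<in> events"
      by measurable
    have [measurable]: "(\<lambda>\<omega>. \<Gamma> \<omega> i) \<in> borel_measurable N" for i
      using unit_poisson_pointsD(1)[OF scaled_indicator_marksD(2)[OF YN]]
      by (rule measurable_compose) (rule measurable_component_singleton, simp)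
    have [measurable]: "(\<lambda>\<omega>. W (Y \<omega> i)) \<in> borel_measurable N" for i
      using integrable_rsmD(1)[OF scaled_indicator_marksD(3)[OF YN], of i] W_m
      unfolding random_sup_measure_def by (rule measurable_compose)
    show "{\<omega>\<in>space N. \<forall>i. W (Y \<omega> i) \<le> ennreal (\<Gamma> \<omega> i)} \<in> events" by measurable
  qed
  also have "\<dots> = exp (- enn2real (\<integral>\<^sup>+\<omega>. W (Y \<omega> 0) \<partial>N))"
    by (rule marked_poisson_void_probability[OF scaled_indicator_marksD(1,2,6,7,5,4)[OF YN] W_m])
      (use fin in \<open>simp add: W_int ennreal_mult_less_top\<close>)
  also have "\<dots> = exp (- enn2real (\<integral>\<^sup>+\<omega>. (SUP j\<in>{..<n}. ennreal (u j) * Y \<omega> 0 (K j)) \<partial>N) / t)"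
    unfolding W_int using t by (simp add: enn2real_mult)
  finally show "prob {\<omega>\<in>space N. (SUP j\<in>{..<n}. ennreal (u j) * (SUP i. ennreal (1 / \<Gamma> \<omega> i) * Y \<omega> i (K j))) \<le> ennreal t}
      = exp (- enn2real (\<integral>\<^sup>+\<omega>. (SUP j\<in>{..<n}. ennreal (u j) * Y \<omega> 0 (K j)) \<partial>N) / t)" .
qed

lemma representation_unit_frechet:
  fixes X :: "'m \<Rightarrow> 'a::topological_space set \<Rightarrow> ennreal" and n :: nat
  assumes rep: "crsm_representation M X N \<Gamma> Y" and X: "random_sup_measure M X"
    and K: "\<And>j. j < n \<Longrightarrow> compact (K j)" and u: "\<And>j. j < n \<Longrightarrow> 0 \<le> u j"
  shows "unit_frechet M (\<lambda>\<omega>. SUP j\<in>{..<n}. ennreal (u j) * X \<omega> (K j))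
    (enn2real (\<integral>\<^sup>+\<omega>. (SUP j\<in>{..<n}. ennreal (u j) * Y \<omega> 0 (K j)) \<partial>N))"
proof -
  have YN: "scaled_indicator_marks N \<Gamma> Y" and eq: "equal_in_distribution_K M X N (\<lambda>\<omega> K. SUP i. ennreal (1 / \<Gamma> \<omega> i) * Y \<omega> i K)"
    using rep unfolding crsm_representation_iff by auto
  have "(\<lambda>\<omega>. SUP j\<in>{..<n}. ennreal (u j) * X \<omega> (K j)) \<in> borel_measurable M"
    using random_sup_measureD(2)[OF X K] by (intro borel_measurable_SUP borel_measurable_times_ennreal) auto
  moreover have "measure M {\<omega>\<in>space M. (SUP j\<in>{..<n}. ennreal (u j) * X \<omega> (K j)) \<le> ennreal t} =
    exp (- enn2real (\<integral>\<^sup>+\<omega>. (SUP j\<in>{..<n}. ennreal (u j) * Y \<omega> 0 (K j)) \<partial>N) / t)" if "0 < t" for t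
    using equal_in_distribution_KD[OF eq random_sup_measureD(2)[OF X] scaled_indicator_marks_measurable(2)[OF YN] K, where u=u and y="ennreal t"]
      scaled_indicator_marks_law(2)[OF YN K u that] by simp
  ultimately show ?thesis unfolding unit_frechet_def by simp
qed

section \<open>The tail dependence functional\<close>

lemma USC_add:
  fixes f g :: "'a::t2_space \<Rightarrow> real"
  assumes f: "f \<in> USC" and g: "g \<in> USC"
  shows "(\<lambda>x. f x + g x) \<in> USC"
proof -
  have "open {x. f x + g x < a}" for a
  proof -
    have "{x. f x + g x < a} = (\<Union>q. {x. f x < q} \<inter> {x. g x < a - q})"
    proof (intro equalityI subsetI)
      fix x assume "x \<in> {x. f x + g x < a}"
      \<comment> \<open>The witness is the midpoint between \<open>f x\<close> and
        \<open>a - g x\<close>.\<close>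
      then have "f x < (f x + a - g x) / 2" "g x < a - (f x + a - g x) / 2" by (auto simp: field_simps)
      then show "x \<in> (\<Union>q. {x. f x < q} \<inter> {x. g x < a - q})" by blast
    qed auto
    moreover have "open {x. f x < q}" "open {x. g x < q}" for q
      using USC_D(3)[OF f] USC_D(3)[OF g] unfolding usc_fun_def by auto
    ultimately show ?thesis by (simp add: open_Int open_UN)
  qed
  then have "usc_fun (\<lambda>x. f x + g x)" unfolding usc_fun_def by simp
  moreover have "bounded (range (\<lambda>x. f x + g x))"
    using bounded_plus_comp[OF USC_D(1)[OF f] USC_D(1)[OF g]] by simp
  moreover have "compact (closure {x. f x + g x \<noteq> 0})"
  proof -
    have "{x. f x + g x \<noteq> 0} \<subseteq> closure {x. f x \<noteq> 0} \<union> closure {x. g x \<noteq> 0}"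
      using closure_subset[of "{x. f x \<noteq> 0}"] closure_subset[of "{x. g x \<noteq> 0}"] by fastforce
    then have "closure {x. f x + g x \<noteq> 0} \<subseteq> closure {x. f x \<noteq> 0} \<union> closure {x. g x \<noteq> 0}"
      by (intro closure_minimal closed_Un) auto
    then show ?thesis
      using compact_Int_closed[OF compact_Un[OF USC_D(4)[OF f] USC_D(4)[OF g]] closed_closure[of "{x. f x + g x \<noteq> 0}"]]
      by (simp add: Int_absorb1)
  qed
  ultimately show ?thesis using USC_D(2)[OF f] USC_D(2)[OF g] unfolding USC_def by simp
qed

lemma scaled_indicator_USC:
  fixes K :: "'a::t2_space set"
  assumes "compact K" "0 \<le> v" shows "(\<lambda>x. v * indicator K x) \<in> USC"
proof (rule finite_range_USC)
  show "finite (range (\<lambda>x. v * indicator K x))"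
    by (rule finite_subset[of _ "{0, v}"]) (auto simp: indicator_def)
  show "0 \<le> v * indicator K x" for x using assms by simp
  fix q :: real assume q: "0 < q"
  have "{x. q \<le> v * indicator K x} = (if q \<le> v then K else {})"
    using q by (auto simp: indicator_def)
  then show "compact {x. q \<le> v * indicator K x}" using assms by simp
qed

text \<open>With \<open>C\<close> a bound of \<open>f\<close> and \<open>K\<close> the closure of
  its support, one term majorizes all levels at once, uniformly in the sup-measure. It bounds the
  scales of the finite maxima and the means of extremal integrals.\<close>

lemma USC_superlevel_bound:
  fixes f :: "'a::t2_space \<Rightarrow> real"
  assumes f: "f \<in> USC"
  obtains C K where "0 \<le> C" "compact K"
    "\<And>\<phi> q. sup_measure \<phi> \<Longrightarrow> 0 < q \<Longrightarrow> ennreal q * \<phi> {x. q \<le> f x} \<le> ennreal C * \<phi> K"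
proof -
  obtain C where C: "\<And>x. f x \<le> C" using USC_D(1)[OF f] by (auto simp: bounded_real intro: order_trans[OF abs_ge_self])
  show ?thesis
  proof (rule that[of "max 0 C" "closure {x. f x \<noteq> 0}"])
    show "compact (closure {x. f x \<noteq> 0})" by (rule USC_D(4)[OF f])
    fix \<phi> :: "'a set \<Rightarrow> ennreal" and q :: real assume \<phi>: "sup_measure \<phi>" and q: "0 < q"
    show "ennreal q * \<phi> {x. q \<le> f x} \<le> ennreal (max 0 C) * \<phi> (closure {x. f x \<noteq> 0})"
    proof (cases "{x. q \<le> f x} = {}")
      case True then show ?thesis using sup_measure_empty[OF \<phi>] by (simp only: True mult_zero_right zero_le)
    next
      case False
      then obtain x where "q \<le> f x" by auto
      then have "ennreal q \<le> ennreal (max 0 C)" using C[of x] by (intro ennreal_leI) auto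
      moreover have "\<phi> {x. q \<le> f x} \<le> \<phi> (closure {x. f x \<noteq> 0})"
        using q closure_subset[of "{x. f x \<noteq> 0}"] by (intro sup_measure_mono[OF \<phi>]) force
      ultimately show ?thesis by (intro mult_mono) auto
    qed
  qed simp
qed

lemma extremal_integral_SUP_lessThan:
  assumes lc: "locally_compact_space (euclidean :: 'a::{t2_space, second_countable_topology} topology)"
    and \<phi>: "sup_measure \<phi>" and f: "\<And>x. 0 \<le> f x"
  shows "extremal_integral f \<phi> = (SUP n. SUP i\<in>{..<n}. ennreal (pos_rat i) * \<phi> {x::'a::{t2_space, second_countable_topology}. pos_rat i \<le> f x})"
  unfolding extremal_integral_eq_SUP_superlevel[OF lc \<phi> f]
  by (rule antisym; intro SUP_least) (auto intro: SUP_upper2[of "Suc _"] SUP_upper)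

text \<open>The defining supremum runs over all compacts; the form with rational superlevel sets
  replaces it by countably many measurable evaluations.\<close>

lemma extremal_integral_measurable:
  fixes X :: "'m \<Rightarrow> 'a::{t2_space, second_countable_topology} set \<Rightarrow> ennreal"
  assumes lc: "locally_compact_space (euclidean :: 'a topology)"
    and X: "random_sup_measure M X" and f: "f \<in> USC"
  shows "(\<lambda>\<omega>. extremal_integral f (X \<omega>)) \<in> borel_measurable M"
proof -
  have "(\<lambda>\<omega>. SUP n. ennreal (pos_rat n) * X \<omega> {x. pos_rat n \<le> f x}) \<in> borel_measurable M"
    using random_sup_measureD(2)[OF X compact_superlevel[OF f pos_rat_pos]]
    by (intro borel_measurable_SUP borel_measurable_times_ennreal) auto
  then show ?thesis
    by (rule measurable_cong[THEN iffD1, rotated])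
      (rule extremal_integral_eq_SUP_superlevel[OF lc random_sup_measureD(1)[OF X] USC_D(2)[OF f], symmetric])
qed

text \<open>Max-stability provides Frechet laws for finite maxima only. The extremal integral is
  their increasing limit over rational levels, and a multiple of some \<open>X K\<close> dominates
  them, so it is Frechet too and its scale is the limit of theirs. In particular
  \<open>tail_dep\<close> is a genuine scale on \<open>USC\<close>.\<close>

lemma max_stable_tail_dep:
  fixes X :: "'m \<Rightarrow> 'a::{t2_space, second_countable_topology} set \<Rightarrow> ennreal"
  assumes lc: "locally_compact_space (euclidean :: 'a topology)" and M: "prob_space M"
    and X: "random_sup_measure M X" and ms: "max_stable M X" and f: "f \<in> USC"
    and a: "\<And>n. unit_frechet M (\<lambda>\<omega>. SUP i\<in>{..<n}. ennreal (pos_rat i) * X \<omega> {x. pos_rat i \<le> f x}) (a n)"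
  shows "a \<longlonglongrightarrow> tail_dep M X f"
proof -
  interpret prob_space M by fact
  let ?V = "\<lambda>n \<omega>. SUP i\<in>{..<n}. ennreal (pos_rat i) * X \<omega> {x. pos_rat i \<le> f x}"
  obtain C K where CK: "0 \<le> C" "compact K"
    "\<And>\<phi> q. sup_measure \<phi> \<Longrightarrow> 0 < q \<Longrightarrow> ennreal q * \<phi> {x. q \<le> f x} \<le> ennreal C * \<phi> K"
    by (rule USC_superlevel_bound[OF f], rule that)
  obtain b where b: "unit_frechet M (\<lambda>\<omega>. SUP i\<in>{..<1::nat}. ennreal C * X \<omega> K) b"
    using ms[unfolded max_stable_def, rule_format, of 1 "\<lambda>_. K" "\<lambda>_. C"] CK by auto
  have "a n \<le> b" for n
    by (rule unit_frechet_mono[OF a b])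
      (use CK(3)[OF random_sup_measureD(1)[OF X] pos_rat_pos] in \<open>auto simp: lessThan_Suc intro!: SUP_least\<close>)
  then obtain l where l: "a \<longlonglongrightarrow> l" "unit_frechet M (\<lambda>\<omega>. SUP n. ?V n \<omega>) l"
    using unit_frechet_SUP[of ?V a b] a by (auto simp: incseq_def intro!: SUP_subset_mono)
  have "unit_frechet M (\<lambda>\<omega>. extremal_integral f (X \<omega>)) l"
    using l(2) unit_frechet_cong[of M "\<lambda>\<omega>. extremal_integral f (X \<omega>)" "\<lambda>\<omega>. SUP n. ?V n \<omega>" l]
      extremal_integral_SUP_lessThan[OF lc random_sup_measureD(1)[OF X] USC_D(2)[OF f]] by simp
  then have "tail_dep M X f = l" unfolding tail_dep_def by (rule frechet_scale_eq)
  then show ?thesis using l(1) by simp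
qed

lemma representation_max_stable:
  fixes X :: "'m \<Rightarrow> 'a::topological_space set \<Rightarrow> ennreal"
  assumes rep: "crsm_representation M X N \<Gamma> Y" and X: "random_sup_measure M X"
  shows "max_stable M X"
  unfolding max_stable_def
proof (intro allI impI)
  fix n :: nat and K :: "nat \<Rightarrow> 'a set" and u assume *: "\<forall>i<n. compact (K i) \<and> (0::real) \<le> u i"
  show "\<exists>a. unit_frechet M (\<lambda>\<omega>. SUP i\<in>{..<n}. ennreal (u i) * X \<omega> (K i)) a"
    by (rule exI, rule representation_unit_frechet[OF rep X]) (use * in auto)
qed

text \<open>For finite maxima the scale is the mean over the marks. Convergence of the scales on the
  side of \<open>X\<close> and monotone convergence on the side of the marks extend this to the
  extremal integral.\<close>

lemma representation_tail_dep:
  fixes X :: "'m \<Rightarrow> 'a::{t2_space, second_countable_topology} set \<Rightarrow> ennreal"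
  assumes lc: "locally_compact_space (euclidean :: 'a topology)" and M: "prob_space M"
    and X: "random_sup_measure M X" and rep: "crsm_representation M X N \<Gamma> Y" and f: "f \<in> USC"
  shows "ennreal (tail_dep M X f) = (\<integral>\<^sup>+\<omega>. extremal_integral f (Y \<omega> 0) \<partial>N)"
proof -
  have YN: "scaled_indicator_marks N \<Gamma> Y" using rep unfolding crsm_representation_iff by simp
  note Y = integrable_rsmD(1)[OF scaled_indicator_marksD(3)[OF YN, of 0]]
  let ?W = "\<lambda>n \<omega>. SUP i\<in>{..<n}. ennreal (pos_rat i) * Y \<omega> 0 {x. pos_rat i \<le> f x}"
  have cK: "compact {x. pos_rat i \<le> f x}" for i by (rule compact_superlevel[OF f pos_rat_pos])
  have "(\<lambda>n. enn2real (\<integral>\<^sup>+\<omega>. ?W n \<omega> \<partial>N)) \<longlonglongrightarrow> tail_dep M X f"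
    by (rule max_stable_tail_dep[OF lc M X representation_max_stable[OF rep X] f])
      (rule representation_unit_frechet[OF rep X], use cK pos_rat_pos in \<open>auto simp: less_imp_le\<close>)
  then have "(\<lambda>n. ennreal (enn2real (\<integral>\<^sup>+\<omega>. ?W n \<omega> \<partial>N))) \<longlonglongrightarrow> ennreal (tail_dep M X f)"
    by (rule tendsto_ennrealI)
  moreover have "ennreal (enn2real (\<integral>\<^sup>+\<omega>. ?W n \<omega> \<partial>N)) = (\<integral>\<^sup>+\<omega>. ?W n \<omega> \<partial>N)" for n
    using scaled_indicator_marks_law(1)[OF YN, of n "\<lambda>i. {x. pos_rat i \<le> f x}" pos_rat] cK pos_rat_pos
    by (simp add: less_imp_le less_top)
  moreover have "(\<lambda>n. \<integral>\<^sup>+\<omega>. ?W n \<omega> \<partial>N) \<longlonglongrightarrow> (\<integral>\<^sup>+\<omega>. extremal_integral f (Y \<omega> 0) \<partial>N)"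
  proof -
    have inc: "incseq ?W" by (auto simp: incseq_def le_fun_def intro!: SUP_subset_mono)
    have meas: "?W n \<in> borel_measurable N" for n
      using random_sup_measureD(2)[OF Y cK] by (intro borel_measurable_SUP borel_measurable_times_ennreal) auto
    have "(\<integral>\<^sup>+\<omega>. extremal_integral f (Y \<omega> 0) \<partial>N) = (\<integral>\<^sup>+\<omega>. (SUP n. ?W n \<omega>) \<partial>N)"
      by (rule nn_integral_cong) (rule extremal_integral_SUP_lessThan[OF lc random_sup_measureD(1)[OF Y] USC_D(2)[OF f]])
    also have "\<dots> = (SUP n. \<integral>\<^sup>+\<omega>. ?W n \<omega> \<partial>N)" by (rule nn_integral_monotone_convergence_SUP[OF inc meas])
    finally have *: "(\<integral>\<^sup>+\<omega>. extremal_integral f (Y \<omega> 0) \<partial>N) = (SUP n. \<integral>\<^sup>+\<omega>. ?W n \<omega> \<partial>N)" .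
    have "incseq (\<lambda>n. \<integral>\<^sup>+\<omega>. ?W n \<omega> \<partial>N)"
      using inc by (auto simp: incseq_def le_fun_def intro!: nn_integral_mono)
    then show ?thesis unfolding * by (rule LIMSEQ_SUP)
  qed
  ultimately show ?thesis by (auto intro: LIMSEQ_unique)
qed

lemma marks_comonotone_additive:
  fixes Y :: "'n \<Rightarrow> 'a::{t2_space, second_countable_topology} set \<Rightarrow> ennreal"
  assumes lc: "locally_compact_space (euclidean :: 'a topology)"
    and Y: "random_sup_measure N Y" and AE: "AE \<omega> in N. \<exists>c F. 0 < c \<and> closed F \<and> F \<noteq> {} \<and> Y \<omega> = scaled_indicator_sm c F"
    and f: "f \<in> USC" and g: "g \<in> USC" and co: "\<And>x y. 0 \<le> (f x - f y) * (g x - g y)"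
  shows "(\<integral>\<^sup>+\<omega>. extremal_integral (\<lambda>x. f x + g x) (Y \<omega>) \<partial>N) =
    (\<integral>\<^sup>+\<omega>. extremal_integral f (Y \<omega>) \<partial>N) + (\<integral>\<^sup>+\<omega>. extremal_integral g (Y \<omega>) \<partial>N)"
proof -
  have "(\<integral>\<^sup>+\<omega>. extremal_integral (\<lambda>x. f x + g x) (Y \<omega>) \<partial>N) = (\<integral>\<^sup>+\<omega>. extremal_integral f (Y \<omega>) + extremal_integral g (Y \<omega>) \<partial>N)"
  proof (rule nn_integral_cong_AE, rule AE_mp[OF AE], intro AE_I2 impI)
    fix \<omega> assume "\<exists>c F. 0 < c \<and> closed F \<and> F \<noteq> {} \<and> Y \<omega> = scaled_indicator_sm c F"
    then obtain c F where "closed F" "Y \<omega> = scaled_indicator_sm c F" by blast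
    then show "extremal_integral (\<lambda>x. f x + g x) (Y \<omega>) = extremal_integral f (Y \<omega>) + extremal_integral g (Y \<omega>)"
      using extremal_integral_scaled_indicator_comonotone[OF lc _ USC_D(2)[OF f] USC_D(2)[OF g] co] by simp
  qed
  also have "\<dots> = (\<integral>\<^sup>+\<omega>. extremal_integral f (Y \<omega>) \<partial>N) + (\<integral>\<^sup>+\<omega>. extremal_integral g (Y \<omega>) \<partial>N)"
    by (intro nn_integral_add extremal_integral_measurable[OF lc Y] f g)
  finally show ?thesis .
qed

lemma representation_imp_CRSM:
  fixes X :: "'m \<Rightarrow> 'a::{t2_space, second_countable_topology} set \<Rightarrow> ennreal"
  assumes lc: "locally_compact_space (euclidean :: 'a topology)" and M: "prob_space M"
    and X: "random_sup_measure M X" and rep: "crsm_representation M X N \<Gamma> Y"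
  shows "CRSM M X" and "compact K \<Longrightarrow> ennreal (ext_coeff M X K) = (\<integral>\<^sup>+ \<omega>. Y \<omega> 0 K \<partial>N)"
proof -
  have YN: "scaled_indicator_marks N \<Gamma> Y" using rep unfolding crsm_representation_iff by simp
  note Y = integrable_rsmD(1)[OF scaled_indicator_marksD(3)[OF YN, of 0]]
  note td = representation_tail_dep[OF lc M X rep]
  \<comment> \<open>The embedding \<open>ennreal\<close> sends negative reals to 0, so the equations
    for \<open>tail_dep\<close> return to the reals only once nonnegativity is known; it holds for
    limits of scales.\<close>
  have td0: "0 \<le> tail_dep M X f" if f: "f \<in> USC" for f
  proof -
    have ms: "\<exists>a. unit_frechet M (\<lambda>\<omega>. SUP i\<in>{..<n}. ennreal (pos_rat i) * X \<omega> {x. pos_rat i \<le> f x}) a" for n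
      using representation_max_stable[OF rep X, unfolded max_stable_def, rule_format, of n "\<lambda>i. {x. pos_rat i \<le> f x}" pos_rat]
        compact_superlevel[OF f pos_rat_pos] pos_rat_pos by (simp add: less_imp_le)
    then have "\<exists>a. \<forall>n. unit_frechet M (\<lambda>\<omega>. SUP i\<in>{..<n}. ennreal (pos_rat i) * X \<omega> {x. pos_rat i \<le> f x}) (a n)"
      by (intro choice allI)
    then obtain a where a: "\<And>n. unit_frechet M (\<lambda>\<omega>. SUP i\<in>{..<n}. ennreal (pos_rat i) * X \<omega> {x. pos_rat i \<le> f x}) (a n)"
      by (elim exE) (rule that, rule spec)
    have "\<And>n. 0 \<le> a n" using a unfolding unit_frechet_def by auto
    with max_stable_tail_dep[OF lc M X representation_max_stable[OF rep X] f a] show ?thesis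
      by (intro LIMSEQ_le_const) auto
  qed
  show "CRSM M X"
    unfolding CRSM_def
  proof (intro conjI ballI impI)
    show "max_stable M X" by (rule representation_max_stable[OF rep X])
    fix f g :: "'a \<Rightarrow> real" assume f: "f \<in> USC" and g: "g \<in> USC" and co: "\<forall>x y. 0 \<le> (f x - f y) * (g x - g y)"
    have "ennreal (tail_dep M X (\<lambda>x. f x + g x)) = ennreal (tail_dep M X f) + ennreal (tail_dep M X g)"
      unfolding td[OF f] td[OF g] td[OF USC_add[OF f g]]
      by (rule marks_comonotone_additive[OF lc Y scaled_indicator_marksD(8)[OF YN] f g]) (use co in auto)
    also have "\<dots> = ennreal (tail_dep M X f + tail_dep M X g)" using td0 f g by simp
    finally show "tail_dep M X (\<lambda>x. f x + g x) = tail_dep M X f + tail_dep M X g"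
      using td0 f g USC_add[OF f g] by (subst (asm) ennreal_inj) auto
  qed
  assume K: "compact K"
  have "indicator K = (\<lambda>x. 1 * indicator K x :: real)" by simp
  then have KU: "(indicator K :: 'a \<Rightarrow> real) \<in> USC" using scaled_indicator_USC[OF K, of 1] by simp
  have "ennreal (ext_coeff M X K) = (\<integral>\<^sup>+ \<omega>. extremal_integral (indicator K) (Y \<omega> 0) \<partial>N)"
    unfolding ext_coeff_def by (rule td[OF KU])
  also have "\<dots> = (\<integral>\<^sup>+ \<omega>. Y \<omega> 0 K \<partial>N)"
    by (rule nn_integral_cong) (rule extremal_integral_indicator[OF lc random_sup_measureD(1)[OF Y]])
  finally show "ennreal (ext_coeff M X K) = (\<integral>\<^sup>+ \<omega>. Y \<omega> 0 K \<partial>N)" .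
qed

subsection \<open>Existence of the Poisson process\<close>

lemma indep_vars_PiM_coordinates:
  assumes M: "\<And>i. prob_space (M i)"
  shows "prob_space.indep_vars (PiM UNIV M) M (\<lambda>i x. x i) UNIV"
proof -
  interpret prob_space "PiM UNIV M" by (rule prob_space_PiM[OF M])
  have "distr (PiM UNIV M) (PiM UNIV M) (\<lambda>x. \<lambda>i\<in>UNIV. x i) = PiM UNIV (\<lambda>i. distr (PiM UNIV M) (M i) (\<lambda>x. x i))"
    using M by (simp add: distr_PiM_component distr_id restrict_UNIV)
  then show ?thesis by (subst indep_vars_iff_distr_eq_PiM) auto
qed

text \<open>Serves to show that two positions almost surely differ, by measuring the diagonal in the
  product of their laws.\<close>

lemma (in prob_space) indep_vars_pair_distr:
  assumes ind: "indep_vars M' X I" and ij: "i \<in> I" "j \<in> I" "i \<noteq> j"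
  shows "distr M (M' i \<Otimes>\<^sub>M M' j) (\<lambda>\<omega>. (X i \<omega>, X j \<omega>)) = distr M (M' i) (X i) \<Otimes>\<^sub>M distr M (M' j) (X j)"
proof (rule pair_measure_eqI[symmetric])
  have Xm[measurable]: "X i \<in> measurable M (M' i)" "X j \<in> measurable M (M' j)" using ind ij unfolding indep_vars_def by auto
  interpret DX: prob_space "distr M (M' i) (X i)" by (rule prob_space_distr) simp
  interpret DY: prob_space "distr M (M' j) (X j)" by (rule prob_space_distr) simp
  show "sigma_finite_measure (distr M (M' i) (X i))" "sigma_finite_measure (distr M (M' j) (X j))" ..
  show "sets (distr M (M' i) (X i) \<Otimes>\<^sub>M distr M (M' j) (X j)) = sets (distr M (M' i \<Otimes>\<^sub>M M' j) (\<lambda>\<omega>. (X i \<omega>, X j \<omega>)))"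
    by (simp cong: sets_pair_measure_cong)
  fix A B assume "A \<in> sets (distr M (M' i) (X i))" "B \<in> sets (distr M (M' j) (X j))"
  then have A: "A \<in> sets (M' i)" and B: "B \<in> sets (M' j)" by auto
  define C where "C k = (if k = i then A else B)" for k
  have "prob (\<Inter>k\<in>{i, j}. X k -` C k \<inter> space M) = (\<Prod>k\<in>{i, j}. prob (X k -` C k \<inter> space M))"
    by (rule indep_varsD[OF ind]) (use ij A B in \<open>auto simp: C_def\<close>)
  then have "prob ((X i -` A \<inter> space M) \<inter> (X j -` B \<inter> space M)) = prob (X i -` A \<inter> space M) * prob (X j -` B \<inter> space M)"
    using ij by (simp add: C_def)
  moreover have "(X i -` A \<inter> space M) \<inter> (X j -` B \<inter> space M) = (\<lambda>\<omega>. (X i \<omega>, X j \<omega>)) -` (A \<times> B) \<inter> space M" by auto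
  ultimately show "emeasure (distr M (M' i) (X i)) A * emeasure (distr M (M' j) (X j)) B = emeasure (distr M (M' i \<Otimes>\<^sub>M M' j) (\<lambda>\<omega>. (X i \<omega>, X j \<omega>))) (A \<times> B)"
    using A B Xm by (simp add: emeasure_distr emeasure_eq_measure ennreal_mult)
qed

section \<open>Characterizing the process by its counts\<close>

text \<open>The count is read off a series of indicators. If infinitely many points fall into
  \<open>B\<close>, the series is infinite and \<open>enn2real\<close> returns 0, which is also the
  cardinality assigned to an infinite set.\<close>

lemma measurable_card_points:
  fixes B :: "real set"
  assumes B: "B \<in> sets borel"
  shows "(\<lambda>\<gamma>. card {i::nat. \<gamma> i \<in> B}) \<in> measurable (PiM UNIV (\<lambda>_. borel)) (count_space UNIV)"
proof -
  have [measurable]: "(\<lambda>\<gamma>. indicator B (\<gamma> i) :: ennreal) \<in> borel_measurable (PiM UNIV (\<lambda>_::nat. borel))" for i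
  proof -
    have "(\<lambda>\<gamma>::nat \<Rightarrow> real. \<gamma> i) \<in> borel_measurable (PiM UNIV (\<lambda>_::nat. borel))" by (rule measurable_component_singleton) simp
    then show ?thesis using B by measurable
  qed
  have "card {i::nat. \<gamma> i \<in> B} = nat \<lfloor>enn2real (\<Sum>i. indicator B (\<gamma> i))\<rfloor>" for \<gamma> :: "nat \<Rightarrow> real"
  proof -
    have "(\<Sum>i. indicator B (\<gamma> i)) = (\<Sum>i. indicator {i. \<gamma> i \<in> B} i :: ennreal)"
      by (simp add: indicator_def)
    also have "\<dots> = (\<integral>\<^sup>+i. indicator {i. \<gamma> i \<in> B} i \<partial>count_space UNIV)"
      by (rule nn_integral_count_space_nat[symmetric])
    also have "\<dots> = emeasure (count_space UNIV) {i. \<gamma> i \<in> B}" by simp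
    finally have *: "(\<Sum>i. indicator B (\<gamma> i)) = emeasure (count_space UNIV) {i. \<gamma> i \<in> B}" .
    show ?thesis
    proof (cases "finite {i. \<gamma> i \<in> B}")
      case True then show ?thesis unfolding * by (simp add: emeasure_count_space)
    next
      case False then show ?thesis unfolding * by (simp add: emeasure_count_space)
    qed
  qed
  then show ?thesis by simp
qed

text \<open>Point probabilities of count vectors are what generating functions deliver. They contain
  the marginal laws, and they give independence because singletons generate the discrete
  sigma-algebra on \<open>nat\<close>.\<close>

lemma unit_poisson_pointsI:
  assumes N: "prob_space N" and \<Gamma>: "\<Gamma> \<in> measurable N (PiM UNIV (\<lambda>_. borel))"
    and AE: "AE \<omega> in N. strict_mono (\<Gamma> \<omega>) \<and> 0 < \<Gamma> \<omega> 0 \<and> filterlim (\<Gamma> \<omega>) at_top sequentially"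
    and joint: "\<And>(n::nat) (B :: nat \<Rightarrow> real set) m. (\<And>j. j < n \<Longrightarrow> B j \<in> sets borel \<and> bounded (B j) \<and> B j \<subseteq> {0<..}) \<Longrightarrow>
      disjoint_family_on B {..<n} \<Longrightarrow>
      measure N {\<omega>\<in>space N. \<forall>j<n. card {i. \<Gamma> \<omega> i \<in> B j} = m j} =
      (\<Prod>j<n. exp (- measure lborel (B j)) * measure lborel (B j) ^ m j / fact (m j))"
  shows "unit_poisson_points N \<Gamma>"
  unfolding unit_poisson_points_def
proof (intro conjI allI impI)
  interpret prob_space N by fact
  fix n :: nat and B :: "nat \<Rightarrow> real set"
  assume *: "(\<forall>j<n. B j \<in> sets borel \<and> bounded (B j) \<and> B j \<subseteq> {0<..}) \<and> disjoint_family_on B {..<n}"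
  define c where "c j \<omega> = card {i. \<Gamma> \<omega> i \<in> B j}" for j \<omega>
  define p where "p j k = exp (- measure lborel (B j)) * measure lborel (B j) ^ k / fact k" for j k
  have cm: "c j \<in> measurable N (count_space UNIV)" if "j < n" for j
    unfolding c_def using measurable_compose[OF \<Gamma> measurable_card_points] * that by blast
  have sub: "prob {\<omega>\<in>space N. \<forall>j\<in>J. c j \<omega> = m j} = (\<Prod>j\<in>J. p j (m j))" if J: "J \<subseteq> {..<n}" for J m
  proof -
    \<comment> \<open>Indices outside \<open>J\<close> get the empty set and the count 0. Their
      factor is \<open>exp 0 * 0 ^ 0 / fact 0 = 1\<close>, so the joint law for \<open>n\<close>
      sets covers every subfamily.\<close>
    define B' where "B' j = (if j \<in> J then B j else {})" for j
    define m' where "m' j = (if j \<in> J then m j else 0)" for j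
    have "measure N {\<omega>\<in>space N. \<forall>j<n. card {i. \<Gamma> \<omega> i \<in> B' j} = m' j} =
      (\<Prod>j<n. exp (- measure lborel (B' j)) * measure lborel (B' j) ^ m' j / fact (m' j))"
      by (rule joint) (use * in \<open>auto simp: B'_def disjoint_family_on_def\<close>)
    moreover have "{\<omega>\<in>space N. \<forall>j<n. card {i. \<Gamma> \<omega> i \<in> B' j} = m' j} = {\<omega>\<in>space N. \<forall>j\<in>J. c j \<omega> = m j}"
      using J unfolding B'_def m'_def c_def by auto
    moreover have "(\<Prod>j<n. exp (- measure lborel (B' j)) * measure lborel (B' j) ^ m' j / fact (m' j)) = (\<Prod>j\<in>J. p j (m j))"
      by (rule prod.mono_neutral_cong_right) (use J in \<open>auto simp: B'_def m'_def p_def\<close>)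
    ultimately show ?thesis by simp
  qed
  have single: "prob {\<omega>\<in>space N. c j \<omega> = k} = p j k" if "j < n" for j k
    using sub[of "{j}" "\<lambda>_. k"] that by simp
  show "measure N {\<omega>\<in>space N. card {i. \<Gamma> \<omega> i \<in> B j} = k} = exp (- measure lborel (B j)) * measure lborel (B j) ^ k / fact k" if "j < n" for j k
    using single[OF that] unfolding c_def p_def .
  show "indep_vars (\<lambda>_. count_space UNIV) (\<lambda>j \<omega>. card {i. \<Gamma> \<omega> i \<in> B j}) {..<n}"
  proof (cases "n = 0")
    case True then show ?thesis by (simp add: indep_vars_def indep_sets_def)
  next
    case False
    \<comment> \<open>Adding \<open>{}\<close> closes the singletons under intersection, and
      \<open>UNIV\<close> is the total space required of a generator.\<close>
    define E where "E = insert {} (insert UNIV (range (\<lambda>k::nat. {k})))"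
    have "indep_vars (\<lambda>_. count_space UNIV) c {..<n}"
    proof (subst indep_vars_finite[where E="\<lambda>_. E"])
      show "{..<n} \<noteq> {}" "finite {..<n}" using False by auto
      show "c j \<in> measurable N (count_space UNIV)" if "j \<in> {..<n}" for j using cm that by simp
      show "Int_stable E" for j :: nat unfolding E_def Int_stable_def by auto
      show "space (count_space UNIV) \<in> E" "E \<subseteq> Pow (space (count_space UNIV))" for j :: nat unfolding E_def by auto
      show "sets (count_space UNIV) = sigma_sets (space (count_space UNIV)) E" for j :: nat
      proof -
        have "A \<in> sigma_sets UNIV E" for A :: "nat set"
        proof -
          have "(\<Union>k\<in>A. {k}) \<in> sigma_sets UNIV E"
            by (rule sigma_sets_UNION) (auto simp: E_def intro!: sigma_sets.Basic countable_subset[OF subset_UNIV])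
          then show ?thesis by simp
        qed
        then show ?thesis by auto
      qed
      show "\<forall>A\<in>{..<n} \<rightarrow> E. prob (\<Inter>j\<in>{..<n}. c j -` A j \<inter> space N) = (\<Prod>j\<in>{..<n}. prob (c j -` A j \<inter> space N))"
      proof
        fix A assume A: "A \<in> {..<n} \<rightarrow> E"
        show "prob (\<Inter>j\<in>{..<n}. c j -` A j \<inter> space N) = (\<Prod>j\<in>{..<n}. prob (c j -` A j \<inter> space N))"
        proof (cases "\<exists>j<n. A j = {}")
          case True
          then obtain j where j: "j < n" "A j = {}" by auto
          then have "(\<Inter>j\<in>{..<n}. c j -` A j \<inter> space N) = {}" by force
          moreover have "(\<Prod>j\<in>{..<n}. prob (c j -` A j \<inter> space N)) = 0"
            using j by (intro prod_zero) (auto intro!: bexI[of _ j])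
          ultimately show ?thesis by simp
        next
          case False
          define J where "J = {j. j < n \<and> A j \<noteq> UNIV}"
          have "\<exists>k. A j = {k}" if "j \<in> J" for j
          proof -
            have "A j \<in> E" using funcset_mem[OF A, of j] that unfolding J_def by simp
            moreover have "A j \<noteq> {}" "A j \<noteq> UNIV" using that False unfolding J_def by auto
            ultimately show ?thesis unfolding E_def by auto
          qed
          then obtain m where m: "\<And>j. j \<in> J \<Longrightarrow> A j = {m j}" by metis
          have J: "J \<subseteq> {..<n}" unfolding J_def by auto
          have "(\<Inter>j\<in>{..<n}. c j -` A j \<inter> space N) = {\<omega>\<in>space N. \<forall>j\<in>J. c j \<omega> = m j}"
          proof (intro equalityI subsetI)
            fix \<omega> assume "\<omega> \<in> (\<Inter>j\<in>{..<n}. c j -` A j \<inter> space N)"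
            then show "\<omega> \<in> {\<omega>\<in>space N. \<forall>j\<in>J. c j \<omega> = m j}"
              using m J \<open>n \<noteq> 0\<close> by fastforce
          next
            fix \<omega> assume \<omega>: "\<omega> \<in> {\<omega>\<in>space N. \<forall>j\<in>J. c j \<omega> = m j}"
            have "c j \<omega> \<in> A j" if "j < n" for j
              using \<omega> m[of j] that unfolding J_def by (cases "A j = UNIV") auto
            then show "\<omega> \<in> (\<Inter>j\<in>{..<n}. c j -` A j \<inter> space N)" using \<omega> by auto
          qed
          then have "prob (\<Inter>j\<in>{..<n}. c j -` A j \<inter> space N) = (\<Prod>j\<in>J. p j (m j))" using sub[OF J] by simp
          also have "\<dots> = (\<Prod>j\<in>{..<n}. prob (c j -` A j \<inter> space N))"
          proof (rule prod.mono_neutral_cong_left)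
            show "\<forall>i\<in>{..<n} - J. prob (c i -` A i \<inter> space N) = 1"
              using prob_space unfolding J_def by auto
            fix j assume j: "j \<in> J"
            have "c j -` A j \<inter> space N = {\<omega>\<in>space N. c j \<omega> = m j}" using m[OF j] by auto
            then show "p j (m j) = prob (c j -` A j \<inter> space N)" using single j J by auto
          qed (use J in auto)
          finally show ?thesis .
        qed
      qed
    qed
    then show ?thesis unfolding c_def[abs_def] .
  qed
qed (fact \<Gamma> AE)+

lemma unit_poisson_points_joint_law:
  assumes N: "prob_space N" and \<Gamma>: "unit_poisson_points N \<Gamma>"
    and B: "\<And>j. j < n \<Longrightarrow> B j \<in> sets borel \<and> bounded (B j) \<and> B j \<subseteq> {0<..}" "disjoint_family_on B {..<n::nat}"
  shows "measure N {\<omega>\<in>space N. \<forall>j<n. card {i. \<Gamma> \<omega> i \<in> B j} = m j} =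
      (\<Prod>j<n. exp (- measure lborel (B j)) * measure lborel (B j) ^ m j / fact (m j))"
proof (rule prob_space.poisson_joint_law_of_pgf[OF N])
  show "(\<lambda>\<omega>. card {i. \<Gamma> \<omega> i \<in> B j}) \<in> measurable N (count_space UNIV)" if "j < n" for j
    by (rule unit_poisson_points_pgf(2)[OF N \<Gamma> B, of "\<lambda>_. 1"]) (use that in auto)
  fix s :: "nat \<Rightarrow> real" assume s: "\<And>j. 0 \<le> s j \<and> s j \<le> 1"
  show "(\<integral>\<omega>. (\<Prod>j<n. s j ^ card {i. \<Gamma> \<omega> i \<in> B j}) \<partial>N) = (\<Prod>j<n. exp (- measure lborel (B j) * (1 - s j)))"
    using unit_poisson_points_pgf(1)[OF N \<Gamma> B s] by (simp add: exp_sum[symmetric] sum_negf)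
qed

text \<open>Being a unit Poisson process is a property of the law on sequence space. This moves the
  process from the space where it is built to the space on which the representation is
  stated.\<close>

lemma unit_poisson_points_of_law:
  assumes M: "prob_space M" and \<Delta>: "unit_poisson_points M \<Delta>"
    and N: "prob_space N" and \<Gamma>: "\<Gamma> \<in> measurable N (PiM UNIV (\<lambda>_. borel))"
    and law: "distr N (PiM UNIV (\<lambda>_. borel)) \<Gamma> = distr M (PiM UNIV (\<lambda>_. borel)) \<Delta>"
  shows "unit_poisson_points N \<Gamma>"
proof (rule unit_poisson_pointsI[OF N \<Gamma>])
  let ?P = "PiM UNIV (\<lambda>_. borel) :: (nat \<Rightarrow> real) measure"
  note \<Delta>m = unit_poisson_pointsD(1)[OF \<Delta>]
  have [measurable]: "(\<lambda>\<gamma>. \<gamma> i) \<in> borel_measurable ?P" for i by (rule measurable_component_singleton) simp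
  \<comment> \<open>A countable formulation of the path conditions, hence measurable: for an
    increasing sequence, divergence means exceeding every natural number.\<close>
  define good where "good \<gamma> \<longleftrightarrow> (\<forall>n. \<gamma> n < \<gamma> (Suc n)) \<and> 0 < \<gamma> 0 \<and> (\<forall>m. \<exists>n. real m \<le> \<gamma> n)" for \<gamma> :: "nat \<Rightarrow> real"
  have good: "good \<gamma> \<longleftrightarrow> strict_mono \<gamma> \<and> 0 < \<gamma> 0 \<and> filterlim \<gamma> at_top sequentially" for \<gamma>
  proof -
    have "filterlim \<gamma> at_top sequentially \<longleftrightarrow> (\<forall>m. \<exists>n. real m \<le> \<gamma> n)" if sm: "strict_mono \<gamma>"
    proof
      assume "filterlim \<gamma> at_top sequentially"
      then have "eventually (\<lambda>n. real m \<le> \<gamma> n) sequentially" for m by (simp add: filterlim_at_top)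
      then show "\<forall>m. \<exists>n. real m \<le> \<gamma> n" by (auto simp: eventually_sequentially)
    next
      assume *: "\<forall>m. \<exists>n. real m \<le> \<gamma> n"
      show "filterlim \<gamma> at_top sequentially"
        unfolding filterlim_at_top
      proof
        fix Z :: real
        obtain m where "Z \<le> real m" using real_arch_simple by blast
        moreover obtain n where "real m \<le> \<gamma> n" using * by blast
        ultimately show "eventually (\<lambda>i. Z \<le> \<gamma> i) sequentially"
          using sm strict_mono_less_eq[OF sm, of n] by (intro eventually_sequentiallyI[of n]) (auto intro: order_trans)
      qed
    qed
    then show ?thesis unfolding good_def strict_mono_Suc_iff by auto
  qed
  have good_m: "{\<gamma>\<in>space ?P. good \<gamma>} \<in> sets ?P" unfolding good_def by measurable
  have "AE \<omega> in M. good (\<Delta> \<omega>)" using \<Delta> unfolding unit_poisson_points_def good by (elim conjE)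
  then have "AE \<gamma> in distr M ?P \<Delta>. good \<gamma>" by (subst AE_distr_iff[OF \<Delta>m good_m])
  then have "AE \<omega> in N. good (\<Gamma> \<omega>)" unfolding law[symmetric] by (rule AE_distrD[OF \<Gamma>])
  then show "AE \<omega> in N. strict_mono (\<Gamma> \<omega>) \<and> 0 < \<Gamma> \<omega> 0 \<and> filterlim (\<Gamma> \<omega>) at_top sequentially" unfolding good .
  fix n :: nat and B :: "nat \<Rightarrow> real set" and m
  assume B: "\<And>j. j < n \<Longrightarrow> B j \<in> sets borel \<and> bounded (B j) \<and> B j \<subseteq> {0<..}" "disjoint_family_on B {..<n}"
  define A where "A = {\<gamma>\<in>space ?P. \<forall>j\<in>{..<n}. card {i. \<gamma> i \<in> B j} = m j}"
  have A: "A \<in> sets ?P" unfolding A_def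
  proof (rule sets.sets_Collect_finite_All[OF _ finite_lessThan])
    fix j assume "j \<in> {..<n}"
    then have "(\<lambda>\<gamma>. card {i. \<gamma> i \<in> B j}) -` {m j} \<inter> space ?P \<in> sets ?P"
      using B by (intro measurable_sets[OF measurable_card_points]) auto
    then show "{\<gamma>\<in>space ?P. card {i. \<gamma> i \<in> B j} = m j} \<in> sets ?P" by (simp add: vimage_def Int_def conj_commute)
  qed
  have "measure (distr N ?P \<Gamma>) A = measure N {\<omega>\<in>space N. \<forall>j<n. card {i. \<Gamma> \<omega> i \<in> B j} = m j}"
    using measurable_space[OF \<Gamma>] by (subst measure_distr[OF \<Gamma> A]) (auto simp: A_def intro!: arg_cong[where f="measure N"])
  moreover have "measure (distr M ?P \<Delta>) A = measure M {\<omega>\<in>space M. \<forall>j<n. card {i. \<Delta> \<omega> i \<in> B j} = m j}"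
    using measurable_space[OF \<Delta>m] by (subst measure_distr[OF \<Delta>m A]) (auto simp: A_def intro!: arg_cong[where f="measure M"])
  ultimately show "measure N {\<omega>\<in>space N. \<forall>j<n. card {i. \<Gamma> \<omega> i \<in> B j} = m j} =
      (\<Prod>j<n. exp (- measure lborel (B j)) * measure lborel (B j) ^ m j / fact (m j))"
    unfolding law using unit_poisson_points_joint_law[OF M \<Delta> B] by simp
qed

section \<open>Construction from independent unit intervals\<close>

text \<open>Local finiteness gives every real a next point of \<open>S\<close>. Iteration reaches
  all of \<open>S\<close>, since an unreached point would have infinitely many points of
  \<open>S\<close> below it. The last clause expresses \<open>\<gamma> i \<le> t\<close> by a count,
  which later makes the enumeration measurable.\<close>

lemma enumerate_locally_finite:
  fixes S :: "real set"
  assumes pos: "S \<subseteq> {0<..}" and inf: "infinite S" and fin: "\<And>t. finite (S \<inter> {..t})"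
  obtains \<gamma> :: "nat \<Rightarrow> real" where "strict_mono \<gamma>" "range \<gamma> = S" "filterlim \<gamma> at_top sequentially"
    "\<And>i t. \<gamma> i \<le> t \<longleftrightarrow> i < card (S \<inter> {..t})"
proof -
  have ex: "\<exists>m. m \<in> S \<and> x < m \<and> (\<forall>y\<in>S. x < y \<longrightarrow> m \<le> y)" for x
  proof -
    have "\<not> S \<subseteq> S \<inter> {..x}" using fin[of x] inf finite_subset by blast
    then obtain z where z: "z \<in> S" "x < z" unfolding subset_iff Int_iff atMost_iff not_all by (auto simp: not_le)
    define T where "T = (S \<inter> {..z}) \<inter> {x<..}"
    have T: "finite T" "z \<in> T" unfolding T_def using fin[of z] z by auto
    have "Min T \<in> T" using T by (intro Min_in) auto
    moreover have "Min T \<le> y" if "y \<in> S" "x < y" for y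
    proof (cases "y \<le> z")
      case True then show ?thesis using T that by (intro Min_le) (auto simp: T_def)
    next
      case False
      moreover have "Min T \<le> z" using T by (intro Min_le)
      ultimately show ?thesis by simp
    qed
    ultimately show ?thesis unfolding T_def by auto
  qed
  define nxt where "nxt x = (SOME m. m \<in> S \<and> x < m \<and> (\<forall>y\<in>S. x < y \<longrightarrow> m \<le> y))" for x
  have nxt: "nxt x \<in> S" "x < nxt x" "\<And>y. y \<in> S \<Longrightarrow> x < y \<Longrightarrow> nxt x \<le> y" for x
    using someI_ex[OF ex[of x]] unfolding nxt_def by auto
  \<comment> \<open>The iteration starts at 0, which lies below all of \<open>S\<close> but is not a
    point of it; hence \<open>Suc i\<close> steps.\<close>
  define \<gamma> where "\<gamma> i = (nxt ^^ Suc i) 0" for i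
  have \<gamma>_Suc: "\<gamma> (Suc i) = nxt (\<gamma> i)" for i unfolding \<gamma>_def by simp
  have \<gamma>_S: "\<gamma> i \<in> S" for i unfolding \<gamma>_def using nxt(1) by simp
  have sm: "strict_mono \<gamma>" unfolding strict_mono_Suc_iff \<gamma>_Suc using nxt(2) by simp
  have inj: "inj \<gamma>" using sm by (rule strict_mono_imp_inj_on)
  have rng: "range \<gamma> = S"
  proof
    show "range \<gamma> \<subseteq> S" using \<gamma>_S by auto
    show "S \<subseteq> range \<gamma>"
    proof (rule subsetI, rule ccontr)
      fix s assume s: "s \<in> S" "s \<notin> range \<gamma>"
      have "\<gamma> i < s" for i
      proof (induction i)
        case 0
        have "\<gamma> 0 \<le> s" unfolding \<gamma>_def using nxt(3)[of s 0] s pos by auto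
        then show ?case using s by (metis order_le_less rangeI)
      next
        case (Suc i)
        then have "\<gamma> (Suc i) \<le> s" unfolding \<gamma>_Suc using nxt(3) s by auto
        then show ?case using s by (metis order_le_less rangeI)
      qed
      then have "range \<gamma> \<subseteq> S \<inter> {..s}" using \<gamma>_S by (auto intro: less_imp_le)
      then have "finite (range \<gamma>)" using fin finite_subset by blast
      then show False using inj range_inj_infinite by blast
    qed
  qed
  have card: "card (S \<inter> {..t}) = card {i. \<gamma> i \<le> t}" and fin': "finite {i. \<gamma> i \<le> t}" for t
  proof -
    have eq: "S \<inter> {..t} = \<gamma> ` {i. \<gamma> i \<le> t}" using rng by auto
    show "card (S \<inter> {..t}) = card {i. \<gamma> i \<le> t}" unfolding eq by (rule card_image) (rule inj_on_subset[OF inj], simp)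
    show "finite {i. \<gamma> i \<le> t}" using fin[of t] unfolding eq by (rule finite_imageD) (rule inj_on_subset[OF inj], simp)
  qed
  have iff: "\<gamma> i \<le> t \<longleftrightarrow> i < card (S \<inter> {..t})" for i t
  proof
    assume "\<gamma> i \<le> t"
    then have "{..i} \<subseteq> {i. \<gamma> i \<le> t}" using strict_mono_less_eq[OF sm] by (auto intro: order_trans)
    then have "card {..i} \<le> card {i. \<gamma> i \<le> t}" by (rule card_mono[OF fin'])
    then show "i < card (S \<inter> {..t})" unfolding card by simp
  next
    assume i: "i < card (S \<inter> {..t})"
    show "\<gamma> i \<le> t"
    proof (rule ccontr)
      assume "\<not> \<gamma> i \<le> t"
      have "j < i" if "\<gamma> j \<le> t" for j
      proof -
        have "\<gamma> j < \<gamma> i" using that \<open>\<not> \<gamma> i \<le> t\<close> by simp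
        then show ?thesis using strict_mono_less[OF sm] by simp
      qed
      then have "{j. \<gamma> j \<le> t} \<subseteq> {..<i}" by auto
      then have "card {j. \<gamma> j \<le> t} \<le> card {..<i}" by (rule card_mono[OF finite_lessThan])
      then show False using i unfolding card by simp
    qed
  qed
  have "filterlim \<gamma> at_top sequentially"
    unfolding filterlim_at_top
  proof
    fix Z :: real
    show "eventually (\<lambda>i. Z \<le> \<gamma> i) sequentially"
      using iff[of _ Z] by (intro eventually_sequentiallyI[of "card (S \<inter> {..Z})"]) (meson linear not_less)
  qed
  then show ?thesis using that sm rng iff by blast
qed

text \<open>Model: the \<open>k\<close>-th unit interval carries a Poisson number of independent uniform points; a sample
  point is a pair (counts, positions).\<close>

definition unif_interval :: "nat \<Rightarrow> real measure" where
  "unif_interval k = density lborel (indicator {real k<..real k + 1})"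

definition interval_counts :: "(nat \<Rightarrow> nat) measure" where
  "interval_counts = PiM UNIV (\<lambda>_. measure_pmf (poisson_pmf 1))"

definition interval_positions :: "(nat \<times> nat \<Rightarrow> real) measure" where
  "interval_positions = PiM UNIV (\<lambda>p. unif_interval (fst p))"

text \<open>The number of points in \<open>B\<close> coming from the first \<open>R\<close>
  intervals, as a finite sum and thus measurable on the whole sample space. It agrees with the
  cardinality of enumerated points on generic samples when
  \<open>B \<subseteq> {..real R}\<close>.\<close>

definition point_count :: "nat \<Rightarrow> real set \<Rightarrow> (nat \<Rightarrow> nat) \<times> (nat \<times> nat \<Rightarrow> real) \<Rightarrow> nat" where
  "point_count R B x = (\<Sum>k<R. \<Sum>j<fst x k. of_bool (snd x (k, j) \<in> B))"

text \<open>Infinitely many intervals are occupied, which makes the point set infinite and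
  enumerable by all of \<open>nat\<close>.\<close>

definition generic_counts :: "(nat \<Rightarrow> nat) \<Rightarrow> bool" where
  "generic_counts c \<longleftrightarrow> (\<forall>m. \<exists>k\<ge>m. c k \<noteq> 0)"

text \<open>Distinct indices give distinct points, so counting indices and counting points agree;
  the intervals locate each point.\<close>

definition generic_positions :: "(nat \<times> nat \<Rightarrow> real) \<Rightarrow> bool" where
  "generic_positions u \<longleftrightarrow> (\<forall>p. u p \<in> {real (fst p)<..real (fst p) + 1}) \<and> (\<forall>p q. p \<noteq> q \<longrightarrow> u p \<noteq> u q)"

lemma sets_unif_interval[simp, measurable_cong]: "sets (unif_interval k) = sets borel"
  unfolding unif_interval_def by simp

lemma space_unif_interval[simp]: "space (unif_interval k) = UNIV"
  unfolding unif_interval_def by simp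

lemma prob_space_unif_interval: "prob_space (unif_interval k)"
  by (rule prob_spaceI) (simp add: unif_interval_def emeasure_density)

lemma prob_space_interval_counts: "prob_space interval_counts"
  unfolding interval_counts_def by (rule prob_space_PiM) (rule prob_space_measure_pmf)

lemma prob_space_interval_positions: "prob_space interval_positions"
  unfolding interval_positions_def by (rule prob_space_PiM) (rule prob_space_unif_interval)

lemma measurable_position[measurable]: "(\<lambda>u. u p) \<in> borel_measurable interval_positions"
proof -
  have "(\<lambda>u. u p) \<in> measurable interval_positions (unif_interval (fst p))"
    unfolding interval_positions_def by (rule measurable_component_singleton) simp
  then show ?thesis by (simp cong: measurable_cong_sets)
qed

lemma measurable_count[measurable]: "(\<lambda>c. c k) \<in> measurable interval_counts (count_space UNIV)"
proof -
  have "(\<lambda>c. c k) \<in> measurable interval_counts (measure_pmf (poisson_pmf 1))"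
    unfolding interval_counts_def by (rule measurable_component_singleton) simp
  moreover have "measurable interval_counts (measure_pmf (poisson_pmf 1)) = measurable interval_counts (count_space UNIV)"
    by (rule measurable_cong_sets) simp_all
  ultimately show ?thesis by simp
qed

text \<open>Each interval is empty with probability \<open>exp (-1)\<close>, so by independence the
  intervals \<open>m\<close> to \<open>m + r\<close> are all empty with probability
  \<open>exp (-1) ^ Suc r\<close>, which tends to 0.\<close>

lemma AE_generic_counts: "AE c in interval_counts. generic_counts c"
proof -
  interpret prob_space interval_counts by (rule prob_space_interval_counts)
  have law: "prob {c\<in>space interval_counts. c k = 0} = exp (-1)" for k
  proof -
    have "measure (measure_pmf (poisson_pmf 1)) {0} = measure (distr interval_counts (measure_pmf (poisson_pmf 1)) (\<lambda>c. c k)) {0}"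
      unfolding interval_counts_def by (subst distr_PiM_component) (auto intro: prob_space_measure_pmf)
    also have "\<dots> = prob ((\<lambda>c. c k) -` {0} \<inter> space interval_counts)"
      by (rule measure_distr) (simp_all add: measurable_count)
    also have "(\<lambda>c. c k) -` {0} \<inter> space interval_counts = {c\<in>space interval_counts. c k = 0}" by auto
    finally show ?thesis by (simp add: measure_pmf_single)
  qed
  have ind: "indep_vars (\<lambda>_. measure_pmf (poisson_pmf 1)) (\<lambda>k c. c k) UNIV"
    unfolding interval_counts_def by (rule indep_vars_PiM_coordinates) (rule prob_space_measure_pmf)
  have "AE c in interval_counts. \<exists>k\<ge>m. c k \<noteq> 0" for m
  proof -
    define A where "A = {c\<in>space interval_counts. \<forall>k\<ge>m. c k = 0}"
    have A_m: "A \<in> events" unfolding A_def by measurable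
    have bd: "prob A \<le> exp (-1) ^ Suc r" for r
    proof -
      have "prob A \<le> prob (\<Inter>k\<in>{m..m+r}. (\<lambda>c. c k) -` {0} \<inter> space interval_counts)"
      proof (rule finite_measure_mono)
        show "A \<subseteq> (\<Inter>k\<in>{m..m+r}. (\<lambda>c. c k) -` {0} \<inter> space interval_counts)" by (auto simp: A_def)
        show "(\<Inter>k\<in>{m..m+r}. (\<lambda>c. c k) -` {0} \<inter> space interval_counts) \<in> events"
          by (intro sets.finite_INT measurable_sets[OF measurable_count]) auto
      qed
      also have "\<dots> = (\<Prod>k\<in>{m..m+r}. prob ((\<lambda>c. c k) -` {0} \<inter> space interval_counts))"
        by (rule indep_varsD[OF ind]) auto
      also have "\<dots> = (\<Prod>k\<in>{m..m+r}. exp (-1))"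
      proof (rule prod.cong[OF refl])
        fix k
        have "(\<lambda>c. c k) -` {0} \<inter> space interval_counts = {c\<in>space interval_counts. c k = 0}" by auto
        then show "prob ((\<lambda>c. c k) -` {0} \<inter> space interval_counts) = exp (-1)" by (simp only: law)
      qed
      finally show ?thesis by simp
    qed
    have l: "(\<lambda>r. exp (-1::real) ^ Suc r) \<longlonglongrightarrow> 0"
      by (intro LIMSEQ_Suc LIMSEQ_realpow_zero) auto
    have "prob A \<le> 0" by (rule LIMSEQ_le_const[OF l]) (use bd in blast)
    then have "emeasure interval_counts A = 0" using measure_nonneg[of interval_counts A] by (simp add: emeasure_eq_measure)
    then have "AE c in interval_counts. c \<notin> A" using A_m by (intro AE_not_in) (simp add: null_sets_def)
    then show ?thesis by (rule AE_mp) (auto simp: A_def)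
  qed
  then show ?thesis unfolding generic_counts_def AE_all_countable by simp
qed

text \<open>Two different positions have a product law with diffuse factors, for which the diagonal
  is a null set. Countably many pairs leave one exceptional null set.\<close>

lemma AE_generic_positions: "AE u in interval_positions. generic_positions u"
proof -
  interpret prob_space interval_positions by (rule prob_space_interval_positions)
  have 1: "AE u in interval_positions. u p \<in> {real (fst p)<..real (fst p) + 1}" for p
    unfolding interval_positions_def
  proof (rule AE_PiM_component[where P="\<lambda>y. y \<in> {real (fst p)<..real (fst p) + 1}" and i=p and M="\<lambda>p. unif_interval (fst p)"])
    show "AE y in unif_interval (fst p). y \<in> {real (fst p)<..real (fst p) + 1}"
      unfolding unif_interval_def by (subst AE_density) (auto simp: indicator_def)
  qed (auto intro: prob_space_unif_interval)
  have "AE u in interval_positions. u p \<noteq> u q" if pq: "p \<noteq> q" for p q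
  proof -
    let ?U = "unif_interval (fst p)" and ?V = "unif_interval (fst q)"
    interpret V: prob_space ?V by (rule prob_space_unif_interval)
    have comp: "distr interval_positions (unif_interval (fst p)) (\<lambda>u. u p) = unif_interval (fst p)" for p
      unfolding interval_positions_def
      by (rule distr_PiM_component[where M="\<lambda>p. unif_interval (fst p)"]) (auto intro: prob_space_unif_interval)
    have ind: "indep_vars (\<lambda>p. unif_interval (fst p)) (\<lambda>p u. u p) UNIV"
      unfolding interval_positions_def by (rule indep_vars_PiM_coordinates) (rule prob_space_unif_interval)
    have D: "distr interval_positions (?U \<Otimes>\<^sub>M ?V) (\<lambda>u. (u p, u q)) = ?U \<Otimes>\<^sub>M ?V"
      using indep_vars_pair_distr[OF ind, of p q] pq comp by simp
    define E where "E = {z\<in>space (?U \<Otimes>\<^sub>M ?V). fst z = snd z}"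
    have E_m: "E \<in> sets (?U \<Otimes>\<^sub>M ?V)" unfolding E_def by measurable
    have "emeasure (?U \<Otimes>\<^sub>M ?V) E = (\<integral>\<^sup>+a. emeasure ?V (Pair a -` E) \<partial>?U)"
      by (rule V.emeasure_pair_measure_alt[OF E_m])
    also have "\<dots> = (\<integral>\<^sup>+a. 0 \<partial>?U)"
    proof (rule nn_integral_cong)
      fix a :: real
      have "Pair a -` E = {a}" unfolding E_def by (auto simp: space_pair_measure)
      moreover have "emeasure ?V {a} = 0"
      proof -
        have "emeasure ?V {a} = (\<integral>\<^sup>+y. indicator {real (fst q)<..real (fst q) + 1} y * indicator {a} y \<partial>lborel)"
          unfolding unif_interval_def by (rule emeasure_density) auto
        also have "\<dots> \<le> (\<integral>\<^sup>+y. indicator {a} y \<partial>lborel)"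
          by (rule nn_integral_mono) (auto simp: indicator_def)
        finally show ?thesis by simp
      qed
      ultimately show "emeasure ?V (Pair a -` E) = 0" by simp
    qed
    finally have "E \<in> null_sets (?U \<Otimes>\<^sub>M ?V)" using E_m by (simp add: null_sets_def)
    then have "AE z in ?U \<Otimes>\<^sub>M ?V. z \<notin> E" by (rule AE_not_in)
    then have "AE z in distr interval_positions (?U \<Otimes>\<^sub>M ?V) (\<lambda>u. (u p, u q)). z \<notin> E" unfolding D .
    then have "AE u in interval_positions. (u p, u q) \<notin> E" by (rule AE_distrD[rotated]) measurable
    then show ?thesis by (rule AE_mp) (auto simp: E_def space_pair_measure)
  qed
  then have 2: "AE u in interval_positions. p \<noteq> q \<longrightarrow> u p \<noteq> u q" for p q by (cases "p = q") auto
  have "AE u in interval_positions. \<forall>p. u p \<in> {real (fst p)<..real (fst p) + 1}"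
    unfolding AE_all_countable by (rule allI, rule 1)
  moreover have "AE u in interval_positions. \<forall>p q. p \<noteq> q \<longrightarrow> u p \<noteq> u q"
    unfolding AE_all_countable by (intro allI, rule 2)
  ultimately show ?thesis unfolding generic_positions_def by (rule AE_conjI)
qed

lemma measurable_point_count[measurable]:
  assumes [measurable]: "B \<in> sets borel"
  shows "point_count R B \<in> measurable (interval_counts \<Otimes>\<^sub>M interval_positions) (count_space UNIV)"
proof -
  let ?M = "interval_counts \<Otimes>\<^sub>M interval_positions"
  have [measurable]: "(\<lambda>x. fst x k) \<in> measurable ?M (count_space UNIV)" for k
    by (rule measurable_compose[OF measurable_fst measurable_count])
  have [measurable]: "(\<lambda>x. snd x p) \<in> borel_measurable ?M" for p
    by (rule measurable_compose[OF measurable_snd measurable_position])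
  have "(\<lambda>x. \<Sum>j<n. of_bool (snd x (k, j) \<in> B) :: nat) \<in> measurable ?M (count_space UNIV)" for n k
    unfolding of_bool_def by measurable
  then have "(\<lambda>x. \<Sum>j<fst x k. of_bool (snd x (k, j) \<in> B) :: nat) \<in> measurable ?M (count_space UNIV)" for k
    by (rule measurable_compose_countable) measurable
  then show ?thesis unfolding point_count_def[abs_def] by measurable
qed

lemma point_count_eq_card:
  "point_count R B x = card {p. fst p < R \<and> snd p < fst x (fst p) \<and> snd x p \<in> B}"
proof -
  have "{p. fst p < R \<and> snd p < fst x (fst p) \<and> snd x p \<in> B} = (SIGMA k:{..<R}. {j\<in>{..<fst x k}. snd x (k, j) \<in> B})"
    by auto
  moreover have "card (SIGMA k:{..<R}. {j\<in>{..<fst x k}. snd x (k, j) \<in> B}) = (\<Sum>k<R. card {j\<in>{..<fst x k}. snd x (k, j) \<in> B})"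
    by (rule card_SigmaI) auto
  moreover have "card {j\<in>{..<fst x k}. snd x (k, j) \<in> B} = (\<Sum>j<fst x k. of_bool (snd x (k, j) \<in> B))" for k
    by (simp add: sum_of_bool_eq Int_def)
  ultimately show ?thesis unfolding point_count_def by simp
qed

text \<open>A point with index \<open>(k, j)\<close> exceeds \<open>k\<close>, so the first
  \<open>R\<close> intervals account for all points up to \<open>R\<close>. This yields local
  finiteness and identifies cardinalities with \<open>point_count\<close>.\<close>

lemma generic_points_enumeration:
  assumes c: "generic_counts (fst x)" and u: "generic_positions (snd x)"
  shows "\<exists>\<gamma> :: nat \<Rightarrow> real. strict_mono \<gamma> \<and> 0 < \<gamma> 0 \<and> filterlim \<gamma> at_top sequentially \<and>
    (\<forall>i t. \<gamma> i \<le> t \<longleftrightarrow> i < point_count (nat \<lceil>t\<rceil>) {..t} x) \<and>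
    (\<forall>R B. B \<subseteq> {..real R} \<longrightarrow> card {i. \<gamma> i \<in> B} = point_count R B x)"
proof -
  define D where "D = {p. snd p < fst x (fst p)}"
  define S where "S = snd x ` D"
  have u_bd: "real (fst p) < snd x p" "snd x p \<le> real (fst p) + 1"
    and u_inj: "p \<noteq> q \<Longrightarrow> snd x p \<noteq> snd x q" for p q
    using u[unfolded generic_positions_def, THEN conjunct1, rule_format, of p]
      u[unfolded generic_positions_def, THEN conjunct2, rule_format, of p q] by auto
  have inj: "inj_on (snd x) A" for A by (rule inj_onI) (use u_inj in blast)
  have finD: "finite {p\<in>D. fst p < R}" for R
  proof -
    have "{p\<in>D. fst p < R} = (SIGMA k:{..<R}. {..<fst x k})" unfolding D_def by auto
    then show ?thesis by simp
  qed
  have restr: "{p\<in>D. snd x p \<in> B} = {p. fst p < R \<and> snd p < fst x (fst p) \<and> snd x p \<in> B}" if "B \<subseteq> {..real R}" for R B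
  proof -
    have "fst p < R" if "snd x p \<in> B" for p
      using u_bd(1)[of p] \<open>B \<subseteq> {..real R}\<close> that by (auto dest!: subsetD)
    then show ?thesis unfolding D_def by auto
  qed
  have SB: "S \<inter> B = snd x ` {p\<in>D. snd x p \<in> B}" for B unfolding S_def by auto
  have card_SB: "card (S \<inter> B) = point_count R B x" if "B \<subseteq> {..real R}" for R B
    unfolding SB point_count_eq_card restr[OF that] by (rule card_image[OF inj])
  have ceil: "{..t} \<subseteq> {..real (nat \<lceil>t\<rceil>)}" for t :: real by (auto intro: order_trans[OF _ real_nat_ceiling_ge])
  have "finite (S \<inter> {..t})" for t
  proof -
    have "{p\<in>D. snd x p \<in> {..t}} \<subseteq> {p\<in>D. fst p < nat \<lceil>t\<rceil>}"
      using restr[OF ceil[of t]] unfolding D_def by auto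
    then show ?thesis unfolding SB using finite_subset[OF _ finD] by blast
  qed
  moreover have "infinite S"
  proof
    assume "finite S"
    then have "finite D" unfolding S_def using finite_imageD[OF _ inj] by blast
    then have "finite (fst ` D)" by simp
    then obtain m where m: "\<And>k. k \<in> fst ` D \<Longrightarrow> k < m" using finite_nat_set_iff_bounded by auto
    obtain k where k: "k \<ge> m" "fst x k \<noteq> 0" using c unfolding generic_counts_def by blast
    then have "(k, 0) \<in> D" unfolding D_def by auto
    then have "k \<in> fst ` D" by (metis fst_conv imageI)
    then show False using m k by fastforce
  qed
  moreover have S_pos: "S \<subseteq> {0<..}" unfolding S_def
  proof (rule image_subsetI)
    fix p show "snd x p \<in> {0<..}" using u_bd(1)[of p] of_nat_0_le_iff[of "fst p"] by (simp del: of_nat_0_le_iff)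
  qed
  ultimately obtain \<gamma> where \<gamma>: "strict_mono \<gamma>" "range \<gamma> = S" "filterlim \<gamma> at_top sequentially"
    "\<And>i t. \<gamma> i \<le> t \<longleftrightarrow> i < card (S \<inter> {..t})"
    using enumerate_locally_finite[of S] by metis
  have "card {i. \<gamma> i \<in> B} = card (S \<inter> B)" for B
  proof -
    have "S \<inter> B = \<gamma> ` {i. \<gamma> i \<in> B}" using \<gamma>(2) by auto
    then show ?thesis
      using card_image[OF inj_on_subset[OF strict_mono_imp_inj_on[OF \<gamma>(1)] subset_UNIV], of "{i. \<gamma> i \<in> B}"] by simp
  qed
  then have "\<forall>R B. B \<subseteq> {..real R} \<longrightarrow> card {i. \<gamma> i \<in> B} = point_count R B x" using card_SB by simp
  moreover have "\<forall>i t. \<gamma> i \<le> t \<longleftrightarrow> i < point_count (nat \<lceil>t\<rceil>) {..t} x" using \<gamma>(4) card_SB[OF ceil] by simp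
  moreover have "0 < \<gamma> 0" using \<gamma>(2) S_pos by auto
  ultimately show ?thesis using \<gamma> by blast
qed

text \<open>Integrating the positions first, each point of interval \<open>k\<close> contributes the
  mean \<open>q k\<close> of its factor. The counts then contribute one Poisson generating function
  at \<open>q k\<close> per interval, and the sum of the deficits \<open>1 - q k\<close> reassembles
  the lengths of the sets \<open>B l\<close>.\<close>

lemma point_count_pgf:
  fixes s :: "nat \<Rightarrow> real"
  assumes B: "\<And>l. l < n \<Longrightarrow> B l \<in> sets borel \<and> B l \<subseteq> {0<..real R}" "disjoint_family_on B {..<n::nat}"
    and s: "\<And>l. 0 \<le> s l \<and> s l \<le> 1"
  shows "(\<integral>x. (\<Prod>l<n. s l ^ point_count R (B l) x) \<partial>(interval_counts \<Otimes>\<^sub>M interval_positions)) =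
    (\<Prod>l<n. exp (- measure lborel (B l) * (1 - s l)))"
proof -
  interpret C: prob_space interval_counts by (rule prob_space_interval_counts)
  interpret P: prob_space interval_positions by (rule prob_space_interval_positions)
  let ?M = "interval_counts \<Otimes>\<^sub>M interval_positions"
  interpret PP: pair_prob_space interval_counts interval_positions ..
  \<comment> \<open>The factor due to a point at \<open>y\<close>. Disjointness admits at most one
    \<open>s l\<close>, so \<open>1 - g\<close> is linear in the indicators of the
    \<open>B l\<close>.\<close>
  define g where "g y = (\<Prod>l<n. if y \<in> B l then s l else 1)" for y
  have Bm[measurable]: "B l \<in> sets borel" if "l \<in> {..<n}" for l using B that by auto
  have g_m[measurable]: "g \<in> borel_measurable borel"
    unfolding g_def[abs_def] by (intro borel_measurable_prod measurable_If) auto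
  have g01: "0 \<le> g y" "g y \<le> 1" for y
    unfolding g_def using s by (auto intro!: prod_nonneg prod_le_1)
  have g_sum: "1 - g y = (\<Sum>l<n. (1 - s l) * indicator (B l) y)" for y
  proof (cases "\<exists>l<n. y \<in> B l")
    case True
    then obtain l where l: "l < n" "y \<in> B l" by auto
    have uniq: "y \<notin> B l'" if "l' < n" "l' \<noteq> l" for l'
      using B(2) l that unfolding disjoint_family_on_def by auto
    have "g y = (\<Prod>l'<n. if l' = l then s l else 1)"
      unfolding g_def by (rule prod.cong) (use uniq l in auto)
    moreover have "(\<Sum>l'<n. (1 - s l') * indicator (B l') y) = (\<Sum>l'<n. if l' = l then 1 - s l else 0)"
      by (rule sum.cong) (use uniq l in auto)
    ultimately show ?thesis using l by (simp add: prod.delta sum.delta)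
  qed (auto simp: g_def)
  have prod_eq: "(\<Prod>l<n. s l ^ point_count R (B l) x) = (\<Prod>p\<in>(SIGMA k:{..<R}. {..<fst x k}). g (snd x p))" for x
  proof -
    have "s l ^ point_count R (B l) x = (\<Prod>k<R. \<Prod>j<fst x k. if snd x (k, j) \<in> B l then s l else 1)" for l
      unfolding point_count_def power_sum by (intro prod.cong refl) auto
    then have "(\<Prod>l<n. s l ^ point_count R (B l) x) = (\<Prod>l<n. \<Prod>p\<in>(SIGMA k:{..<R}. {..<fst x k}). if snd x p \<in> B l then s l else 1)"
      by (simp add: prod.Sigma)
    then show ?thesis unfolding g_def by (simp add: prod.swap[of _ _ "{..<n}"])
  qed
  define q where "q k = (\<integral>y. g y \<partial>unif_interval k)" for k
  have [measurable]: "g \<in> borel_measurable (unif_interval k)" for k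
    using g_m by (subst measurable_cong_sets[OF sets_unif_interval refl])
  have U_int: "integrable (unif_interval k) g" for k
  proof -
    interpret U: prob_space "unif_interval k" by (rule prob_space_unif_interval)
    show ?thesis by (rule U.integrable_const_bound[of _ 1]) (use g01 in auto)
  qed
  have q0: "0 \<le> q k" for k unfolding q_def using g01 by simp
  have U_nn: "(\<integral>\<^sup>+y. ennreal (g y) \<partial>unif_interval k) = ennreal (q k)" for k
    unfolding q_def by (rule nn_integral_eq_integral[OF U_int]) (use g01 in auto)
  have inner: "(\<integral>\<^sup>+u. (\<Prod>p\<in>J. ennreal (g (u p))) \<partial>interval_positions) = (\<Prod>p\<in>J. ennreal (q (fst p)))" if J: "finite J" for J
  proof -
    have "P.indep_vars (\<lambda>p. unif_interval (fst p)) (\<lambda>p u. u p) UNIV"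
      unfolding interval_positions_def by (rule indep_vars_PiM_coordinates) (rule prob_space_unif_interval)
    then have "P.indep_vars (\<lambda>p. unif_interval (fst p)) (\<lambda>p u. u p) J" by (rule P.indep_vars_subset) simp
    then have "P.indep_vars (\<lambda>_. borel) (\<lambda>p u. ennreal (g (u p))) J"
      by (rule P.indep_vars_compose2) simp
    then have "(\<integral>\<^sup>+u. (\<Prod>p\<in>J. ennreal (g (u p))) \<partial>interval_positions) = (\<Prod>p\<in>J. \<integral>\<^sup>+u. ennreal (g (u p)) \<partial>interval_positions)"
      by (rule P.indep_vars_nn_integral[OF J]) simp
    also have "\<dots> = (\<Prod>p\<in>J. ennreal (q (fst p)))"
    proof (rule prod.cong[OF refl])
      fix p :: "nat \<times> nat"
      have "(\<integral>\<^sup>+y. ennreal (g y) \<partial>distr interval_positions (unif_interval (fst p)) (\<lambda>u. u p)) = (\<integral>\<^sup>+u. ennreal (g (u p)) \<partial>interval_positions)"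
        by (rule nn_integral_distr) (auto simp: interval_positions_def)
      moreover have "distr interval_positions (unif_interval (fst p)) (\<lambda>u. u p) = unif_interval (fst p)"
        unfolding interval_positions_def
        by (rule distr_PiM_component[where M="\<lambda>p. unif_interval (fst p)"]) (auto intro: prob_space_unif_interval)
      ultimately show "(\<integral>\<^sup>+u. ennreal (g (u p)) \<partial>interval_positions) = ennreal (q (fst p))" using U_nn by simp
    qed
    finally show ?thesis .
  qed
  have F_m: "(\<lambda>x. \<Prod>l<n. s l ^ point_count R (B l) x) \<in> borel_measurable ?M"
  proof (rule borel_measurable_prod)
    fix l assume "l \<in> {..<n}"
    then have "point_count R (B l) \<in> measurable ?M (count_space UNIV)" using Bm by (rule_tac measurable_point_count)
    from measurable_compose[OF this, of "\<lambda>i. s l ^ i" borel]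
    show "(\<lambda>x. s l ^ point_count R (B l) x) \<in> borel_measurable ?M" by simp
  qed
  have "(\<integral>\<^sup>+x. ennreal (\<Prod>l<n. s l ^ point_count R (B l) x) \<partial>?M) =
    (\<integral>\<^sup>+c. \<integral>\<^sup>+u. ennreal (\<Prod>l<n. s l ^ point_count R (B l) (c, u)) \<partial>interval_positions \<partial>interval_counts)"
    by (rule P.nn_integral_fst[symmetric]) (use F_m in measurable)
  also have "\<dots> = (\<integral>\<^sup>+c. (\<Prod>k<R. ennreal (q k ^ c k)) \<partial>interval_counts)"
  proof (rule nn_integral_cong)
    fix c
    have "(\<integral>\<^sup>+u. ennreal (\<Prod>l<n. s l ^ point_count R (B l) (c, u)) \<partial>interval_positions) =
      (\<integral>\<^sup>+u. (\<Prod>p\<in>(SIGMA k:{..<R}. {..<c k}). ennreal (g (u p))) \<partial>interval_positions)"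
      unfolding prod_eq fst_conv snd_conv using g01 by (intro nn_integral_cong) (simp add: prod_ennreal)
    also have "\<dots> = (\<Prod>p\<in>(SIGMA k:{..<R}. {..<c k}). ennreal (q (fst p)))"
      by (rule inner) auto
    also have "\<dots> = (\<Prod>k<R. \<Prod>j<c k. ennreal (q k))"
      by (subst prod.Sigma) (auto simp: case_prod_beta)
    also have "\<dots> = (\<Prod>k<R. ennreal (q k ^ c k))"
      using q0 by (simp add: ennreal_power)
    finally show "(\<integral>\<^sup>+u. ennreal (\<Prod>l<n. s l ^ point_count R (B l) (c, u)) \<partial>interval_positions) = (\<Prod>k<R. ennreal (q k ^ c k))" .
  qed
  also have "\<dots> = (\<Prod>k<R. \<integral>\<^sup>+c. ennreal (q k ^ c k) \<partial>interval_counts)"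
  proof (rule C.indep_vars_nn_integral)
    have "C.indep_vars (\<lambda>_. measure_pmf (poisson_pmf 1)) (\<lambda>k c. c k) UNIV"
      unfolding interval_counts_def by (rule indep_vars_PiM_coordinates) (rule prob_space_measure_pmf)
    then have "C.indep_vars (\<lambda>_. measure_pmf (poisson_pmf 1)) (\<lambda>k c. c k) {..<R}" by (rule C.indep_vars_subset) simp
    then show "C.indep_vars (\<lambda>_. borel) (\<lambda>k c. ennreal (q k ^ c k)) {..<R}"
      by (rule C.indep_vars_compose2[where Y="\<lambda>k i. ennreal (q k ^ i)"]) simp
  qed auto
  also have "\<dots> = (\<Prod>k<R. ennreal (exp (- 1 * (1 - q k))))"
  proof (rule prod.cong[OF refl], rule C.poisson_pgf)
    fix k i :: nat
    have "measure (measure_pmf (poisson_pmf 1)) {i} = measure (distr interval_counts (measure_pmf (poisson_pmf 1)) (\<lambda>c. c k)) {i}"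
      unfolding interval_counts_def by (subst distr_PiM_component) (auto intro: prob_space_measure_pmf)
    also have "\<dots> = C.prob ((\<lambda>c. c k) -` {i} \<inter> space interval_counts)"
      by (rule measure_distr) (simp_all add: measurable_count)
    also have "(\<lambda>c. c k) -` {i} \<inter> space interval_counts = {c\<in>space interval_counts. c k = i}" by auto
    finally show "C.prob {c\<in>space interval_counts. c k = i} = exp (- 1) * 1 ^ i / fact i" by (simp add: measure_pmf_single)
  qed (use q0 in auto)
  also have "\<dots> = ennreal (\<Prod>l<n. exp (- measure lborel (B l) * (1 - s l)))"
  proof -
    have fin: "emeasure lborel (B l \<inter> A) < \<infinity>" if "l < n" for l A
    proof (rule emeasure_bounded_finite, rule bounded_subset[of "{0..real R}"])
      show "B l \<inter> A \<subseteq> {0..real R}" using B(1)[OF that] by auto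
    qed simp
    have "1 - q k = (\<Sum>l<n. (1 - s l) * measure lborel (B l \<inter> {real k<..real k + 1}))" for k
    proof -
      interpret U: prob_space "unif_interval k" by (rule prob_space_unif_interval)
      have "1 - q k = (\<integral>y. 1 - g y \<partial>unif_interval k)"
        unfolding q_def using U_int U.prob_space by (subst Bochner_Integration.integral_diff) auto
      also have "\<dots> = (\<integral>y. (\<Sum>l<n. (1 - s l) * indicator (B l) y) \<partial>unif_interval k)" unfolding g_sum ..
      also have "\<dots> = (\<Sum>l<n. (1 - s l) * measure (unif_interval k) (B l))"
      proof -
        have "integrable (unif_interval k) (\<lambda>y. (1 - s l) * indicator (B l) y)" if "l \<in> {..<n}" for l
          by (intro integrable_mult_right integrable_real_indicator) (simp_all add: Bm[OF that] U.emeasure_eq_measure)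
        then show ?thesis by (subst Bochner_Integration.integral_sum) simp_all
      qed
      also have "\<dots> = (\<Sum>l<n. (1 - s l) * measure lborel (B l \<inter> {real k<..real k + 1}))"
      proof (intro sum.cong refl arg_cong2[where f="(*)"])
        fix l assume "l \<in> {..<n}"
        then have "emeasure (unif_interval k) (B l) = (\<integral>\<^sup>+y. indicator {real k<..real k + 1} y * indicator (B l) y \<partial>lborel)"
          unfolding unif_interval_def using Bm by (intro emeasure_density) auto
        also have "\<dots> = (\<integral>\<^sup>+y. indicator (B l \<inter> {real k<..real k + 1}) y \<partial>lborel)"
          by (rule nn_integral_cong) (auto simp: indicator_def)
        also have "\<dots> = emeasure lborel (B l \<inter> {real k<..real k + 1})"
          using Bm[OF \<open>l \<in> {..<n}\<close>] by simp
        finally show "measure (unif_interval k) (B l) = measure lborel (B l \<inter> {real k<..real k + 1})"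
          unfolding measure_def by simp
      qed
      finally show ?thesis .
    qed
    then have "(\<Sum>k<R. 1 - q k) = (\<Sum>l<n. \<Sum>k<R. (1 - s l) * measure lborel (B l \<inter> {real k<..real k + 1}))"
      by (simp add: sum.swap[of _ _ "{..<R}"])
    also have "\<dots> = (\<Sum>l<n. (1 - s l) * measure lborel (B l))"
    proof (rule sum.cong[OF refl])
      fix l assume l: "l \<in> {..<n}"
      have "measure lborel (\<Union>k<R. B l \<inter> {real k<..real k + 1}) = (\<Sum>k<R. measure lborel (B l \<inter> {real k<..real k + 1}))"
      proof (rule measure_finite_Union)
        show "disjoint_family_on (\<lambda>k. B l \<inter> {real k<..real k + 1}) {..<R}"
          unfolding disjoint_family_on_def
        proof (intro ballI impI)
          fix k k' :: nat assume "k \<noteq> k'"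
          then have "real k + 1 \<le> real k' \<or> real k' + 1 \<le> real k" by linarith
          then show "(B l \<inter> {real k<..real k + 1}) \<inter> (B l \<inter> {real k'<..real k' + 1}) = {}" by auto
        qed
      qed (use Bm[OF l] fin l in \<open>auto simp: less_top\<close>)
      moreover have "(\<Union>k<R. B l \<inter> {real k<..real k + 1}) = B l"
      proof (intro equalityI subsetI)
        fix y assume y: "y \<in> B l"
        then have y0: "0 < y" "y \<le> real R" using B(1)[of l] l by auto
        \<comment> \<open>The intervals are closed on the right, so an integer \<open>y\<close>
          belongs to the interval ending at \<open>y\<close>; hence the ceiling minus one.\<close>
        define k where "k = nat (\<lceil>y\<rceil> - 1)"
        have "real k < y" "y \<le> real k + 1" "k < R" using y0 unfolding k_def by linarith+
        then show "y \<in> (\<Union>k<R. B l \<inter> {real k<..real k + 1})" using y by auto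
      qed auto
      ultimately show "(\<Sum>k<R. (1 - s l) * measure lborel (B l \<inter> {real k<..real k + 1})) = (1 - s l) * measure lborel (B l)"
        by (simp add: sum_distrib_left)
    qed
    finally have eq: "(\<Sum>k<R. 1 - q k) = (\<Sum>l<n. (1 - s l) * measure lborel (B l))" .
    have "(\<Prod>k<R. exp (- 1 * (1 - q k))) = exp (\<Sum>k<R. - 1 * (1 - q k))"
      by (rule exp_sum[symmetric]) simp
    also have "(\<Sum>k<R. - 1 * (1 - q k)) = - 1 * (\<Sum>k<R. 1 - q k)"
      by (rule sum_distrib_left[symmetric])
    also have "\<dots> = (\<Sum>l<n. - 1 * ((1 - s l) * measure lborel (B l)))"
      unfolding eq by (rule sum_distrib_left)
    also have "\<dots> = (\<Sum>l<n. - measure lborel (B l) * (1 - s l))"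
      by (rule sum.cong) (simp_all add: algebra_simps)
    also have "exp \<dots> = (\<Prod>l<n. exp (- measure lborel (B l) * (1 - s l)))"
      by (rule exp_sum) simp
    finally have "(\<Prod>k<R. exp (- 1 * (1 - q k))) = (\<Prod>l<n. exp (- measure lborel (B l) * (1 - s l)))" .
    then show ?thesis by (simp add: prod_ennreal)
  qed
  finally have nn: "(\<integral>\<^sup>+x. ennreal (\<Prod>l<n. s l ^ point_count R (B l) x) \<partial>?M) = ennreal (\<Prod>l<n. exp (- measure lborel (B l) * (1 - s l)))" .
  have "AE x in ?M. 0 \<le> (\<Prod>l<n. s l ^ point_count R (B l) x)"
    using s by (intro AE_I2 prod_nonneg) simp
  from integral_eq_nn_integral[OF F_m this] show ?thesis
    unfolding nn by (simp add: prod_nonneg)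
qed


lemma unit_poisson_points_exists:
  "\<exists>M (\<Gamma> :: (nat \<Rightarrow> nat) \<times> (nat \<times> nat \<Rightarrow> real) \<Rightarrow> nat \<Rightarrow> real). prob_space M \<and> unit_poisson_points M \<Gamma>"
proof -
  interpret C: prob_space interval_counts by (rule prob_space_interval_counts)
  interpret P: prob_space interval_positions by (rule prob_space_interval_positions)
  let ?M = "interval_counts \<Otimes>\<^sub>M interval_positions"
  have pM: "prob_space ?M" by (rule prob_space_pair[OF prob_space_interval_counts prob_space_interval_positions])
  interpret M: prob_space ?M by (rule pM)
  \<comment> \<open>The almost sure statements provide measurable sets of full measure inside the
    generic samples; the case distinction defining \<open>\<Gamma>\<close> needs such a set to be
    measurable.\<close>
  obtain C where C: "C \<in> sets interval_counts" "emeasure interval_counts C = 1" "\<And>c. c \<in> C \<Longrightarrow> generic_counts c"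
  proof -
    obtain N where N: "{c\<in>space interval_counts. \<not> generic_counts c} \<subseteq> N" "N \<in> null_sets interval_counts"
      using AE_generic_counts unfolding eventually_ae_filter by auto
    show ?thesis
    proof (rule that[of "space interval_counts - N"])
      show "emeasure interval_counts (space interval_counts - N) = 1"
        using N(2) emeasure_Diff_null_set[OF N(2), of "space interval_counts"] C.emeasure_space_1 by simp
    qed (use N in auto)
  qed
  obtain U where U: "U \<in> sets interval_positions" "emeasure interval_positions U = 1" "\<And>u. u \<in> U \<Longrightarrow> generic_positions u"
  proof -
    obtain N where N: "{u\<in>space interval_positions. \<not> generic_positions u} \<subseteq> N" "N \<in> null_sets interval_positions"
      using AE_generic_positions unfolding eventually_ae_filter by auto
    show ?thesis
    proof (rule that[of "space interval_positions - N"])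
      show "emeasure interval_positions (space interval_positions - N) = 1"
        using N(2) emeasure_Diff_null_set[OF N(2), of "space interval_positions"] P.emeasure_space_1 by simp
    qed (use N in auto)
  qed
  define G where "G = C \<times> U"
  have G: "G \<in> sets ?M" unfolding G_def using C U by auto
  have "emeasure ?M G = 1" unfolding G_def using C U by (simp add: P.emeasure_pair_measure_Times)
  then have AE_G: "AE x in ?M. x \<in> G"
    using M.AE_in_set_eq_1[OF G] by (simp add: M.emeasure_eq_measure)
  define Q where "Q x \<gamma> \<longleftrightarrow> strict_mono \<gamma> \<and> 0 < \<gamma> 0 \<and> filterlim \<gamma> at_top sequentially \<and>
    (\<forall>i t. \<gamma> i \<le> t \<longleftrightarrow> i < point_count (nat \<lceil>t\<rceil>) {..t} x) \<and>
    (\<forall>R B. B \<subseteq> {..real R} \<longrightarrow> card {i. \<gamma> i \<in> B} = point_count R B x)" for x and \<gamma> :: "nat \<Rightarrow> real"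
  \<comment> \<open>Outside \<open>G\<close> the constant 0 is a measurable default on a null
    set.\<close>
  define \<Gamma> where "\<Gamma> x = (if x \<in> G then SOME \<gamma>. Q x \<gamma> else (\<lambda>_. 0))" for x
  have Q: "Q x (\<Gamma> x)" if "x \<in> G" for x
  proof -
    have "\<exists>\<gamma>. Q x \<gamma>"
      unfolding Q_def by (rule generic_points_enumeration) (use that C U in \<open>auto simp: G_def\<close>)
    then have "Q x (SOME \<gamma>. Q x \<gamma>)" by (rule someI_ex)
    then show ?thesis using that unfolding \<Gamma>_def by simp
  qed
  have "unit_poisson_points ?M \<Gamma>"
  proof (rule unit_poisson_pointsI)
    show "prob_space ?M" by (rule pM)
    show "\<Gamma> \<in> measurable ?M (PiM UNIV (\<lambda>_. borel))"
    proof (rule measurable_PiM_single')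
      fix i :: nat
      show "(\<lambda>x. \<Gamma> x i) \<in> borel_measurable ?M"
      proof (rule borel_measurableI_le)
        fix t :: real
        \<comment> \<open>The enumeration comes from a choice operator, but it is below
          \<open>t\<close> exactly when the count up to \<open>t\<close> exceeds \<open>i\<close>,
          and counts are measurable.\<close>
        have "{x\<in>space ?M. \<Gamma> x i \<le> t} = {x\<in>space ?M. if x \<in> G then i < point_count (nat \<lceil>t\<rceil>) {..t} x else 0 \<le> t}"
          using Q unfolding Q_def by (auto simp: \<Gamma>_def)
        also have "\<dots> \<in> sets ?M"
        proof -
          have [measurable]: "point_count (nat \<lceil>t\<rceil>) {..t} \<in> measurable ?M (count_space UNIV)" by (rule measurable_point_count) simp
          show ?thesis using G by measurable
        qed
        finally show "{x\<in>space ?M. \<Gamma> x i \<le> t} \<in> sets ?M" .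
      qed
    qed simp
    show "AE x in ?M. strict_mono (\<Gamma> x) \<and> 0 < \<Gamma> x 0 \<and> filterlim (\<Gamma> x) at_top sequentially"
    proof (rule AE_mp[OF AE_G], intro AE_I2 impI)
      fix x assume "x \<in> G"
      from Q[OF this] show "strict_mono (\<Gamma> x) \<and> 0 < \<Gamma> x 0 \<and> filterlim (\<Gamma> x) at_top sequentially"
        unfolding Q_def by simp
    qed
    fix n :: nat and B :: "nat \<Rightarrow> real set" and m
    assume B: "\<And>j. j < n \<Longrightarrow> B j \<in> sets borel \<and> bounded (B j) \<and> B j \<subseteq> {0<..}" "disjoint_family_on B {..<n}"
    have "bounded (\<Union>j<n. B j)" using B by (intro bounded_UN) auto
    then obtain b where b: "\<And>y. y \<in> (\<Union>j<n. B j) \<Longrightarrow> \<bar>y\<bar> \<le> b" by (auto simp: bounded_real)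
    obtain R where R: "b \<le> real R" using real_arch_simple by blast
    have BR: "B j \<in> sets borel \<and> B j \<subseteq> {0<..real R}" if "j < n" for j
      using B(1)[OF that] b R that by fastforce
    have "M.prob {x\<in>space ?M. \<forall>j<n. card {i. \<Gamma> x i \<in> B j} = m j} = M.prob {x\<in>space ?M. \<forall>j<n. point_count R (B j) x = m j}"
    proof (rule M.finite_measure_eq_AE)
      show "AE x in ?M. (x \<in> {x\<in>space ?M. \<forall>j<n. card {i. \<Gamma> x i \<in> B j} = m j}) = (x \<in> {x\<in>space ?M. \<forall>j<n. point_count R (B j) x = m j})"
      proof (rule AE_mp[OF AE_G], intro AE_I2 impI)
        fix x assume x: "x \<in> G"
        have "card {i. \<Gamma> x i \<in> B j} = point_count R (B j) x" if "j < n" for j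
        proof -
          have "B j \<subseteq> {..real R}" using BR[OF that] by auto
          then show ?thesis using Q[OF x] unfolding Q_def by blast
        qed
        then show "(x \<in> {x\<in>space ?M. \<forall>j<n. card {i. \<Gamma> x i \<in> B j} = m j}) = (x \<in> {x\<in>space ?M. \<forall>j<n. point_count R (B j) x = m j})"
          by simp
      qed
      have pc: "{x\<in>space ?M. point_count R (B j) x = m j} \<in> sets ?M" if "j \<in> {..<n}" for j
      proof -
        have "point_count R (B j) -` {m j} \<inter> space ?M \<in> sets ?M"
          using BR that by (intro measurable_sets[OF measurable_point_count]) auto
        then show ?thesis by (simp add: vimage_def Int_def conj_commute)
      qed
      show "{x\<in>space ?M. \<forall>j<n. point_count R (B j) x = m j} \<in> sets ?M"
        using sets.sets_Collect_finite_All[OF pc finite_lessThan] unfolding Ball_def lessThan_iff .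
      have G\<Gamma>: "\<Gamma> \<in> measurable ?M (PiM UNIV (\<lambda>_. borel))" by fact
      have cc: "{x\<in>space ?M. card {i. \<Gamma> x i \<in> B j} = m j} \<in> sets ?M" if "j \<in> {..<n}" for j
      proof -
        have "(\<lambda>x. card {i. \<Gamma> x i \<in> B j}) -` {m j} \<inter> space ?M \<in> sets ?M"
          using BR that by (intro measurable_sets[OF measurable_compose[OF G\<Gamma> measurable_card_points]]) auto
        then show ?thesis by (simp add: vimage_def Int_def conj_commute)
      qed
      show "{x\<in>space ?M. \<forall>j<n. card {i. \<Gamma> x i \<in> B j} = m j} \<in> sets ?M"
        using sets.sets_Collect_finite_All[OF cc finite_lessThan] unfolding Ball_def lessThan_iff .
    qed
    also have "\<dots> = (\<Prod>j<n. exp (- measure lborel (B j)) * measure lborel (B j) ^ m j / fact (m j))"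
    proof (rule M.poisson_joint_law_of_pgf)
      show "point_count R (B j) \<in> measurable ?M (count_space UNIV)" if "j < n" for j
        using BR[OF that] by (intro measurable_point_count) simp
      show "M.expectation (\<lambda>x. \<Prod>j<n. s j ^ point_count R (B j) x) = (\<Prod>j<n. exp (- measure lborel (B j) * (1 - s j)))"
        if "\<And>j. 0 \<le> s j \<and> s j \<le> 1" for s
        by (rule point_count_pgf[OF BR B(2) that])
    qed
    finally show "M.prob {x\<in>space ?M. \<forall>j<n. card {i. \<Gamma> x i \<in> B j} = m j} = (\<Prod>j<n. exp (- measure lborel (B j)) * measure lborel (B j) ^ m j / fact (m j))" .
  qed
  with pM show ?thesis by (intro exI conjI)
qed

subsection \<open>Scales of max-stable sup-measures\<close>

text \<open>The weighted maximum is the extremal integral of the step function \<open>f\<close>, so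
  its scale is the tail dependence functional at \<open>f\<close>.\<close>

lemma max_stable_unit_frechet_SUP:
  fixes X :: "'m \<Rightarrow> 'a::{t2_space, second_countable_topology} set \<Rightarrow> ennreal"
  assumes lc: "locally_compact_space (euclidean :: 'a topology)"
    and X: "random_sup_measure M X" and ms: "max_stable M X"
    and K: "\<And>i. i < n \<Longrightarrow> compact (K i)" and u: "\<And>i. i < n \<Longrightarrow> 0 \<le> u i"
    and f: "\<And>x. ennreal (f x) = (SUP i\<in>{..<n::nat}. ennreal (u i) * indicator (K i) x)"
  shows "unit_frechet M (\<lambda>\<omega>. SUP i\<in>{..<n}. ennreal (u i) * X \<omega> (K i)) (tail_dep M X f)"
proof -
  obtain a where a: "unit_frechet M (\<lambda>\<omega>. SUP i\<in>{..<n}. ennreal (u i) * X \<omega> (K i)) a"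
    using ms[unfolded max_stable_def, rule_format, of n K u] K u by auto
  have "unit_frechet M (\<lambda>\<omega>. extremal_integral f (X \<omega>)) a"
    using a unit_frechet_cong[of M "\<lambda>\<omega>. extremal_integral f (X \<omega>)" "\<lambda>\<omega>. SUP i\<in>{..<n}. ennreal (u i) * X \<omega> (K i)" a]
      extremal_integral_Max_indicator[OF lc random_sup_measureD(1)[OF X] f] by simp
  then have "tail_dep M X f = a" unfolding tail_dep_def by (rule frechet_scale_eq)
  then show ?thesis using a by simp
qed

lemma max_stable_unit_frechet_indicator:
  fixes X :: "'m \<Rightarrow> 'a::{t2_space, second_countable_topology} set \<Rightarrow> ennreal"
  assumes lc: "locally_compact_space (euclidean :: 'a topology)"
    and X: "random_sup_measure M X" and ms: "max_stable M X" and K: "compact K" and v: "0 \<le> v"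
  shows "unit_frechet M (\<lambda>\<omega>. ennreal v * X \<omega> K) (tail_dep M X (\<lambda>x. v * indicator K x))"
  using max_stable_unit_frechet_SUP[OF lc X ms, where n="Suc 0" and K="\<lambda>_. K" and u="\<lambda>_. v" and f="\<lambda>x. v * indicator K x"] K v
  by (simp add: lessThan_Suc ennreal_mult ennreal_indicator)

lemma unit_frechet_cmult:
  assumes V: "unit_frechet M V a" and M: "prob_space M" and v: "0 \<le> v"
  shows "unit_frechet M (\<lambda>\<omega>. ennreal v * V \<omega>) (v * a)"
proof (cases "v = 0")
  case True then show ?thesis using unit_frechet_0[OF M] by simp
next
  case False
  then have v0: "0 < v" using v by simp
  have [measurable]: "V \<in> borel_measurable M" by (rule unit_frechetD(2)[OF V])
  have "measure M {\<omega>\<in>space M. ennreal v * V \<omega> \<le> ennreal t} = exp (- (v * a) / t)" if "0 < t" for t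
  proof -
    have "ennreal v * y \<le> ennreal t \<longleftrightarrow> y \<le> ennreal (t / v)" for y
      using ennreal_scaling_le_iff[of v t 1 y] ennreal_scaling_le_iff[of 1 t "1 / v" y] v0 that
      by (cases y) (auto simp: ennreal_mult[symmetric] field_simps ennreal_mult_top top_unique)
    then have "measure M {\<omega>\<in>space M. ennreal v * V \<omega> \<le> ennreal t} = measure M {\<omega>\<in>space M. V \<omega> \<le> ennreal (t / v)}"
      by (simp only: )
    also have "\<dots> = exp (- a / (t / v))" using v0 that by (intro unit_frechetD(3)[OF V]) simp
    finally show ?thesis by (simp add: mult.commute)
  qed
  then show ?thesis using unit_frechetD(1)[OF V] v unfolding unit_frechet_def by simp
qed

text \<open>The real maximum of the active weights is the step function; inserting 0 keeps the
  maximum defined at points outside all \<open>K i\<close>. A superlevel set is the union of the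
  finitely many compacts with large enough weight.\<close>

lemma finite_SUP_indicator_USC:
  fixes K :: "nat \<Rightarrow> 'a::t2_space set"
  assumes K: "\<And>i. i < n \<Longrightarrow> compact (K i)" and u: "\<And>i. i < n \<Longrightarrow> 0 \<le> u i"
  obtains f where "f \<in> USC" "finite (range f)"
    "\<And>x. ennreal (f x) = (SUP i\<in>{..<n}. ennreal (u i) * indicator (K i) x)"
proof -
  define V where "V x = insert 0 (u ` {i. i < n \<and> x \<in> K i})" for x
  define f where "f x = Max (V x)" for x
  have V: "finite (V x)" "V x \<noteq> {}" for x unfolding V_def by auto
  have f0: "0 \<le> f x" for x unfolding f_def by (rule Max_ge[OF V(1)]) (simp add: V_def)
  have fin: "finite (range f)"
  proof (rule finite_subset)
    show "range f \<subseteq> insert 0 (u ` {..<n})"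
    proof
      fix y assume "y \<in> range f"
      then obtain x where "y = Max (V x)" unfolding f_def by auto
      then have "y \<in> V x" using Max_in[OF V] by simp
      then show "y \<in> insert 0 (u ` {..<n})" unfolding V_def by auto
    qed
  qed simp
  have "f \<in> USC"
  proof (rule finite_range_USC[OF fin f0])
    fix q :: real assume q: "0 < q"
    have "{x. q \<le> f x} = (\<Union>i\<in>{i. i < n \<and> q \<le> u i}. K i)"
      unfolding f_def Max_ge_iff[OF V] using q by (auto simp: V_def)
    then show "compact {x. q \<le> f x}" using K by (auto intro: compact_UN)
  qed
  moreover have "ennreal (f x) = (SUP i\<in>{..<n}. ennreal (u i) * indicator (K i) x)" for x
  proof (rule antisym)
    have "f x \<in> V x" unfolding f_def by (rule Max_in[OF V])
    then consider "f x = 0" | i where "i < n" "x \<in> K i" "f x = u i" unfolding V_def by auto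
    then show "ennreal (f x) \<le> (SUP i\<in>{..<n}. ennreal (u i) * indicator (K i) x)"
      by cases (auto intro!: SUP_upper2)
    show "(SUP i\<in>{..<n}. ennreal (u i) * indicator (K i) x) \<le> ennreal (f x)"
    proof (rule SUP_least)
      fix i assume "i \<in> {..<n}"
      then show "ennreal (u i) * indicator (K i) x \<le> ennreal (f x)"
        unfolding f_def by (cases "x \<in> K i") (auto intro!: ennreal_leI Max_ge[OF V(1)] simp: V_def)
    qed
  qed
  ultimately show ?thesis using that fin by blast
qed

subsection \<open>The canonical model\<close>

lemma distr_pair_snd:
  assumes M: "prob_space M" and N: "prob_space N"
  shows "distr (M \<Otimes>\<^sub>M N) N snd = N"
proof (rule measure_eqI)
  interpret M: prob_space M by fact
  interpret N: prob_space N by fact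
  fix A assume "A \<in> sets (distr (M \<Otimes>\<^sub>M N) N snd)"
  then have A: "A \<in> sets N" by simp
  have "snd -` A \<inter> space (M \<Otimes>\<^sub>M N) = space M \<times> A" using sets.sets_into_space[OF A] by (auto simp: space_pair_measure)
  then show "emeasure (distr (M \<Otimes>\<^sub>M N) N snd) A = emeasure N A"
    using A by (simp add: emeasure_distr N.emeasure_pair_measure_Times M.emeasure_space_1)
qed simp

lemma indep_set_fst_snd:
  assumes M: "prob_space M" and N: "prob_space N" and S: "f \<in> measurable M S" and T: "g \<in> measurable N T"
  shows "prob_space.indep_set (M \<Otimes>\<^sub>M N)
    (sets (vimage_algebra (space (M \<Otimes>\<^sub>M N)) (\<lambda>\<omega>. f (fst \<omega>)) S)) (sets (vimage_algebra (space (M \<Otimes>\<^sub>M N)) (\<lambda>\<omega>. g (snd \<omega>)) T))"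
proof -
  interpret M: prob_space M by fact
  interpret N: prob_space N by fact
  interpret P: prob_space "M \<Otimes>\<^sub>M N" by (rule prob_space_pair[OF M N])
  have f: "(\<lambda>\<omega>. f (fst \<omega>)) \<in> measurable (M \<Otimes>\<^sub>M N) S" by (rule measurable_compose[OF measurable_fst S])
  have g: "(\<lambda>\<omega>. g (snd \<omega>)) \<in> measurable (M \<Otimes>\<^sub>M N) T" by (rule measurable_compose[OF measurable_snd T])
  have F: "(\<lambda>\<omega>. f (fst \<omega>)) \<in> space (M \<Otimes>\<^sub>M N) \<rightarrow> space S" using measurable_space[OF f] by auto
  have G: "(\<lambda>\<omega>. g (snd \<omega>)) \<in> space (M \<Otimes>\<^sub>M N) \<rightarrow> space T" using measurable_space[OF g] by auto
  show ?thesis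
    unfolding P.indep_sets2_eq sets_vimage_algebra2[OF F] sets_vimage_algebra2[OF G]
  proof (intro conjI ballI)
    show "{(\<lambda>\<omega>. f (fst \<omega>)) -` A \<inter> space (M \<Otimes>\<^sub>M N) |A. A \<in> sets S} \<subseteq> P.events" using measurable_sets[OF f] by auto
    show "{(\<lambda>\<omega>. g (snd \<omega>)) -` A \<inter> space (M \<Otimes>\<^sub>M N) |A. A \<in> sets T} \<subseteq> P.events" using measurable_sets[OF g] by auto
    fix a b assume "a \<in> {(\<lambda>\<omega>. f (fst \<omega>)) -` A \<inter> space (M \<Otimes>\<^sub>M N) |A. A \<in> sets S}" "b \<in> {(\<lambda>\<omega>. g (snd \<omega>)) -` A \<inter> space (M \<Otimes>\<^sub>M N) |A. A \<in> sets T}"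
    then obtain A B where A: "A \<in> sets S" "a = (\<lambda>\<omega>. f (fst \<omega>)) -` A \<inter> space (M \<Otimes>\<^sub>M N)"
      and B: "B \<in> sets T" "b = (\<lambda>\<omega>. g (snd \<omega>)) -` B \<inter> space (M \<Otimes>\<^sub>M N)" by auto
    define A' where "A' = f -` A \<inter> space M"
    define B' where "B' = g -` B \<inter> space N"
    have A': "A' \<in> sets M" and B': "B' \<in> sets N" unfolding A'_def B'_def using S T A B by (auto intro: measurable_sets)
    have "a = A' \<times> space N" "b = space M \<times> B'" "a \<inter> b = A' \<times> B'"
      unfolding A B A'_def B'_def by (auto simp: space_pair_measure)
    moreover have "emeasure (M \<Otimes>\<^sub>M N) (A' \<times> B') = emeasure (M \<Otimes>\<^sub>M N) (A' \<times> space N) * emeasure (M \<Otimes>\<^sub>M N) (space M \<times> B')"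
      using A' B' by (simp add: N.emeasure_pair_measure_Times M.emeasure_space_1 N.emeasure_space_1)
    ultimately show "P.prob (a \<inter> b) = P.prob a * P.prob b"
      by (simp add: P.emeasure_eq_measure ennreal_mult[symmetric])
  qed
qed

text \<open>The marks carry the final sigma-algebra of the parametrization \<open>Y\<close>, which refines \<open>SM\<close> and makes
  the set of scaled indicator sup-measures measurable for free.\<close>

lemma scaled_indicator_marks_exist:
  fixes c :: "real \<Rightarrow> real" and F :: "real \<Rightarrow> 'a::{t2_space, second_countable_topology} set"
  assumes \<nu>: "prob_space \<nu>" and c: "\<And>x. 0 < c x" and F: "\<And>x. closed (F x)" "\<And>x. F x \<noteq> {}"
    and Y: "(\<lambda>x. scaled_indicator_sm (c x) (F x)) \<in> measurable \<nu> SM"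
    and fin: "\<And>K. compact K \<Longrightarrow> (\<integral>\<^sup>+x. scaled_indicator_sm (c x) (F x) K \<partial>\<nu>) < \<infinity>"
  shows "\<exists>N :: ((nat \<Rightarrow> real) \<times> (nat \<Rightarrow> 'a set \<Rightarrow> ennreal)) measure. scaled_indicator_marks N fst snd \<and>
    (\<forall>K. compact K \<longrightarrow> (\<integral>\<^sup>+\<omega>. snd \<omega> 0 K \<partial>N) = (\<integral>\<^sup>+x. scaled_indicator_sm (c x) (F x) K \<partial>\<nu>))"
proof -
  let ?Y = "\<lambda>x. scaled_indicator_sm (c x) (F x)"
  interpret \<nu>: prob_space \<nu> by fact
  define \<Omega> :: "('a set \<Rightarrow> ennreal) set" where "\<Omega> = Collect sup_measure"
  define \<A> where "\<A> = {A. A \<subseteq> \<Omega> \<and> ?Y -` A \<inter> space \<nu> \<in> sets \<nu>}"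
  have Y\<Omega>: "?Y x \<in> \<Omega>" for x unfolding \<Omega>_def using sup_measure_scaled_indicator[OF F(1)] by simp
  have sa: "sigma_algebra \<Omega> \<A>"
    unfolding sigma_algebra_iff2
  proof (intro conjI ballI allI impI)
    show "\<A> \<subseteq> Pow \<Omega>" "{} \<in> \<A>" unfolding \<A>_def by auto
    show "\<Omega> - A \<in> \<A>" if "A \<in> \<A>" for A
    proof -
      have "?Y -` (\<Omega> - A) \<inter> space \<nu> = space \<nu> - (?Y -` A \<inter> space \<nu>)" using Y\<Omega> by auto
      then show ?thesis using that unfolding \<A>_def by auto
    qed
    show "(\<Union>i::nat. A i) \<in> \<A>" if "range A \<subseteq> \<A>" for A
    proof -
      have "?Y -` (\<Union>i. A i) \<inter> space \<nu> = (\<Union>i. ?Y -` A i \<inter> space \<nu>)" by auto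
      moreover have "?Y -` A i \<inter> space \<nu> \<in> sets \<nu>" "A i \<subseteq> \<Omega>" for i using that unfolding \<A>_def by auto
      moreover from this have "(\<Union>i. ?Y -` A i \<inter> space \<nu>) \<in> sets \<nu>" by (intro sets.countable_UN) auto
      moreover have "(\<Union>i. A i) \<subseteq> \<Omega>" using that unfolding \<A>_def by (intro UN_least) auto
      ultimately show ?thesis unfolding \<A>_def by auto
    qed
  qed
  define L0 where "L0 = sigma \<Omega> \<A>"
  have sets_L0: "sets L0 = \<A>" and space_L0: "space L0 = \<Omega>"
    unfolding L0_def using sigma_algebra.sets_measure_of_eq[OF sa] sigma_algebra.space_measure_of_eq[OF sa] by auto
  have Y_L0: "?Y \<in> measurable \<nu> L0"
    by (rule measurableI) (use Y\<Omega> in \<open>auto simp: sets_L0 space_L0 \<A>_def\<close>)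
  have L0_SM: "(\<lambda>\<phi>. \<phi>) \<in> measurable L0 SM"
  proof (rule measurableI)
    show "\<phi> \<in> space SM" if "\<phi> \<in> space L0" for \<phi> using that unfolding space_L0 \<Omega>_def space_SM .
    fix A :: "('a set \<Rightarrow> ennreal) set" assume A: "A \<in> sets SM"
    have "A \<subseteq> \<Omega>" using sets.sets_into_space[OF A] unfolding space_SM \<Omega>_def .
    then show "(\<lambda>\<phi>. \<phi>) -` A \<inter> space L0 \<in> sets L0"
      using measurable_sets[OF Y A] unfolding sets_L0 space_L0 \<A>_def by (simp add: Int_absorb2)
  qed
  define L where "L = distr \<nu> L0 ?Y"
  have L_prob: "prob_space L" unfolding L_def by (rule \<nu>.prob_space_distr[OF Y_L0])
  have L_SM: "(\<lambda>\<phi>. \<phi>) \<in> measurable L SM" using L0_SM unfolding L_def by simp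
  have L_eval: "(\<lambda>\<phi>. \<phi> K) \<in> borel_measurable L" if "compact K" for K :: "'a set"
    using measurable_compose[OF L_SM measurable_SM_eval[OF that]] .
  have L_AE: "AE \<phi> in L. \<exists>c F. 0 < c \<and> closed F \<and> F \<noteq> {} \<and> \<phi> = scaled_indicator_sm c F"
  proof -
    have *: "\<exists>c' F'. 0 < c' \<and> closed F' \<and> F' \<noteq> {} \<and> ?Y x = scaled_indicator_sm c' F'" for x
      by (rule exI[of _ "c x"], rule exI[of _ "F x"]) (simp add: c F)
    have S: "{\<phi>\<in>space L0. \<exists>c F. 0 < c \<and> closed F \<and> F \<noteq> {} \<and> \<phi> = scaled_indicator_sm c F} \<in> sets L0"
    proof -
      have "?Y -` {\<phi>\<in>\<Omega>. \<exists>c F. 0 < c \<and> closed F \<and> F \<noteq> {} \<and> \<phi> = scaled_indicator_sm c F} = UNIV"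
        using * Y\<Omega> by (simp add: vimage_def)
      then show ?thesis unfolding sets_L0 space_L0 \<A>_def by simp
    qed
    show ?thesis unfolding L_def AE_distr_iff[OF Y_L0 S] by (intro AE_I2 *)
  qed
  obtain B and \<Delta> :: "(nat \<Rightarrow> nat) \<times> (nat \<times> nat \<Rightarrow> real) \<Rightarrow> nat \<Rightarrow> real" where B: "prob_space B" "unit_poisson_points B \<Delta>"
    using unit_poisson_points_exists by blast
  \<comment> \<open>Only the law of the constructed process is retained. As a measure on real
    sequences it gives \<open>N\<close> a type independent of the construction, with the points as
    first projection.\<close>
  define Q where "Q = distr B (PiM UNIV (\<lambda>_. borel)) \<Delta>"
  have Q_prob: "prob_space Q" unfolding Q_def
    by (rule prob_space.prob_space_distr[OF B(1) unit_poisson_pointsD(1)[OF B(2)]])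
  have Q_sets: "sets Q = sets (PiM UNIV (\<lambda>_. borel))" unfolding Q_def by simp
  define P where "P = PiM (UNIV :: nat set) (\<lambda>_. L)"
  have P_prob: "prob_space P" unfolding P_def by (rule prob_space_PiM[OF L_prob])
  define N where "N = Q \<Otimes>\<^sub>M P"
  have N_prob: "prob_space N" unfolding N_def by (rule prob_space_pair[OF Q_prob P_prob])
  have fst_m: "fst \<in> measurable N (PiM UNIV (\<lambda>_. borel))"
  proof -
    have "fst \<in> measurable N Q" unfolding N_def by simp
    then show ?thesis by (subst (asm) measurable_cong_sets[OF refl Q_sets])
  qed
  have snd_m: "snd \<in> measurable N P" unfolding N_def by simp
  have snd_law: "distr N P snd = P" unfolding N_def by (rule distr_pair_snd[OF Q_prob P_prob])
  have P_comp: "(\<lambda>y. y i) \<in> measurable P L" for i unfolding P_def by (rule measurable_component_singleton) simp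
  have P_id: "(\<lambda>y. y) \<in> measurable P (PiM UNIV (\<lambda>_. SM))"
  proof (rule measurable_PiM_single')
    show "(\<lambda>y. y i) \<in> measurable P SM" for i by (rule measurable_compose[OF P_comp L_SM])
    have "space L = space SM" unfolding L_def space_SM by (simp add: space_L0 \<Omega>_def)
    then show "(\<lambda>y. y) \<in> space P \<rightarrow> (\<Pi>\<^sub>E i\<in>UNIV. space SM)" by (simp add: P_def space_PiM)
  qed
  have snd_SM: "snd \<in> measurable N (PiM UNIV (\<lambda>_. SM))" using measurable_compose[OF snd_m P_id] .
  have comp_L: "(\<lambda>\<omega>. snd \<omega> i) \<in> measurable N L" for i by (rule measurable_compose[OF snd_m P_comp])
  have comp_SM: "(\<lambda>\<omega>. snd \<omega> i) \<in> measurable N SM" for i by (rule measurable_compose[OF comp_L L_SM])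
  have law_i: "distr N L (\<lambda>\<omega>. snd \<omega> i) = L" for i
  proof -
    have "distr N L (\<lambda>\<omega>. snd \<omega> i) = distr (distr N P snd) L (\<lambda>y. y i)"
      by (subst distr_distr[OF P_comp snd_m]) (simp add: comp_def)
    also have "\<dots> = L" unfolding snd_law unfolding P_def by (rule distr_PiM_component) (auto intro: L_prob)
    finally show ?thesis .
  qed
  have law_SM: "distr N SM (\<lambda>\<omega>. snd \<omega> i) = distr L SM (\<lambda>\<phi>. \<phi>)" for i
    using distr_distr[OF L_SM comp_L[of i]] unfolding law_i by (simp add: comp_def)
  have integral: "(\<integral>\<^sup>+\<omega>. snd \<omega> i K \<partial>N) = (\<integral>\<^sup>+x. ?Y x K \<partial>\<nu>)" if K: "compact K" for i K
  proof -
    have "(\<integral>\<^sup>+\<omega>. snd \<omega> i K \<partial>N) = (\<integral>\<^sup>+\<phi>. \<phi> K \<partial>distr N L (\<lambda>\<omega>. snd \<omega> i))"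
      by (rule nn_integral_distr[OF comp_L, symmetric]) (use L_eval[OF K] in simp)
    also have "\<dots> = (\<integral>\<^sup>+x. ?Y x K \<partial>\<nu>)"
      unfolding law_i unfolding L_def
      by (rule nn_integral_distr[OF Y_L0]) (use L_eval[OF K] in \<open>simp add: L_def\<close>)
    finally show ?thesis .
  qed
  have "scaled_indicator_marks N fst snd"
    unfolding scaled_indicator_marks_def
  proof (intro conjI allI)
    show "prob_space N" by (rule N_prob)
    have "distr N (PiM UNIV (\<lambda>_. borel)) fst = Q"
    proof -
      have "distr N (PiM UNIV (\<lambda>_. borel)) fst = distr N Q fst" by (rule distr_cong) (simp_all add: Q_sets)
      then show ?thesis unfolding N_def using prob_space.distr_pair_fst[OF P_prob] by simp
    qed
    then show "unit_poisson_points N fst"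
      using unit_poisson_points_of_law[OF B N_prob fst_m] unfolding Q_def by simp
    show "integrable_rsm N (\<lambda>\<omega>. snd \<omega> i)" for i
      unfolding integrable_rsm_def random_sup_measure_def using comp_SM integral fin by simp
    show "distr N SM (\<lambda>\<omega>. snd \<omega> i) = distr N SM (\<lambda>\<omega>. snd \<omega> 0)" for i unfolding law_SM ..
    show "snd \<in> measurable N (PiM UNIV (\<lambda>_. SM))" by (rule snd_SM)
    show "prob_space.indep_vars N (\<lambda>_. SM) (\<lambda>i \<omega>. snd \<omega> i) UNIV"
    proof (subst prob_space.indep_vars_iff_distr_eq_PiM[OF N_prob _ comp_SM])
      have "prob_space.indep_vars P (\<lambda>_. L) (\<lambda>i y. y i) UNIV"
        unfolding P_def by (rule indep_vars_PiM_coordinates[OF L_prob])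
      \<comment> \<open>Independence for the finer sigma-algebra of \<open>L\<close> passes to
        \<open>SM\<close> by composition with the identity.\<close>
      then have "prob_space.indep_vars P (\<lambda>_. SM) (\<lambda>i y. y i) UNIV"
        using prob_space.indep_vars_compose2[OF P_prob, of "\<lambda>_. L" "\<lambda>i y. y i" UNIV "\<lambda>_ \<phi>. \<phi>" "\<lambda>_. SM"] L_SM by simp
      then have "distr P (PiM UNIV (\<lambda>_. SM)) (\<lambda>y. \<lambda>i\<in>UNIV. y i) = PiM UNIV (\<lambda>i. distr P SM (\<lambda>y. y i))"
        by (subst (asm) prob_space.indep_vars_iff_distr_eq_PiM[OF P_prob]) (auto intro: measurable_compose[OF P_comp L_SM])
      moreover have "distr N (PiM UNIV (\<lambda>_. SM)) (\<lambda>\<omega>. \<lambda>i\<in>UNIV. snd \<omega> i) = distr P (PiM UNIV (\<lambda>_. SM)) (\<lambda>y. \<lambda>i\<in>UNIV. y i)"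
        using distr_distr[OF P_id snd_m] unfolding snd_law by (simp add: comp_def restrict_UNIV)
      moreover have "distr N SM (\<lambda>\<omega>. snd \<omega> i) = distr P SM (\<lambda>y. y i)" for i
        using distr_distr[OF measurable_compose[OF P_comp L_SM] snd_m, of i] unfolding snd_law by (simp add: comp_def)
      ultimately show "distr N (PiM UNIV (\<lambda>_. SM)) (\<lambda>\<omega>. \<lambda>i\<in>UNIV. snd \<omega> i) = PiM UNIV (\<lambda>i. distr N SM (\<lambda>\<omega>. snd \<omega> i))"
        by simp
    qed simp
    have Q_id: "(\<lambda>\<gamma>. \<gamma>) \<in> measurable Q (PiM UNIV (\<lambda>_. borel))"
      by (subst measurable_cong_sets[OF Q_sets refl]) simp
    show "prob_space.indep_set N (sets (vimage_algebra (space N) fst (PiM UNIV (\<lambda>_. borel))))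
        (sets (vimage_algebra (space N) snd (PiM UNIV (\<lambda>_. SM))))"
      using indep_set_fst_snd[OF Q_prob P_prob Q_id P_id] unfolding N_def .
    show "AE \<omega> in N. \<exists>c F. 0 < c \<and> closed F \<and> F \<noteq> {} \<and> snd \<omega> i = scaled_indicator_sm c F" for i
      using AE_distrD[OF comp_L[of i], unfolded law_i, OF L_AE] .
  qed
  then show ?thesis using integral by blast
qed

subsection \<open>The representation theorem\<close>

text \<open>Finiteness is what makes \<open>enn2real\<close> additive on the means of extremal
  integrals.\<close>

lemma marks_extremal_integral_finite:
  fixes Y :: "'n \<Rightarrow> 'a::{t2_space, second_countable_topology} set \<Rightarrow> ennreal"
  assumes lc: "locally_compact_space (euclidean :: 'a topology)"
    and Y: "integrable_rsm N Y" and f: "f \<in> USC"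
  shows "(\<integral>\<^sup>+\<omega>. extremal_integral f (Y \<omega>) \<partial>N) < \<infinity>"
proof -
  note Y' = integrable_rsmD[OF Y]
  obtain C K where CK: "0 \<le> C" "compact K"
    "\<And>\<phi> q. sup_measure \<phi> \<Longrightarrow> 0 < q \<Longrightarrow> ennreal q * \<phi> {x. q \<le> f x} \<le> ennreal C * \<phi> K"
    by (rule USC_superlevel_bound[OF f], rule that)
  have "(\<integral>\<^sup>+\<omega>. extremal_integral f (Y \<omega>) \<partial>N) \<le> (\<integral>\<^sup>+\<omega>. ennreal C * Y \<omega> K \<partial>N)"
  proof (rule nn_integral_mono)
    fix \<omega> assume "\<omega> \<in> space N"
    note s = random_sup_measureD(1)[OF Y'(1) this]
    show "extremal_integral f (Y \<omega>) \<le> ennreal C * Y \<omega> K"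
      unfolding extremal_integral_eq_SUP_superlevel[OF lc s USC_D(2)[OF f]]
      by (intro SUP_least CK(3)[OF s pos_rat_pos])
  qed
  also have "\<dots> = ennreal C * (\<integral>\<^sup>+\<omega>. Y \<omega> K \<partial>N)"
    by (rule nn_integral_cmult[OF random_sup_measureD(2)[OF Y'(1) CK(2)]])
  also have "\<dots> < \<infinity>" using Y'(2)[OF CK(2)] by (simp add: ennreal_mult_less_top)
  finally show ?thesis .
qed

lemma enum_le_iff_SUP_le:
  assumes g: "bij_betw g {..<n::nat} J" and t: "\<And>K. K \<in> J \<Longrightarrow> 0 < t K"
  shows "(\<forall>K\<in>J. x K \<le> ennreal (t K)) \<longleftrightarrow> (SUP i\<in>{..<n}. ennreal (1 / t (g i)) * x (g i)) \<le> ennreal 1"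
proof -
  have J: "J = g ` {..<n}" using g unfolding bij_betw_def by simp
  have "y \<le> ennreal s \<longleftrightarrow> ennreal (1 / s) * y \<le> ennreal 1" if "0 < s" for s y
    using ennreal_scaling_le_iff[of 1 s 1 y] that by simp
  then have "(\<forall>K\<in>J. x K \<le> ennreal (t K)) \<longleftrightarrow> (\<forall>K\<in>J. ennreal (1 / t K) * x K \<le> ennreal 1)"
    using t by blast
  then show ?thesis unfolding SUP_le_iff unfolding J by simp
qed

lemma CRSM_imp_representation:
  fixes X :: "'m \<Rightarrow> 'a::{t2_space, second_countable_topology} set \<Rightarrow> ennreal"
  assumes lc: "locally_compact_space (euclidean :: 'a topology)" and M: "prob_space M"
    and X: "random_sup_measure M X" and nz: "AE \<omega> in M. X \<omega> \<noteq> (\<lambda>_. 0)" and crsm: "CRSM M X"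
  shows "\<exists>(N :: ((nat \<Rightarrow> real) \<times> (nat \<Rightarrow> 'a set \<Rightarrow> ennreal)) measure) \<Gamma> Y. crsm_representation M X N \<Gamma> Y"
proof -
  have ms: "max_stable M X" using crsm unfolding CRSM_def by simp
  define \<theta> where "\<theta> K = tail_dep M X (\<lambda>x. 1 * indicator K x)" for K
  have \<theta>: "unit_frechet M (\<lambda>\<omega>. X \<omega> K) (\<theta> K)" if "compact K" for K
    using max_stable_unit_frechet_indicator[OF lc X ms that, of 1] unfolding \<theta>_def by simp
  have \<theta>0: "0 \<le> \<theta> K" if "compact K" for K by (rule unit_frechetD(1)[OF \<theta>[OF that]])
  obtain \<nu> :: "real measure" and c F where \<nu>: "prob_space \<nu>" "\<And>x. 0 < c x" "\<And>x. closed (F x)" "\<And>x. F x \<noteq> {}"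
    "(\<lambda>x. scaled_indicator_sm (c x) (F x)) \<in> measurable \<nu> SM"
    and \<nu>_int: "\<And>K. compact K \<Longrightarrow> (\<integral>\<^sup>+x. scaled_indicator_sm (c x) (F x :: 'a set) K \<partial>\<nu>) = ennreal (\<theta> K)"
    by (rule exists_spectral_scaled_indicator[OF lc M X nz \<theta>]) (assumption, rule that)
  obtain N :: "((nat \<Rightarrow> real) \<times> (nat \<Rightarrow> 'a set \<Rightarrow> ennreal)) measure" where YN: "scaled_indicator_marks N fst snd"
    and int: "\<And>K. compact K \<Longrightarrow> (\<integral>\<^sup>+\<omega>. snd \<omega> 0 K \<partial>N) = ennreal (\<theta> K)"
    using scaled_indicator_marks_exist[OF \<nu>] \<nu>_int by auto
  note Y = scaled_indicator_marksD(3)[OF YN, of 0]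
  note Ys = integrable_rsmD(1)[OF Y]
  \<comment> \<open>The tail dependence functional that the marks would produce. It agrees with that
    of \<open>X\<close> on scaled indicators, by the choice of \<nu> and homogeneity of scales, and
    both are comonotone additive.\<close>
  define T' where "T' f = enn2real (\<integral>\<^sup>+\<omega>. extremal_integral f (snd \<omega> 0) \<partial>N)" for f
  have T: "tail_dep M X f = T' f" if f: "f \<in> USC" "finite (range f)" for f
  proof (rule comonotone_additive_unique[OF _ _ _ f])
    fix f g :: "'a \<Rightarrow> real" assume fg: "f \<in> USC" "g \<in> USC" "\<And>x y. 0 \<le> (f x - f y) * (g x - g y)"
    show "tail_dep M X (\<lambda>x. f x + g x) = tail_dep M X f + tail_dep M X g"
      using crsm fg unfolding CRSM_def by simp
    show "T' (\<lambda>x. f x + g x) = T' f + T' g"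
      unfolding T'_def marks_comonotone_additive[OF lc Ys scaled_indicator_marksD(8)[OF YN] fg]
      using marks_extremal_integral_finite[OF lc Y] fg by (intro enn2real_plus) auto
  next
    fix v :: real and K :: "'a set" assume vK: "0 \<le> v" "compact K"
    have "tail_dep M X (\<lambda>x. v * indicator K x) = v * \<theta> K"
      by (rule unit_frechet_unique[OF max_stable_unit_frechet_indicator[OF lc X ms vK(2,1)] unit_frechet_cmult[OF \<theta>[OF vK(2)] M vK(1)]])
    moreover have "T' (\<lambda>x. v * indicator K x) = v * \<theta> K"
    proof -
      have "(\<integral>\<^sup>+\<omega>. extremal_integral (\<lambda>x. v * indicator K x) (snd \<omega> 0) \<partial>N) = (\<integral>\<^sup>+\<omega>. ennreal v * snd \<omega> 0 K \<partial>N)"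
        by (rule nn_integral_cong) (rule extremal_integral_scaled_indicator_fun[OF lc random_sup_measureD(1)[OF Ys] vK(1)])
      also have "\<dots> = ennreal v * ennreal (\<theta> K)"
        using int[OF vK(2)] by (subst nn_integral_cmult[OF random_sup_measureD(2)[OF Ys vK(2)]]) simp
      also have "\<dots> = ennreal (v * \<theta> K)" using vK \<theta>0 by (simp add: ennreal_mult)
      finally show ?thesis unfolding T'_def using vK \<theta>0 by simp
    qed
    ultimately show "tail_dep M X (\<lambda>x. v * indicator K x) = T' (\<lambda>x. v * indicator K x)" by simp
  qed
  have "equal_in_distribution_K M X N (\<lambda>\<omega> K. SUP i. ennreal (1 / fst \<omega> i) * snd \<omega> i K)"
  proof (rule equal_in_distribution_KI[OF M scaled_indicator_marksD(1)[OF YN] random_sup_measureD(2)[OF X] scaled_indicator_marks_measurable(2)[OF YN]])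
    fix J :: "'a set set" and t :: "'a set \<Rightarrow> real"
    assume J: "finite J" "\<And>K. K \<in> J \<Longrightarrow> compact K \<and> 0 < t K"
    obtain g where g: "bij_betw g {..<card J} J"
      using ex_bij_betw_nat_finite[OF J(1)] by (auto simp: atLeast0LessThan)
    \<comment> \<open>Weights \<open>1 / t\<close> rescale all thresholds to the level 1, so the
      joint event becomes one about a single weighted maximum.\<close>
    define u where "u i = 1 / t (g i)" for i
    have gJ: "g i \<in> J" if "i < card J" for i using bij_betwE[OF g] that by auto
    have gK: "compact (g i)" and u0: "0 \<le> u i" if "i < card J" for i
      using J(2)[OF gJ[OF that]] unfolding u_def by auto
    obtain f where f: "f \<in> USC" "finite (range f)" "\<And>x. ennreal (f x) = (SUP i\<in>{..<card J}. ennreal (u i) * indicator (g i) x)"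
      using finite_SUP_indicator_USC[of "card J" g u] gK u0 by blast
    have tJ: "0 < t K" if "K \<in> J" for K using J(2)[OF that] by simp
    have enum: "(\<forall>K\<in>J. x K \<le> ennreal (t K)) \<longleftrightarrow> (SUP i\<in>{..<card J}. ennreal (u i) * x (g i)) \<le> ennreal 1" for x
      unfolding u_def by (rule enum_le_iff_SUP_le[OF g tJ])
    have "measure M {\<omega>\<in>space M. \<forall>K\<in>J. X \<omega> K \<le> ennreal (t K)} = exp (- T' f / 1)"
      unfolding enum using unit_frechetD(3)[OF max_stable_unit_frechet_SUP[OF lc X ms gK u0 f(3)], of 1] T[OF f(1,2)] by simp
    also have "T' f = enn2real (\<integral>\<^sup>+\<omega>. (SUP i\<in>{..<card J}. ennreal (u i) * snd \<omega> 0 (g i)) \<partial>N)"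
      unfolding T'_def
      by (intro arg_cong[where f=enn2real] nn_integral_cong extremal_integral_Max_indicator[OF lc random_sup_measureD(1)[OF Ys] f(3)])
    also have "exp (- \<dots> / 1) = measure N {\<omega>\<in>space N. \<forall>K\<in>J. (SUP i. ennreal (1 / fst \<omega> i) * snd \<omega> i K) \<le> ennreal (t K)}"
      unfolding enum by (rule scaled_indicator_marks_law(2)[OF YN gK u0 zero_less_one, symmetric])
    finally show "measure M {\<omega>\<in>space M. \<forall>K\<in>J. X \<omega> K \<le> ennreal (t K)} =
      measure N {\<omega>\<in>space N. \<forall>K\<in>J. (SUP i. ennreal (1 / fst \<omega> i) * snd \<omega> i K) \<le> ennreal (t K)}" .
  qed
  then show ?thesis using YN unfolding crsm_representation_iff by blast
qed

text \<open>Types cannot be quantified in the existential statement, so it fixes the canonical space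
  of pairs of a point sequence and a mark sequence. The second conjunct concerns representations
  over a probability space of arbitrary type.\<close>

theorem mainTheorem9:
  fixes M :: "'m measure" and X :: "'m \<Rightarrow> 'a::{t2_space, second_countable_topology} set \<Rightarrow> ennreal"
  assumes "locally_compact_space (euclidean :: 'a topology)"
    and "prob_space M"
    and "random_sup_measure M X"
    and "AE \<omega> in M. X \<omega> \<noteq> (\<lambda>_. 0)"
  shows "(CRSM M X \<longleftrightarrow>
            (\<exists>(N :: ((nat \<Rightarrow> real) \<times> (nat \<Rightarrow> 'a set \<Rightarrow> ennreal)) measure) \<Gamma> Y.
                crsm_representation M X N \<Gamma> Y)) \<and>
         (\<forall>(N :: 'n measure) \<Gamma> Y. crsm_representation M X N \<Gamma> Y \<longrightarrow>
            CRSM M X \<and>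
            (\<forall>K. compact K \<longrightarrow> ennreal (ext_coeff M X K) = (\<integral>\<^sup>+ \<omega>. Y \<omega> 0 K \<partial>N)))"
proof (intro conjI iffI allI impI)
  assume "CRSM M X"
  then show "\<exists>(N :: ((nat \<Rightarrow> real) \<times> (nat \<Rightarrow> 'a set \<Rightarrow> ennreal)) measure) \<Gamma> Y. crsm_representation M X N \<Gamma> Y"
    by (rule CRSM_imp_representation[OF assms])
next
  assume "\<exists>(N :: ((nat \<Rightarrow> real) \<times> (nat \<Rightarrow> 'a set \<Rightarrow> ennreal)) measure) \<Gamma> Y. crsm_representation M X N \<Gamma> Y"
  then show "CRSM M X" using representation_imp_CRSM(1)[OF assms(1-3)] by (elim exE)
next
  fix N :: "'n measure" and \<Gamma> Y assume rep: "crsm_representation M X N \<Gamma> Y"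
  show "CRSM M X" by (rule representation_imp_CRSM(1)[OF assms(1-3) rep])
  show "ennreal (ext_coeff M X K) = (\<integral>\<^sup>+ \<omega>. Y \<omega> 0 K \<partial>N)" if "compact K" for K
    by (rule representation_imp_CRSM(2)[OF assms(1-3) rep that])
qed

end
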